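(* Let $\alpha\in[0,\pi)$ and let $\Lambda=\{\lambda_n: n=1,2,\dots\}$ be a sequence of positive real numbers in non-decreasing order with $\delta(\Lambda)>0$. Assume that there exists a decreasing function $\varepsilon(x)$ on $[0,\infty)$ such that $\varepsilon(x)\to 0$ as $x\to\infty$ and $$\lambda(y)-\lambda(x)\le \frac{\alpha}{\pi}\log y-\frac{\alpha}{\pi}\log x+\varepsilon(x)\qquad (y>x\ge 1).$$ Then, in the Banach space $H_\alpha$: (i) $E(\Lambda)=\{z^{\lambda_n}: n=0,1,2,\dots\}$ is minimal; (ii) $\overline{\mathrm{span}}[E(\Lambda)]$ does not contain the function $z^\lambda$ for any complex number $\lambda\notin\Lambda$ with $\operatorname{Re}\lambda>0$; (iii) every function $f\in\overline{\mathrm{span}}[E(\Lambda)]$ can be extended analytically throughout the slit disc $D=\{z\in\mathbb{C}: 0<|z|<1,\ |\arg z|<\pi\}$ (that is, there is an analytic function on $D$ which agrees with $f$ on $I_\alpha\cap D$), with a series expansion of the form $$f(x)=\sum_{k=0}^{\infty}a_k x^{\lambda_k},\qquad 0\le x<1.$$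
   Context: Conventions for the sequence: $\lambda_0=0$, so $0=\lambda_0<\lambda_1\le\lambda_2\le\cdots$, and $\delta(\Lambda)=\inf\{\lambda_{n+1}-\lambda_n: n\ge 0\}$. The characteristic logarithm of $\Lambda$ is $\lambda(t)=\sum_{0<\lambda_n\le t}\lambda_n^{-1}$. Sector and space: for $0\le\alpha<\pi$, $I_\alpha=\{z=re^{i\theta}: 0\le r\le 1,\ |\theta|\le\alpha\}$, and $H_\alpha$ is the Banach space of all complex-valued functions continuous on $I_\alpha$ and analytic in the interior of $I_\alpha$, with norm $\|f\|=\max\{|f(z)|: z\in I_\alpha\}$ (for $\alpha=0$, $H_0=C([0,1])$). Powers: $z^{\lambda}=\exp(\lambda\log z)$ with the principal branch of the logarithm ($|\arg z|<\pi$), with value $0$ at $z=0$ if $\operatorname{Re}\lambda>0$, and $z^{0}=1$. $\mathrm{span}[E]$ is the set of finite (complex) linear combinations of elements of $E$, and $\overline{\mathrm{span}}[E]$ is its closure in $H_\alpha$. A set $E$ in a Banach space is minimal if $e\notin\overline{\mathrm{span}}[E\setminus\{e\}]$ for every $e\in E$. *)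

theory Defs
  imports "HOL-Complex_Analysis.Complex_Analysis" "HOL-Library.Function_Algebras"
begin

definition sector :: "real \<Rightarrow> complex set" where
  "sector \<alpha> = {of_real r * cis \<theta> | r \<theta>. 0 \<le> r \<and> r \<le> 1 \<and> \<bar>\<theta>\<bar> \<le> \<alpha>}"

definition slit_disc :: "complex set" where
  "slit_disc = {z. 0 < norm z \<and> norm z < 1 \<and> \<bar>Arg z\<bar> < pi}"

text \<open>
  Functions on the sector are represented by functions on the whole plane that vanish outside
  the sector.  Then equality of representatives is equality on the sector, and the space is a
  linear subspace of the functions on the plane with pointwise operations.
  For \<open>\<alpha> = 0\<close> the interior is empty and the space is \<open>C([0,1])\<close>.
\<close>

definition H_space :: "real \<Rightarrow> (complex \<Rightarrow> complex) set" where
  "H_space \<alpha> = {f. continuous_on (sector \<alpha>) f \<and> f analytic_on interior (sector \<alpha>) \<and>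
                    (\<forall>z. z \<notin> sector \<alpha> \<longrightarrow> f z = 0)}"

definition H_norm :: "real \<Rightarrow> (complex \<Rightarrow> complex) \<Rightarrow> real" where
  "H_norm \<alpha> f = (SUP z\<in>sector \<alpha>. norm (f z))"

text \<open>
  The value \<open>0\<close> off the space is irrelevant; the locale \<open>Metric_space\<close> asks for nonnegativity
  everywhere, which a supremum of an unbounded set need not satisfy.
\<close>

definition H_dist :: "real \<Rightarrow> (complex \<Rightarrow> complex) \<Rightarrow> (complex \<Rightarrow> complex) \<Rightarrow> real" where
  "H_dist \<alpha> f g = (if f \<in> H_space \<alpha> \<and> g \<in> H_space \<alpha> then H_norm \<alpha> (f - g) else 0)"

abbreviation H_topology :: "real \<Rightarrow> (complex \<Rightarrow> complex) topology" where
  "H_topology \<alpha> \<equiv> Metric_space.mtopology (H_space \<alpha>) (H_dist \<alpha>)"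

global_interpretation cfun: vector_space "\<lambda>(c::complex) (f :: complex \<Rightarrow> complex) z. c * f z"
  by unfold_locales (auto simp: fun_eq_iff algebra_simps)

definition closed_span :: "real \<Rightarrow> (complex \<Rightarrow> complex) set \<Rightarrow> (complex \<Rightarrow> complex) set" where
  "closed_span \<alpha> E = H_topology \<alpha> closure_of (cfun.span E)"

definition minimal_set :: "real \<Rightarrow> (complex \<Rightarrow> complex) set \<Rightarrow> bool" where
  "minimal_set \<alpha> E \<longleftrightarrow> (\<forall>e\<in>E. e \<notin> closed_span \<alpha> (E - {e}))"

text \<open>The library has \<open>0 powr 0 = 0\<close>, but the constant function \<open>z\<^sup>0 = 1\<close> is needed at \<open>0\<close> too.\<close>

definition cpower :: "complex \<Rightarrow> complex \<Rightarrow> complex" where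
  "cpower \<mu> z = (if \<mu> = 0 then 1 else z powr \<mu>)"

definition H_power :: "real \<Rightarrow> complex \<Rightarrow> complex \<Rightarrow> complex" where
  "H_power \<alpha> \<mu> z = (if z \<in> sector \<alpha> then cpower \<mu> z else 0)"

text \<open>Sequences are indexed from \<open>0\<close>, with \<open>\<lambda>\<^sub>0 = 0\<close> not belonging to \<open>\<Lambda>\<close>.\<close>

definition power_system :: "real \<Rightarrow> (nat \<Rightarrow> real) \<Rightarrow> (complex \<Rightarrow> complex) set" where
  "power_system \<alpha> l = range (\<lambda>n. H_power \<alpha> (of_real (l n)))"

definition min_gap :: "(nat \<Rightarrow> real) \<Rightarrow> real" where
  "min_gap l = (INF n. l (Suc n) - l n)"

definition char_log :: "(nat \<Rightarrow> real) \<Rightarrow> real \<Rightarrow> real" where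
  "char_log l t = (\<Sum>n | 0 < l n \<and> l n \<le> t. inverse (l n))"

lemma compact_sector: "compact (sector \<alpha>)"
proof -
  have "sector \<alpha> = (\<lambda>(r, \<theta>). of_real r * cis \<theta>) ` ({0..1} \<times> {-\<alpha>..\<alpha>})"
    by (force simp: sector_def image_iff abs_le_iff)
  moreover have "continuous_on ({0..1} \<times> {-\<alpha>..\<alpha>}) (\<lambda>(r, \<theta>). of_real r * cis \<theta>)"
    by (auto simp: case_prod_unfold cis_conv_exp intro!: continuous_intros)
  ultimately show ?thesis
    by (metis compact_continuous_image compact_Times compact_Icc)
qed

lemma sector_nonempty:
  assumes "0 \<le> \<alpha>"
  shows "sector \<alpha> \<noteq> {}"
proof -
  have "of_real 0 * cis 0 \<in> sector \<alpha>"
    unfolding sector_def using assms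
    by (intro CollectI exI[of _ 0] exI[of _ "0::real"] conjI) auto
  thus ?thesis by blast
qed

lemma subspace_H_space: "cfun.subspace (H_space \<alpha>)"
  unfolding cfun.subspace_def H_space_def zero_fun_def plus_fun_def
  by (auto intro!: continuous_intros analytic_intros)

lemma H_norm_bdd_above:
  assumes "f \<in> H_space \<alpha>"
  shows "bdd_above ((\<lambda>z. norm (f z)) ` sector \<alpha>)"
proof -
  have "compact ((\<lambda>z. norm (f z)) ` sector \<alpha>)"
    using assms by (intro compact_continuous_image compact_sector)
      (auto simp: H_space_def intro!: continuous_intros)
  thus ?thesis
    by (simp add: compact_imp_bounded bounded_imp_bdd_above)
qed

lemma norm_le_H_norm:
  assumes "f \<in> H_space \<alpha>" "z \<in> sector \<alpha>"
  shows "norm (f z) \<le> H_norm \<alpha> f"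
  unfolding H_norm_def using assms by (intro cSUP_upper H_norm_bdd_above)

lemma H_norm_attained:
  assumes "0 \<le> \<alpha>" "f \<in> H_space \<alpha>"
  shows "\<exists>z\<in>sector \<alpha>. H_norm \<alpha> f = norm (f z)"
proof -
  have "\<exists>z\<in>sector \<alpha>. \<forall>y\<in>sector \<alpha>. norm (f y) \<le> norm (f z)"
    using assms sector_nonempty by (intro continuous_attains_sup compact_sector)
      (auto simp: H_space_def intro!: continuous_intros)
  then obtain z where z: "z \<in> sector \<alpha>" "\<forall>y\<in>sector \<alpha>. norm (f y) \<le> norm (f z)" by blast
  have "H_norm \<alpha> f \<le> norm (f z)"
    unfolding H_norm_def using z by (intro cSUP_least) auto
  with norm_le_H_norm[OF assms(2) z(1)] z(1) show ?thesis by force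
qed

lemma Metric_space_H:
  assumes "0 \<le> \<alpha>"
  shows "Metric_space (H_space \<alpha>) (H_dist \<alpha>)"
proof
  have diff: "f - g \<in> H_space \<alpha>" if "f \<in> H_space \<alpha>" "g \<in> H_space \<alpha>" for f g
    using cfun.subspace_diff[OF subspace_H_space] that by blast
  fix f g h
  show "0 \<le> H_dist \<alpha> f g"
    using H_norm_attained[OF assms diff[of f g]] by (auto simp: H_dist_def)
  show "H_dist \<alpha> f g = H_dist \<alpha> g f"
    by (auto simp: H_dist_def H_norm_def norm_minus_commute)
  assume fg: "f \<in> H_space \<alpha>" "g \<in> H_space \<alpha>"
  show "H_dist \<alpha> f g = 0 \<longleftrightarrow> f = g"
  proof
    assume "H_dist \<alpha> f g = 0"
    hence "H_norm \<alpha> (f - g) = 0" using fg by (simp add: H_dist_def)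
    hence "f z = g z" if "z \<in> sector \<alpha>" for z
      using norm_le_H_norm[OF diff[OF fg] that] by simp
    moreover have "f z = g z" if "z \<notin> sector \<alpha>" for z
      using fg that by (simp add: H_space_def)
    ultimately show "f = g" by blast
  qed (use sector_nonempty[OF assms] in \<open>auto simp: H_dist_def H_norm_def\<close>)
  assume h: "h \<in> H_space \<alpha>"
  have "H_norm \<alpha> (f - h) \<le> H_norm \<alpha> (f - g) + H_norm \<alpha> (g - h)"
  proof -
    obtain z where z: "z \<in> sector \<alpha>" "H_norm \<alpha> (f - h) = norm ((f - h) z)"
      using H_norm_attained[OF assms diff[OF fg(1) h]] by blast
    have "norm ((f - h) z) \<le> norm ((f - g) z) + norm ((g - h) z)"
      by (metis diff_add_cancel fun_diff_def norm_diff_triangle_ineq norm_triangle_ineq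
          add_diff_eq)
    thus ?thesis
      using z norm_le_H_norm[OF diff[OF fg] z(1)] norm_le_H_norm[OF diff[OF fg(2) h] z(1)]
      by linarith
  qed
  thus "H_dist \<alpha> f h \<le> H_dist \<alpha> f g + H_dist \<alpha> g h"
    using fg h by (simp add: H_dist_def)
qed

lemma in_closed_span_iff:
  assumes "0 \<le> \<alpha>" "E \<subseteq> H_space \<alpha>"
  shows "f \<in> closed_span \<alpha> E \<longleftrightarrow>
           f \<in> H_space \<alpha> \<and> (\<forall>e>0. \<exists>g\<in>cfun.span E. H_norm \<alpha> (f - g) < e)"
proof -
  interpret Metric_space "H_space \<alpha>" "H_dist \<alpha>"
    by (rule Metric_space_H) fact
  have span: "cfun.span E \<subseteq> H_space \<alpha>"
    by (rule cfun.span_minimal[OF assms(2) subspace_H_space])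
  have "H_dist \<alpha> f g = H_norm \<alpha> (f - g)" if "f \<in> H_space \<alpha>" "g \<in> cfun.span E" for g
    using that span by (auto simp: H_dist_def)
  moreover have "f \<in> closed_span \<alpha> E \<longleftrightarrow>
      f \<in> H_space \<alpha> \<and> (\<forall>e>0. \<exists>g\<in>cfun.span E. g \<in> H_space \<alpha> \<and> H_dist \<alpha> f g < e)"
    unfolding closed_span_def metric_closure_of by auto
  ultimately show ?thesis
    using span by (metis subsetD)
qed

lemma H_power_in_H_space:
  assumes "0 \<le> \<alpha>" "\<alpha> < pi" "\<mu> = 0 \<or> Re \<mu> > 0"
  shows "H_power \<alpha> \<mu> \<in> H_space \<alpha>"
proof -
  have slit: "z \<notin> \<real>\<^sub>\<le>\<^sub>0" if z: "z \<in> sector \<alpha>" "z \<noteq> 0" for z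
  proof -
    obtain r t where rt: "z = of_real r * cis t" "0 \<le> r" "\<bar>t\<bar> \<le> \<alpha>"
      using z(1) by (auto simp: sector_def)
    have "r > 0"
      using rt z(2) by (auto simp: less_le)
    show ?thesis
    proof
      assume "z \<in> \<real>\<^sub>\<le>\<^sub>0"
      hence "sin t = 0" "cos t \<le> 0"
        using rt(1) \<open>r > 0\<close> by (auto simp: complex_nonpos_Reals_iff mult_le_0_iff)
      moreover have "t = 0"
        using sin_eq_0_pi[of t] \<open>sin t = 0\<close> rt(3) assms(2) by linarith
      ultimately show False by simp
    qed
  qed
  have 1: "continuous_on (sector \<alpha>) (cpower \<mu>)"
  proof (cases "\<mu> = 0")
    case False
    hence re: "Re \<mu> > 0" using assms(3) by blast
    have "continuous (at z within sector \<alpha>) (\<lambda>z. z powr \<mu>)" if z: "z \<in> sector \<alpha>" for z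
    proof (cases "z = 0")
      case True
      have "((\<lambda>z. z powr \<mu>) \<longlongrightarrow> 0) (at 0 within sector \<alpha>)"
        using re by (intro tendsto_eq_intros tendsto_powr_complex_0) (auto simp: tendsto_ident_at)
      thus ?thesis using True by (simp add: continuous_within)
    next
      case False
      thus ?thesis
        using isCont_powr_complex[of "\<lambda>z. z" z "\<lambda>_. \<mu>"] slit[OF z False]
        by (simp add: continuous_at_imp_continuous_at_within)
    qed
    thus ?thesis
      using False by (simp add: continuous_on_eq_continuous_within cpower_def[abs_def])
  qed (simp add: cpower_def[abs_def])
  have int0: "0 \<notin> interior (sector \<alpha>)"
  proof
    assume "0 \<in> interior (sector \<alpha>)"
    then obtain e where e: "e > 0" "ball 0 e \<subseteq> sector \<alpha>" by (meson mem_interior)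
    have "- of_real (e / 2) \<in> sector \<alpha>" using e by auto
    thus False using slit[of "- of_real (e / 2)"] e(1) by simp
  qed
  have 2: "cpower \<mu> analytic_on interior (sector \<alpha>)"
  proof (cases "\<mu> = 0")
    case False
    have "(\<lambda>z. z powr \<mu>) analytic_on interior (sector \<alpha>)"
    proof (rule analytic_on_powr[OF analytic_on_ident analytic_on_const])
      fix z assume "z \<in> interior (sector \<alpha>)"
      thus "z \<notin> \<real>\<^sub>\<le>\<^sub>0"
        using slit[of z] int0 interior_subset by blast
    qed
    thus ?thesis using False by (simp add: cpower_def[abs_def])
  qed (simp add: cpower_def[abs_def])
  have "continuous_on (sector \<alpha>) (H_power \<alpha> \<mu>)"
    using 1 by (subst continuous_on_cong[OF refl, of _ _ "cpower \<mu>"]) (auto simp: H_power_def)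
  moreover have "H_power \<alpha> \<mu> analytic_on interior (sector \<alpha>)"
  proof -
    have "H_power \<alpha> \<mu> z = cpower \<mu> z" if "z \<in> interior (sector \<alpha>)" for z
      using that interior_subset[of "sector \<alpha>"] by (auto simp: H_power_def)
    thus ?thesis
      using 2 by (simp add: analytic_on_open cong: holomorphic_cong)
  qed
  ultimately show ?thesis
    by (simp add: H_space_def H_power_def)
qed

end

theory Submission
  imports Defs
begin

text \<open>
  Everything follows from the coefficient estimate \<open>\<bar>a\<^sub>n\<bar> \<le> C\<^sub>\<eta> e\<^bsup>\<eta> \<lambda>\<^sub>n\<^esup> \<parallel>\<Sum> a\<^sub>k z\<^bsup>\<lambda>\<^sub>k\<^esup>\<parallel>\<close>, uniform over all
  finite sums, for every \<open>\<eta> > 0\<close>: it gives minimality, and coefficientwise convergence of approximating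
  sums to a series that converges on the slit disc; the exponent of a power in the closed span is then
  read off the series as \<open>x \<rightarrow> 0\<close>.

  To estimate \<open>a\<^sub>n\<close>, substitute \<open>z = e\<^bsup>-\<rho> w\<^esup>\<close> so that the sector becomes a half-strip of half-width \<open>\<beta> = \<pi>\<close>
  (or \<open>0\<close> if \<open>\<alpha> = 0\<close>). One needs a function \<open>K\<close>, analytic in the right half-plane, that is \<open>1\<close> at the
  \<open>n\<close>-th exponent and \<open>0\<close> at the others, with \<open>\<bar>K(iy)\<bar> \<le> M e\<^bsup>\<beta>\<bar>y\<bar>\<^esup>/(1+\<bar>y\<bar>)\<^sup>2\<close> and with decay on two rays close to the
  positive axis; moving the contour of \<open>\<integral> K(s) \<Sum> a\<^sub>k/(s - \<mu>\<^sub>k) ds\<close> from these rays to the imaginary axis then bounds \<open>a\<^sub>n\<close>.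

  The density hypothesis says that the partial sums of \<open>\<Sum> (N\<^sub>j - 1)/j\<close>, with \<open>N\<^sub>j\<close> the number of
  exponents in \<open>(j-1, j]\<close>, are almost decreasing. Adding a point to suitable empty cells makes this series
  converge. The quotient of the Blaschke product over the completed sequence by that over \<open>{1, \<dots>, J}\<close>,
  times \<open>sin(\<pi>s)/(\<pi>s)\<close>, has modulus at most \<open>e\<^bsup>\<pi>\<bar>y\<bar>\<^esup>\<close> on the imaginary axis because Blaschke factors are
  unimodular there, while on a ray summation by parts shows that the quotient is \<open>e\<^bsup>o(r)\<^esup>\<close> from above and
  below. The lower bound is carried from the ray to the exponent itself using only that the zeros are separated.
\<close>

subsection \<open>Moduli of Blaschke factors on a ray\<close>

text \<open>The scale is \<rho> = \<alpha>/\<pi>: passing from \<open>l n\<close> to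
  \<open>\<rho> * (l n + 1)\<close> turns the logarithmic density \<alpha>/\<pi> into 1, the density
  of the integers, and this is why the sine is the comparison function. For \<alpha> = 0 the density
  is 0 and there is no sine; the number \<open>e\<close>, 1 or 0, treats both cases at once. The
  shift by 1 amounts to multiplying the sums by z: the exponent 0 becomes positive and the sums
  decay along the half-strip. The hypothesis guards only against too many zeros, which would make
  the quotient of Blaschke products too small. With too few it would be too large on the rays; the
  added points prevent that, and they do no harm because K may vanish at further points. Rays are
  used because on the real axis the logarithm of a Blaschke product is singular at the zeros. Off
  the axis it is smooth, and the position of a zero inside its unit cell matters only up to a
  bounded total error. All products are finite, up to J. The constants that reach the result do not
  depend on J; those that do only make the closing sides of contours vanish.\<close>

lemma sum_Poisson_kernel_le:
  fixes r :: real
  assumes "r > 0"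
  shows "(\<Sum>k=1..n. r / (r\<^sup>2 + (real k)\<^sup>2)) \<le> pi / 2"
proof -
  \<comment> \<open>The kernel is the derivative of arctan (x / r) in x and decreases for x > 0, so
    each term is at most an increment of arctan and the sum telescopes to less than \<pi>/2,
    whatever n and r are.\<close>
  have step: "r / (r\<^sup>2 + (real (Suc k))\<^sup>2) \<le> arctan (real (Suc k) / r) - arctan (real k / r)" for k
  proof -
    have "\<exists>z>real k / r. z < real (Suc k) / r \<and>
        arctan (real (Suc k) / r) - arctan (real k / r) = (real (Suc k) / r - real k / r) * inverse (1 + z\<^sup>2)"
      using assms by (intro MVT2 DERIV_arctan) (auto simp: divide_strict_right_mono)
    then obtain z where z: "real k / r < z" "z < real (Suc k) / r"
      "arctan (real (Suc k) / r) - arctan (real k / r) = (real (Suc k) / r - real k / r) * inverse (1 + z\<^sup>2)"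
      by blast
    have "0 \<le> real k / r" using assms by simp
    hence "0 < z" using z(1) by linarith
    have "z\<^sup>2 \<le> (real (Suc k) / r)\<^sup>2"
      using z \<open>0 < z\<close> by (intro power_mono) auto
    hence "inverse (1 + (real (Suc k) / r)\<^sup>2) \<le> inverse (1 + z\<^sup>2)"
      by (intro le_imp_inverse_le) (auto intro: add_pos_nonneg)
    hence "1 / r * inverse (1 + (real (Suc k) / r)\<^sup>2) \<le> 1 / r * inverse (1 + z\<^sup>2)"
      using assms by (intro mult_left_mono) auto
    moreover have "real (Suc k) / r - real k / r = 1 / r"
      by (simp add: diff_divide_distrib [symmetric])
    moreover have "r / (r\<^sup>2 + (real (Suc k))\<^sup>2) = 1 / r * inverse (1 + (real (Suc k) / r)\<^sup>2)"
      using assms by (simp add: field_simps power2_eq_square)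
    ultimately show ?thesis
      using z(3) by presburger
  qed
  have "(\<Sum>k=1..n. r / (r\<^sup>2 + (real k)\<^sup>2)) \<le> arctan (real n / r)"
  proof (induction n)
    case (Suc n)
    thus ?case using step[of n] by (simp del: of_nat_Suc)
  qed auto
  thus ?thesis using arctan_ubound[of "real n / r"] by linarith
qed

text \<open>The products increase to sinh(\<pi>z)/(\<pi>z), by the sine product on the imaginary
  axis, and |sinh t| \<le> |t| exp |t|. The later comparisons of a product at a point with the
  product at its real part all end in this bound.\<close>

lemma prod_one_plus_square_le_exp:
  fixes z :: real
  shows "(\<Prod>k=1..n. 1 + z\<^sup>2 / (real k)\<^sup>2) \<le> exp (pi * \<bar>z\<bar>)"
proof (cases "z = 0")
  case False
  let ?P = "\<lambda>n. \<Prod>k=1..n. 1 + z\<^sup>2 / (real k)\<^sup>2"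
  define w where "w = \<i> * of_real z"
  have "(\<lambda>n. norm (of_real pi * w * (\<Prod>k=1..n. 1 - w\<^sup>2 / of_nat k^2))) \<longlonglongrightarrow> norm (sin (of_real pi * w))"
    by (intro tendsto_norm sin_product_formula_complex)
  also have "(\<lambda>n. norm (of_real pi * w * (\<Prod>k=1..n. 1 - w\<^sup>2 / of_nat k^2))) = (\<lambda>n. pi * \<bar>z\<bar> * ?P n)"
  proof
    fix n
    have X: "(\<Prod>k=1..n. 1 - w\<^sup>2 / of_nat k^2) = of_real (?P n)"
      by (simp add: w_def power_mult_distrib)
    have "?P n \<ge> 0" by (intro prod_nonneg) auto
    hence "\<bar>?P n\<bar> = ?P n" by (rule abs_of_nonneg)
    thus "norm (of_real pi * w * (\<Prod>k=1..n. 1 - w\<^sup>2 / of_nat k^2)) = pi * \<bar>z\<bar> * ?P n"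
      unfolding X unfolding norm_mult w_def norm_of_real norm_ii by simp
  qed
  finally have lim: "(\<lambda>n. pi * \<bar>z\<bar> * ?P n) \<longlonglongrightarrow> norm (sin (of_real pi * w))" .
  have mono: "incseq (\<lambda>n. pi * \<bar>z\<bar> * ?P n)"
  proof (rule incseq_SucI)
    fix n
    have "?P n \<ge> 0" by (intro prod_nonneg) auto
    hence "?P n \<le> ?P (Suc n)" by (simp add: algebra_simps)
    thus "pi * \<bar>z\<bar> * ?P n \<le> pi * \<bar>z\<bar> * ?P (Suc n)" by (intro mult_left_mono) auto
  qed
  have le: "pi * \<bar>z\<bar> * ?P n \<le> norm (sin (of_real pi * w))"
    using incseq_le[OF mono lim] .
  have sn: "norm (sin (of_real pi * w)) = \<bar>sinh (pi * z)\<bar>"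
  proof -
    have a: "\<i> * (of_real pi * w) = of_real (- (pi * z))"
      by (simp add: w_def algebra_simps flip: power2_eq_square)
    have "sin (of_real pi * w) = \<i> * (exp (- (\<i> * (of_real pi * w))) - exp (\<i> * (of_real pi * w))) / 2"
    proof -
      have "(A - B) / (2 * \<i>) = \<i> * (B - A) / 2" for A B :: complex
        by (simp add: field_simps)
      thus ?thesis by (simp add: sin_exp_eq)
    qed
    also have "\<dots> = \<i> * of_real (sinh (pi * z))"
      unfolding a by (simp add: sinh_field_def exp_of_real [symmetric])
    finally have "sin (of_real pi * w) = \<i> * of_real (sinh (pi * z))" .
    thus ?thesis by (simp add: norm_mult)
  qed
  have sb: "\<bar>sinh t\<bar> \<le> \<bar>t\<bar> * exp \<bar>t\<bar>" for t :: real
  proof -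
    have *: "sinh t \<le> t * exp t" if "t \<ge> 0" for t :: real
    proof -
      have "1 - exp (-(2*t)) \<le> 2 * t" using exp_ge_add_one_self[of "-(2*t)"] by linarith
      hence "exp t * (1 - exp (-(2*t))) \<le> exp t * (2 * t)" by (intro mult_left_mono) auto
      moreover have "exp t * exp (-(2*t)) = exp (-t)" by (simp flip: exp_add)
      ultimately have "exp t - exp (-t) \<le> 2 * (t * exp t)" by (simp add: algebra_simps)
      thus ?thesis by (simp add: sinh_field_def)
    qed
    show ?thesis using *[of "\<bar>t\<bar>"] by (cases "t \<ge> 0") auto
  qed
  have "\<bar>sinh (pi * z)\<bar> \<le> pi * \<bar>z\<bar> * exp (pi * \<bar>z\<bar>)"
    using sb[of "pi * z"] by (simp add: abs_mult)
  hence "pi * \<bar>z\<bar> * ?P n \<le> pi * \<bar>z\<bar> * exp (pi * \<bar>z\<bar>)"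
    using le sn by linarith
  thus ?thesis using False by (simp add: mult_le_cancel_left)
qed auto

text \<open>For \<open>c = cos \<theta>\<close> this is \<open>ln \<bar>(t - e\<^bsup>i\<theta>\<^esup>)/(t + e\<^bsup>i\<theta>\<^esup>)\<bar>\<close>.\<close>

definition sector_log :: "real \<Rightarrow> real \<Rightarrow> real" where
  "sector_log c t = (ln (t\<^sup>2 - 2 * c * t + 1) - ln (t\<^sup>2 + 2 * c * t + 1)) / 2"

lemma quadratic_pos:
  fixes c t :: real
  assumes "\<bar>c\<bar> < 1"
  shows "t\<^sup>2 - 2 * c * t + 1 > 0" "t\<^sup>2 + 2 * c * t + 1 > 0"
proof -
  have c: "c\<^sup>2 < 1" using assms by (simp add: abs_square_less_1)
  have "t\<^sup>2 - 2 * c * t + 1 = (t - c)\<^sup>2 + (1 - c\<^sup>2)" "t\<^sup>2 + 2 * c * t + 1 = (t + c)\<^sup>2 + (1 - c\<^sup>2)"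
    by (simp_all add: power2_eq_square algebra_simps)
  thus "t\<^sup>2 - 2 * c * t + 1 > 0" "t\<^sup>2 + 2 * c * t + 1 > 0"
    using c zero_le_power2[of "t - c"] zero_le_power2[of "t + c"] by linarith+
qed

lemma Blaschke_factor_eq_sector_log:
  fixes t r \<theta> :: real
  assumes "r > 0" "\<bar>cos \<theta>\<bar> < 1"
  defines "s \<equiv> of_real r * cis \<theta>"
  shows "norm ((of_real t - s) / (of_real t + s)) = exp (sector_log (cos \<theta>) (t / r))"
    "norm ((of_real t - cnj s) / (of_real t + cnj s)) = exp (sector_log (cos \<theta>) (t / r))"
proof -
  let ?c = "cos \<theta>" and ?u = "t / r"
  have sc: "(sin \<theta>)\<^sup>2 = 1 - ?c\<^sup>2" by (simp add: sin_squared_eq)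
  have 1: "(norm (of_real t - s))\<^sup>2 = r\<^sup>2 * (?u\<^sup>2 - 2 * ?c * ?u + 1)"
  proof -
    have "(norm (of_real t - s))\<^sup>2 = (t - r * ?c)\<^sup>2 + (r * sin \<theta>)\<^sup>2"
      by (simp add: s_def cmod_power2)
    also have "\<dots> = (t - r * ?c)\<^sup>2 + r\<^sup>2 * (1 - ?c\<^sup>2)" by (simp add: power_mult_distrib sc)
    also have "\<dots> = r\<^sup>2 * (?u\<^sup>2 - 2 * ?c * ?u + 1)"
      using assms(1) by (simp add: field_simps power2_eq_square)
    finally show ?thesis .
  qed
  have 2: "(norm (of_real t + s))\<^sup>2 = r\<^sup>2 * (?u\<^sup>2 + 2 * ?c * ?u + 1)"
  proof -
    have "(norm (of_real t + s))\<^sup>2 = (t + r * ?c)\<^sup>2 + (r * sin \<theta>)\<^sup>2"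
      by (simp add: s_def cmod_power2)
    also have "\<dots> = (t + r * ?c)\<^sup>2 + r\<^sup>2 * (1 - ?c\<^sup>2)" by (simp add: power_mult_distrib sc)
    also have "\<dots> = r\<^sup>2 * (?u\<^sup>2 + 2 * ?c * ?u + 1)"
      using assms(1) by (simp add: field_simps power2_eq_square)
    finally show ?thesis .
  qed
  note p = quadratic_pos[OF assms(2), of ?u]
  have "(norm ((of_real t - s) / (of_real t + s)))\<^sup>2 = (exp (sector_log ?c ?u))\<^sup>2"
  proof -
    have "(exp (sector_log ?c ?u))\<^sup>2 = exp (2 * sector_log ?c ?u)"
      by (simp add: exp_double)
    also have "2 * sector_log ?c ?u = ln (?u\<^sup>2 - 2 * ?c * ?u + 1) - ln (?u\<^sup>2 + 2 * ?c * ?u + 1)"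
      by (simp add: sector_log_def)
    also have "exp \<dots> = (?u\<^sup>2 - 2 * ?c * ?u + 1) / (?u\<^sup>2 + 2 * ?c * ?u + 1)"
      by (simp only: exp_diff exp_ln[OF p(1)] exp_ln[OF p(2)])
    also have "\<dots> = (norm (of_real t - s))\<^sup>2 / (norm (of_real t + s))\<^sup>2"
      unfolding 1 2 using assms(1) by simp
    finally show ?thesis by (simp add: norm_divide power_divide)
  qed
  thus A: "norm ((of_real t - s) / (of_real t + s)) = exp (sector_log ?c ?u)"
    by (simp add: power2_eq_iff_nonneg)
  have "(of_real t - cnj s) / (of_real t + cnj s) = cnj ((of_real t - s) / (of_real t + s))"
    by simp
  thus "norm ((of_real t - cnj s) / (of_real t + cnj s)) = exp (sector_log ?c ?u)"
    using A by (simp only: complex_mod_cnj)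
qed

text \<open>The difference of the two sides is the square
  \<open>c\<^sup>2 * (t\<^sup>2 - 1)\<^sup>2\<close>. The left side is the denominator in the
  derivative of \<open>sector_log\<close>, which for |c| < 1 is thus at least of the order (1 +
  t^2)^2.\<close>

lemma denominators_bound:
  fixes c t :: real
  shows "(t\<^sup>2 - 2 * c * t + 1) * (t\<^sup>2 + 2 * c * t + 1) \<ge> (1 - c\<^sup>2) * (t\<^sup>2 + 1)\<^sup>2"
proof -
  have "(t\<^sup>2 - 2 * c * t + 1) * (t\<^sup>2 + 2 * c * t + 1) - (1 - c\<^sup>2) * (t\<^sup>2 + 1)\<^sup>2 = c\<^sup>2 * (t\<^sup>2 - 1)\<^sup>2"
    by (simp add: power2_eq_square algebra_simps)
  moreover have "c\<^sup>2 * (t\<^sup>2 - 1)\<^sup>2 \<ge> 0" by simp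
  ultimately show ?thesis by linarith
qed

lemma sector_log_deriv:
  fixes c t :: real
  assumes "\<bar>c\<bar> < 1"
  defines "D \<equiv> (t\<^sup>2 - 2 * c * t + 1) * (t\<^sup>2 + 2 * c * t + 1)"
  shows "(sector_log c has_real_derivative 2 * c * (t\<^sup>2 - 1) / D) (at t)"
proof -
  note p = quadratic_pos[OF assms(1), of t]
  have "(sector_log c has_real_derivative
     ((2 * t - 2 * c) / (t\<^sup>2 - 2 * c * t + 1) - (2 * t + 2 * c) / (t\<^sup>2 + 2 * c * t + 1)) / 2) (at t)"
    unfolding sector_log_def [abs_def] using p
    by (auto intro!: derivative_eq_intros)
  also have "((2 * t - 2 * c) / (t\<^sup>2 - 2 * c * t + 1) - (2 * t + 2 * c) / (t\<^sup>2 + 2 * c * t + 1)) / 2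
     = 2 * c * (t\<^sup>2 - 1) / D"
  proof -
    have *: "A / p - B / q = (A * q - B * p) / (p * q)" if "p > 0" "q > 0" for A B p q :: real
      using that by (simp add: field_simps)
    have "(2 * t - 2 * c) * (t\<^sup>2 + 2 * c * t + 1) - (2 * t + 2 * c) * (t\<^sup>2 - 2 * c * t + 1)
        = 2 * (2 * c * (t\<^sup>2 - 1))"
      by (simp add: power2_eq_square algebra_simps)
    thus ?thesis unfolding D_def *[OF p, of "2 * t - 2 * c" "2 * t + 2 * c"] by simp
  qed
  finally show ?thesis .
qed

text \<open>After the rescaling t = x / r the decay 1/(1 + t^2) becomes the Poisson kernel, so
  moving all points inside their unit cells will cost only a bounded amount.\<close>

lemma sector_log_deriv_bound:
  fixes c t :: real
  assumes "\<bar>c\<bar> < 1"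
  defines "D \<equiv> (t\<^sup>2 - 2 * c * t + 1) * (t\<^sup>2 + 2 * c * t + 1)"
  shows "\<bar>2 * c * (t\<^sup>2 - 1) / D\<bar> \<le> 2 / (1 - c\<^sup>2) / (1 + t\<^sup>2)"
proof -
  have c: "c\<^sup>2 < 1" using assms by (simp add: abs_square_less_1)
  have t1: "t\<^sup>2 + 1 > 0" by (auto intro: add_nonneg_pos)
  have D: "D \<ge> (1 - c\<^sup>2) * (t\<^sup>2 + 1)\<^sup>2" unfolding D_def by (rule denominators_bound)
  have pos: "(1 - c\<^sup>2) * (t\<^sup>2 + 1)\<^sup>2 > 0"
    using c by (intro mult_pos_pos zero_less_power) (auto intro: add_nonneg_pos)
  have num: "\<bar>2 * c * (t\<^sup>2 - 1)\<bar> \<le> 2 * (t\<^sup>2 + 1)"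
  proof -
    have "\<bar>t\<^sup>2 - 1\<bar> \<le> t\<^sup>2 + 1" by (auto simp: abs_if)
    hence "\<bar>c\<bar> * \<bar>t\<^sup>2 - 1\<bar> \<le> 1 * (t\<^sup>2 + 1)" using assms by (intro mult_mono) auto
    thus ?thesis by (simp add: abs_mult)
  qed
  have "\<bar>2 * c * (t\<^sup>2 - 1) / D\<bar> = \<bar>2 * c * (t\<^sup>2 - 1)\<bar> / D" using D pos by (simp add: abs_divide)
  also have "\<dots> \<le> (2 * (t\<^sup>2 + 1)) / ((1 - c\<^sup>2) * (t\<^sup>2 + 1)\<^sup>2)"
    using num D pos by (intro frac_le) auto
  also have "\<dots> = 2 / (1 - c\<^sup>2) / (1 + t\<^sup>2)"
  proof -
    have "2 * u / (b * u\<^sup>2) = 2 / b / u" if "u > 0" "b > 0" for u b :: real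
      using that by (simp add: power2_eq_square field_simps)
    from this[of "t\<^sup>2 + 1" "1 - c\<^sup>2"] show ?thesis
      using c t1 by (simp add: add.commute[of "t\<^sup>2"])
  qed
  finally show ?thesis .
qed

text \<open>\<open>sector_log c t\<close> equals -artanh q, with leading term -q and an error of
  order at most q^2. As q is largest at t = 1, where it is c, it stays away from the singularity of
  artanh at 1.\<close>

lemma sector_log_approx:
  fixes c t :: real
  assumes "\<bar>c\<bar> < 1" "0 \<le> c" "0 \<le> t"
  defines "q \<equiv> 2 * c * t / (t\<^sup>2 + 1)"
  shows "\<bar>sector_log c t + q\<bar> \<le> q\<^sup>2 / (1 - c)"
proof -
  have t1: "t\<^sup>2 + 1 > 0" by (auto intro: add_nonneg_pos)
  note p = quadratic_pos[OF assms(1), of t]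
  have q0: "0 \<le> q" unfolding q_def using assms t1 by simp
  have qc: "q \<le> c"
  proof -
    have "c * (t - 1)\<^sup>2 \<ge> 0" using assms by simp
    hence "2 * c * t \<le> c * (t\<^sup>2 + 1)" by (simp add: power2_eq_square algebra_simps)
    thus ?thesis unfolding q_def using t1 by (simp add: pos_divide_le_eq)
  qed
  have q1: "q < 1" using qc assms by linarith
  have e1: "t\<^sup>2 - 2 * c * t + 1 = (t\<^sup>2 + 1) * (1 - q)" and e2: "t\<^sup>2 + 2 * c * t + 1 = (t\<^sup>2 + 1) * (1 + q)"
    unfolding q_def using t1 by (simp_all add: field_simps)
  have S: "2 * sector_log c t = ln (1 - q) - ln (1 + q)"
    unfolding sector_log_def e1 e2 using t1 q0 q1 by (simp add: ln_mult)
  have "ln (1 + q) \<le> q" using q0 ln_le_minus_one[of "1+q"] by simp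
  moreover have "ln (1 - q) \<le> - q" using q1 ln_le_minus_one[of "1-q"] by simp
  moreover have "- ln (1 + q) \<le> - q + q\<^sup>2"
  proof -
    have "ln (1 / (1 + q)) \<le> 1 / (1 + q) - 1" using q0 by (intro ln_le_minus_one) simp
    also have "1 / (1 + q) - 1 \<le> - q + q\<^sup>2"
    proof -
      have "1 \<le> (1 - q + q\<^sup>2) * (1 + q)" using q0 by (simp add: power2_eq_square algebra_simps)
      hence "1 / (1 + q) \<le> 1 - q + q\<^sup>2" using q0 by (simp add: pos_divide_le_eq)
      thus ?thesis by simp
    qed
    finally show ?thesis using q0 by (simp add: ln_div)
  qed
  moreover have "- ln (1 - q) \<le> q + q\<^sup>2 / (1 - q)"
  proof -
    have "ln (1 / (1 - q)) \<le> 1 / (1 - q) - 1" using q1 by (intro ln_le_minus_one) simp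
    also have "\<dots> = q + q\<^sup>2 / (1 - q)" using q1 by (simp add: field_simps power2_eq_square)
    finally show ?thesis using q1 by (simp add: ln_div)
  qed
  moreover have "q\<^sup>2 / (1 - q) \<le> q\<^sup>2 / (1 - c)" using qc assms by (intro divide_left_mono) auto
  moreover have "q\<^sup>2 \<le> q\<^sup>2 / (1 - c)"
  proof -
    have "q\<^sup>2 / 1 \<le> q\<^sup>2 / (1 - c)" using assms by (intro divide_left_mono) auto
    thus ?thesis by simp
  qed
  ultimately show ?thesis using S by linarith
qed

text \<open>This concerns the derivative of t * \<open>sector_log c t\<close>. Each of its two
  summands decays only like 1/t, but up to O(1/(1 + t^2)) they are -q and q, so the leading terms
  cancel. Hence the increments of j * \<open>sector_log c (j / r)\<close> used in the summation by
  parts add up to only O(r).\<close>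

lemma mult_sector_log_deriv_bound:
  fixes c t :: real
  assumes "\<bar>c\<bar> < 1" "0 \<le> c" "0 \<le> t"
  defines "D \<equiv> (t\<^sup>2 - 2 * c * t + 1) * (t\<^sup>2 + 2 * c * t + 1)"
  shows "\<bar>sector_log c t + t * (2 * c * (t\<^sup>2 - 1) / D)\<bar> \<le> (4 / (1 - c) + 6 / (1 - c\<^sup>2)) / (1 + t\<^sup>2)"
proof -
  define q where "q = 2 * c * t / (t\<^sup>2 + 1)"
  have t1: "t\<^sup>2 + 1 > 0" by (auto intro: add_nonneg_pos)
  have c: "c\<^sup>2 < 1" using assms by (simp add: abs_square_less_1)
  have q2: "q\<^sup>2 \<le> 4 / (1 + t\<^sup>2)"
  proof -
    have "c\<^sup>2 * t\<^sup>2 \<le> 1 * (t\<^sup>2 + 1)" using c by (intro mult_mono) auto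
    hence "4 * c\<^sup>2 * t\<^sup>2 / (t\<^sup>2 + 1)\<^sup>2 \<le> 4 * (t\<^sup>2 + 1) / (t\<^sup>2 + 1)\<^sup>2" by (intro divide_right_mono) auto
    also have "\<dots> = 4 / (1 + t\<^sup>2)"
    proof -
      have "4 * u / u\<^sup>2 = 4 / u" if "u > 0" for u :: real
        using that by (simp add: power2_eq_square field_simps)
      from this[OF t1] show ?thesis by (simp add: add.commute)
    qed
    finally show ?thesis by (simp add: q_def power_divide power_mult_distrib)
  qed
  have 1: "\<bar>sector_log c t + q\<bar> \<le> 4 / (1 - c) / (1 + t\<^sup>2)"
  proof -
    have "\<bar>sector_log c t + q\<bar> \<le> q\<^sup>2 / (1 - c)" unfolding q_def using assms by (intro sector_log_approx)
    also have "\<dots> \<le> 4 / (1 + t\<^sup>2) / (1 - c)" using q2 assms by (intro divide_right_mono) auto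
    finally show ?thesis by (simp add: field_simps)
  qed
  have D: "D \<ge> (1 - c\<^sup>2) * (t\<^sup>2 + 1)\<^sup>2" unfolding D_def by (rule denominators_bound)
  have pos: "(1 - c\<^sup>2) * (t\<^sup>2 + 1)\<^sup>2 > 0"
    using c t1 by (intro mult_pos_pos zero_less_power) auto
  have "t * (2 * c * (t\<^sup>2 - 1) / D) - q = 2 * c * t * ((t\<^sup>2 - 1) * (t\<^sup>2 + 1) - D) / (D * (t\<^sup>2 + 1))"
  proof -
    have "t * (A * x / D) - A * t / y = A * t * (x * y - D) / (D * y)" if "D \<noteq> 0" "y \<noteq> 0" for A x y
      using that by (simp add: field_simps)
    thus ?thesis unfolding q_def using D pos t1 by auto
  qed
  also have "(t\<^sup>2 - 1) * (t\<^sup>2 + 1) - D = 4 * c\<^sup>2 * t\<^sup>2 - 2 * (t\<^sup>2 + 1)"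
    unfolding D_def by (simp add: power2_eq_square algebra_simps)
  finally have e: "t * (2 * c * (t\<^sup>2 - 1) / D) - q = 2 * c * t * (4 * c\<^sup>2 * t\<^sup>2 - 2 * (t\<^sup>2 + 1)) / (D * (t\<^sup>2 + 1))" .
  have 2: "\<bar>t * (2 * c * (t\<^sup>2 - 1) / D) - q\<bar> \<le> 6 / (1 - c\<^sup>2) / (1 + t\<^sup>2)"
  proof -
    have "c\<^sup>2 * t\<^sup>2 \<le> 1 * (t\<^sup>2 + 1)" using c by (intro mult_mono) auto
    hence "\<bar>4 * c\<^sup>2 * t\<^sup>2 - 2 * (t\<^sup>2 + 1)\<bar> \<le> 6 * (t\<^sup>2 + 1)"
      using t1 mult_nonneg_nonneg[OF zero_le_power2[of c] zero_le_power2[of t]]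
      unfolding abs_le_iff mult.assoc by linarith
    moreover have "\<bar>2 * c * t\<bar> \<le> t\<^sup>2 + 1"
    proof -
      have "c * t \<le> 1 * t" using assms by (intro mult_right_mono) auto
      moreover have "(t - 1)\<^sup>2 \<ge> 0" by simp
      hence "2 * t \<le> t\<^sup>2 + 1" by (simp add: power2_eq_square algebra_simps)
      ultimately show ?thesis using assms by simp
    qed
    ultimately have "\<bar>2 * c * t\<bar> * \<bar>4 * c\<^sup>2 * t\<^sup>2 - 2 * (t\<^sup>2 + 1)\<bar> \<le> (t\<^sup>2 + 1) * (6 * (t\<^sup>2 + 1))"
      by (intro mult_mono) auto
    hence "\<bar>2 * c * t * (4 * c\<^sup>2 * t\<^sup>2 - 2 * (t\<^sup>2 + 1))\<bar> \<le> (t\<^sup>2 + 1) * (6 * (t\<^sup>2 + 1))"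
      by (simp only: abs_mult)
    moreover have "D * (t\<^sup>2 + 1) \<ge> (1 - c\<^sup>2) * (t\<^sup>2 + 1)\<^sup>2 * (t\<^sup>2 + 1)"
      using D t1 by (intro mult_right_mono) auto
    moreover have "(1 - c\<^sup>2) * (t\<^sup>2 + 1)\<^sup>2 * (t\<^sup>2 + 1) > 0" using pos t1 by (rule mult_pos_pos)
    ultimately have "\<bar>2 * c * t * (4 * c\<^sup>2 * t\<^sup>2 - 2 * (t\<^sup>2 + 1))\<bar> / (D * (t\<^sup>2 + 1))
        \<le> (t\<^sup>2 + 1) * (6 * (t\<^sup>2 + 1)) / ((1 - c\<^sup>2) * (t\<^sup>2 + 1)\<^sup>2 * (t\<^sup>2 + 1))"
      by (intro frac_le) auto
    also have "\<dots> = 6 / (1 - c\<^sup>2) / (1 + t\<^sup>2)"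
    proof -
      have "u * (6 * u) / (b * u\<^sup>2 * u) = 6 / b / u" if "u > 0" "b > 0" for u b :: real
        using that by (simp add: power2_eq_square field_simps)
      from this[OF t1, of "1 - c\<^sup>2"] show ?thesis using c by (simp add: add.commute)
    qed
    finally have "\<bar>2 * c * t * (4 * c\<^sup>2 * t\<^sup>2 - 2 * (t\<^sup>2 + 1))\<bar> / (D * (t\<^sup>2 + 1))
        \<le> 6 / (1 - c\<^sup>2) / (1 + t\<^sup>2)" .
    moreover have "D * (t\<^sup>2 + 1) > 0" using D pos t1 by (intro mult_pos_pos) auto
    ultimately show ?thesis unfolding e abs_divide by simp
  qed
  have "\<bar>sector_log c t + t * (2 * c * (t\<^sup>2 - 1) / D)\<bar> \<le> 4 / (1 - c) / (1 + t\<^sup>2) + 6 / (1 - c\<^sup>2) / (1 + t\<^sup>2)"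
    using 1 2 by linarith
  thus ?thesis by (simp add: add_divide_distrib)
qed

subsection \<open>Completing the exponents to a regular sequence\<close>

lemma greedy_correction_converges:
  fixes u :: "nat \<Rightarrow> real"
  assumes lower: "\<And>j. u (Suc j) \<ge> - 1 / real (Suc j)"
    and upper: "\<And>\<eta>. \<eta> > 0 \<Longrightarrow> \<exists>I0. \<forall>I\<ge>I0. \<forall>J\<ge>I. (\<Sum>j\<in>{I<..J}. u j) \<le> \<eta>"
  obtains F :: "nat set" where "\<And>j. j \<in> F \<Longrightarrow> j \<ge> 1 \<and> u j < 0"
    "convergent (\<lambda>J. \<Sum>j=1..J. u j + (if j \<in> F then 1 / real j else 0))"
proof -
  \<comment> \<open>Add \<open>1/j\<close> only when the running sum would become negative. A rise of the corrected sums is then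
    either a rise of the given sums or ends below \<open>1/j\<close>, so they are nonnegative and almost decreasing.\<close>
  define T where "T = rec_nat (0::real) (\<lambda>j t. t + u (Suc j) + (if t + u (Suc j) < 0 then 1 / real (Suc j) else 0))"
  have T0: "T 0 = 0" and TS: "T (Suc j) = T j + u (Suc j) + (if T j + u (Suc j) < 0 then 1 / real (Suc j) else 0)" for j
    by (simp_all add: T_def)
  define F where "F = {j. j \<ge> 1 \<and> T (j - 1) + u j < 0}"
  have Tsum: "T J = (\<Sum>j=1..J. u j + (if j \<in> F then 1 / real j else 0))" for J
    by (induction J) (auto simp: T0 TS F_def)
  have Tpos: "T j \<ge> 0" for j
  proof (induction j)
    case (Suc j)
    \<comment> \<open>One correction by 1/j suffices, because a single term of \<open>u\<close>
      lowers the sum by at most 1/j.\<close>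
    have "T j + u (Suc j) \<ge> - (1 / real (Suc j))" using lower[of j] Suc by simp
    thus ?case unfolding TS by auto
  qed (simp add: T0)
  have FF: "j \<ge> 1 \<and> u j < 0" if "j \<in> F" for j
    using that Tpos[of "j - 1"] by (auto simp: F_def)
  \<comment> \<open>After a correction the running sum is only known to lie below 1/j. Building 1/I
    into \<open>T'\<close> ensures that a correction after I does not count as a rise.\<close>
  define T' where "T' I = max (T I) (1 / real I)" for I
  \<comment> \<open>The index i is the last one in (I, J] at which a correction was made, or I if
    there is none; from i to J only \<open>u\<close> is summed.\<close>
  have reset: "\<exists>i\<ge>I. i \<le> J \<and> T i \<le> T' I \<and> T J = T i + (\<Sum>j\<in>{i<..J}. u j)" if "I \<ge> 1" "I \<le> J" for I J
    using that(2)
  proof (induction J rule: dec_induct)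
    case base
    show ?case by (intro exI[of _ I]) (auto simp: T'_def)
  next
    case (step J)
    show ?case
    proof (cases "T J + u (Suc J) < 0")
      case True
      have "T (Suc J) \<le> 1 / real (Suc J)" unfolding TS using True by simp
      also have "\<dots> \<le> 1 / real I" using step that(1) by (intro divide_left_mono) auto
      finally show ?thesis using step by (intro exI[of _ "Suc J"]) (auto simp: T'_def)
    next
      case False
      from step.IH obtain i where i: "i \<ge> I" "i \<le> J" "T i \<le> T' I" "T J = T i + (\<Sum>j\<in>{i<..J}. u j)" by blast
      have "{i<..Suc J} = insert (Suc J) {i<..J}" using i by auto
      hence "(\<Sum>j\<in>{i<..Suc J}. u j) = u (Suc J) + (\<Sum>j\<in>{i<..J}. u j)" by simp
      thus ?thesis using i False by (intro exI[of _ i]) (auto simp: TS)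
    qed
  qed
  have almost_dec: "\<exists>I0\<ge>1. \<forall>I\<ge>I0. \<forall>J\<ge>I. T' J \<le> T' I + \<eta>" if \<eta>: "\<eta> > 0" for \<eta>
  proof -
    obtain I0 where I0: "\<forall>I\<ge>I0. \<forall>J\<ge>I. (\<Sum>j\<in>{I<..J}. u j) \<le> \<eta>" using upper[OF \<eta>] by blast
    have "T' J \<le> T' I + \<eta>" if IJ: "I \<ge> max 1 I0" "J \<ge> I" for I J
    proof -
      obtain i where i: "i \<ge> I" "i \<le> J" "T i \<le> T' I" "T J = T i + (\<Sum>j\<in>{i<..J}. u j)"
        using reset[of I J] IJ by auto
      have "(\<Sum>j\<in>{i<..J}. u j) \<le> \<eta>" using i I0 IJ by auto
      hence "T J \<le> T' I + \<eta>" using i by linarith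
      moreover have "1 / real J \<le> 1 / real I" using IJ by (intro divide_left_mono) auto
      hence "1 / real J \<le> T' I + \<eta>" using \<eta> unfolding T'_def by linarith
      ultimately show ?thesis by (simp add: T'_def)
    qed
    thus ?thesis by (intro exI[of _ "max 1 I0"]) auto
  qed
  have T'pos: "T' I \<ge> 0" for I using Tpos[of I] by (auto simp: T'_def)
  obtain I1 where I1: "\<forall>I\<ge>I1. \<forall>J\<ge>I. T' J \<le> T' I + 1" using almost_dec[of 1] by auto
  have "bounded (range (\<lambda>n. T' (I1 + n)))"
  proof (rule boundedI)
    fix x assume "x \<in> range (\<lambda>n. T' (I1 + n))"
    thus "norm x \<le> T' I1 + 1" using I1 T'pos by auto
  qed
  then obtain L r where r: "strict_mono (r :: nat \<Rightarrow> nat)" "((\<lambda>n. T' (I1 + n)) \<circ> r) \<longlonglongrightarrow> L"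
    using bounded_imp_convergent_subsequence[of "\<lambda>n. T' (I1 + n)"] by blast
  have rl: "r n \<ge> n" for n using r(1) by (rule seq_suble)
  \<comment> \<open>An almost decreasing sequence that is bounded below converges: n is placed
    between two indices K and M of the convergent subsequence, whose values bound
    \<open>T' n\<close> from above and from below.\<close>
  have lim': "T' \<longlonglongrightarrow> L"
  proof (rule LIMSEQ_I)
    fix e :: real assume e: "e > 0"
    obtain I0 where I0: "\<forall>I\<ge>I0. \<forall>J\<ge>I. T' J \<le> T' I + e / 4" using almost_dec[of "e/4"] e by auto
    obtain k0 where k0: "\<forall>k\<ge>k0. norm (((\<lambda>n. T' (I1 + n)) \<circ> r) k - L) < e / 4"
      using LIMSEQ_D[OF r(2), of "e/4"] e by auto
    define K where "K = I1 + r (max k0 I0)"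
    have K: "K \<ge> I0" "\<bar>T' K - L\<bar> < e / 4"
      using rl[of "max k0 I0"] k0[rule_format, of "max k0 I0"] by (auto simp: K_def)
    show "\<exists>no. \<forall>n\<ge>no. norm (T' n - L) < e"
    proof (intro exI allI impI)
      fix n assume n: "n \<ge> K"
      define M where "M = I1 + r (max k0 n)"
      have M: "M \<ge> n" "\<bar>T' M - L\<bar> < e / 4"
        using rl[of "max k0 n"] k0[rule_format, of "max k0 n"] by (auto simp: M_def)
      have "T' n \<le> T' K + e / 4" using I0 K n by auto
      moreover have "T' M \<le> T' n + e / 4" using I0 K n M by auto
      ultimately show "norm (T' n - L) < e" using K M e unfolding real_norm_def by linarith
    qed
  qed
  have "(\<lambda>n. 1 / real n) \<longlonglongrightarrow> 0" by (rule lim_1_over_n)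
  hence "(\<lambda>n. T' n - 1 / real n) \<longlonglongrightarrow> L - 0" by (intro tendsto_diff lim')
  hence "T \<longlonglongrightarrow> L"
    using tendsto_sandwich[of "\<lambda>n. T' n - 1 / real n" T sequentially T' L] lim' Tpos
    by (auto simp: T'_def max_def)
  hence "convergent (\<lambda>J. \<Sum>j=1..J. u j + (if j \<in> F then 1 / real j else 0))"
    unfolding Tsum[symmetric] by (auto simp: convergent_def)
  with FF show ?thesis by (rule that)
qed

section \<open>Logarithmic sums over real points compared with sums over the integers\<close>

lemma abs_mult_le:
  fixes x d y :: real
  assumes "x = d * y" "d \<ge> 0" "\<bar>y\<bar> \<le> M"
  shows "\<bar>x\<bar> \<le> M * d"
  using assms mult_left_mono[OF assms(3,2)] by (simp add: abs_mult mult.commute)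

lemma sector_log_diff_bound:
  fixes c :: real
  assumes "0 \<le> c" "c < 1" "0 \<le> a" "a \<le> b"
  shows "\<bar>sector_log c b - sector_log c a\<bar> \<le> (2 / (1 - c\<^sup>2)) / (1 + a\<^sup>2) * (b - a)"
proof (cases "a < b")
  case True
  have c: "\<bar>c\<bar> < 1" "c\<^sup>2 < 1" using assms by (auto simp: abs_square_less_1)
  define D where "D t = (t\<^sup>2 - 2 * c * t + 1) * (t\<^sup>2 + 2 * c * t + 1)" for t :: real
  have "\<exists>z>a. z < b \<and> sector_log c b - sector_log c a = (b - a) * (2 * c * (z\<^sup>2 - 1) / D z)"
    unfolding D_def using True by (intro MVT2 sector_log_deriv c) auto
  then obtain z where z: "a < z" "z < b" "sector_log c b - sector_log c a = (b - a) * (2 * c * (z\<^sup>2 - 1) / D z)"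
    by blast
  have "\<bar>2 * c * (z\<^sup>2 - 1) / D z\<bar> \<le> (2 / (1 - c\<^sup>2)) / (1 + z\<^sup>2)"
    unfolding D_def by (rule sector_log_deriv_bound[OF c(1)])
  also have "\<dots> \<le> (2 / (1 - c\<^sup>2)) / (1 + a\<^sup>2)"
  proof -
    have "a\<^sup>2 \<le> z\<^sup>2" using z assms by (intro power_mono) auto
    thus ?thesis using c by (intro divide_left_mono) (auto intro!: mult_pos_pos add_pos_nonneg)
  qed
  finally show ?thesis using True by (intro abs_mult_le[OF z(3)]) auto
qed (use assms in auto)

lemma mult_sector_log_diff_bound:
  fixes c :: real
  assumes "0 \<le> c" "c < 1" "0 \<le> a" "a \<le> b"
  shows "\<bar>b * sector_log c b - a * sector_log c a\<bar> \<le> (4 / (1 - c) + 6 / (1 - c\<^sup>2)) / (1 + a\<^sup>2) * (b - a)"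
proof (cases "a < b")
  case True
  have c: "\<bar>c\<bar> < 1" "c\<^sup>2 < 1" using assms by (auto simp: abs_square_less_1)
  define D where "D t = (t\<^sup>2 - 2 * c * t + 1) * (t\<^sup>2 + 2 * c * t + 1)" for t :: real
  have "\<exists>z>a. z < b \<and> b * sector_log c b - a * sector_log c a =
      (b - a) * (sector_log c z + z * (2 * c * (z\<^sup>2 - 1) / D z))"
  proof (intro MVT2 True)
    fix t :: real
    show "((\<lambda>t. t * sector_log c t) has_real_derivative sector_log c t + t * (2 * c * (t\<^sup>2 - 1) / D t)) (at t)"
      by (rule derivative_eq_intros sector_log_deriv[OF c(1)] refl)+ (simp add: D_def)
  qed
  then obtain z where z: "a < z" "z < b" "b * sector_log c b - a * sector_log c a =
      (b - a) * (sector_log c z + z * (2 * c * (z\<^sup>2 - 1) / D z))"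
    by blast
  have "\<bar>sector_log c z + z * (2 * c * (z\<^sup>2 - 1) / D z)\<bar> \<le> (4 / (1 - c) + 6 / (1 - c\<^sup>2)) / (1 + z\<^sup>2)"
    unfolding D_def using z assms by (intro mult_sector_log_deriv_bound c) auto
  also have "\<dots> \<le> (4 / (1 - c) + 6 / (1 - c\<^sup>2)) / (1 + a\<^sup>2)"
  proof -
    have "a\<^sup>2 \<le> z\<^sup>2" using z assms by (intro power_mono) auto
    thus ?thesis using c by (intro divide_left_mono) (auto intro!: mult_pos_pos add_pos_nonneg)
  qed
  finally show ?thesis using True by (intro abs_mult_le[OF z(3)]) auto
qed (use assms in auto)

lemma sector_log_bounded:
  fixes c t :: real
  assumes "0 \<le> c" "c < 1" "0 \<le> t"
  shows "\<bar>sector_log c t\<bar> \<le> 1 + 1 / (1 - c)"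
proof -
  define q where "q = 2 * c * t / (t\<^sup>2 + 1)"
  have t1: "t\<^sup>2 + 1 > 0" by (auto intro: add_nonneg_pos)
  have "(t - 1)\<^sup>2 \<ge> 0" by simp
  hence "2 * t \<le> t\<^sup>2 + 1" by (simp add: power2_eq_square algebra_simps)
  moreover have "c * t \<le> 1 * t" using assms by (intro mult_right_mono) auto
  ultimately have q: "0 \<le> q" "q \<le> 1" using assms t1 by (auto simp: q_def)
  have "q\<^sup>2 \<le> 1" using q by (simp add: power_le_one)
  hence "q\<^sup>2 / (1 - c) \<le> 1 / (1 - c)" using assms by (intro divide_right_mono) auto
  thus ?thesis using sector_log_approx[of c t] assms q unfolding q_def[symmetric] by auto
qed

text \<open>Abel summation with the tails from j to J in place of the initial sums: in the
  application the tails are small for large j, while initial sums are merely bounded. The boundary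
  term disappears because \<open>h 0 = 0\<close>.\<close>

lemma summation_by_parts_tails:
  fixes u h :: "nat \<Rightarrow> real"
  assumes "h 0 = 0"
  shows "(\<Sum>j=1..J. u j * h j) = (\<Sum>j=1..J. (\<Sum>i=j..J. u i) * (h j - h (j - 1)))"
proof (induction J)
  case (Suc J)
  have tele: "(\<Sum>j=1..n. h j - h (j - 1)) = h n" for n
    by (induction n) (auto simp: assms)
  have "(\<Sum>j=1..Suc J. (\<Sum>i=j..Suc J. u i) * (h j - h (j - 1)))
      = (\<Sum>j=1..Suc J. (\<Sum>i=j..J. u i) * (h j - h (j - 1)) + u (Suc J) * (h j - h (j - 1)))"
    by (intro sum.cong) (auto simp: algebra_simps)
  also have "\<dots> = (\<Sum>j=1..Suc J. (\<Sum>i=j..J. u i) * (h j - h (j - 1))) + u (Suc J) * (\<Sum>j=1..Suc J. h j - h (j - 1))"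
    by (simp only: sum.distrib sum_distrib_left)
  also have "(\<Sum>j=1..Suc J. (\<Sum>i=j..J. u i) * (h j - h (j - 1))) = (\<Sum>j=1..J. (\<Sum>i=j..J. u i) * (h j - h (j - 1)))"
    by simp
  finally show ?case using Suc tele[of "Suc J"] by simp
qed auto

lemma convergent_sum_tails_small:
  fixes u :: "nat \<Rightarrow> real"
  assumes "convergent (\<lambda>J. \<Sum>j=1..J. u j)"
  shows "\<exists>K. \<forall>j J. j \<ge> 1 \<longrightarrow> \<bar>\<Sum>i=j..J. u i\<bar> \<le> K"
    "\<eta> > 0 \<Longrightarrow> \<exists>I. \<forall>j J. j > I \<longrightarrow> \<bar>\<Sum>i=j..J. u i\<bar> \<le> \<eta>"
proof -
  let ?V = "\<lambda>J. \<Sum>j=1..J. u j"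
  have V: "(\<Sum>i=j..J. u i) = ?V J - ?V (j - 1)" if "1 \<le> j" "j \<le> J" for j J
  proof -
    have "{1..J} = {1..j-1} \<union> {j..J}" using that by auto
    hence "?V J = ?V (j - 1) + (\<Sum>i=j..J. u i)"
      using that by (simp add: sum.union_disjoint[symmetric] Int_commute)
    thus ?thesis by simp
  qed
  obtain K where K: "\<And>n. \<bar>?V n\<bar> \<le> K"
    using convergent_imp_Bseq[OF assms] by (auto simp: Bseq_def)
  show "\<exists>K. \<forall>j J. j \<ge> 1 \<longrightarrow> \<bar>\<Sum>i=j..J. u i\<bar> \<le> K"
  proof (intro exI allI impI)
    fix j J :: nat assume j: "j \<ge> 1"
    show "\<bar>\<Sum>i=j..J. u i\<bar> \<le> 2 * K"
    proof (cases "j \<le> J")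
      case True
      show ?thesis using V[OF j True] K[of J] K[of "j-1"] by linarith
    next
      case False
      thus ?thesis using K[of J] by simp
    qed
  qed
  show "\<exists>I. \<forall>j J. j > I \<longrightarrow> \<bar>\<Sum>i=j..J. u i\<bar> \<le> \<eta>" if "\<eta> > 0"
  proof -
    have "Cauchy ?V" using assms by (simp add: Cauchy_convergent_iff)
    from metric_CauchyD[OF this that] obtain M where
      M: "\<forall>m\<ge>M. \<forall>n\<ge>M. dist (?V m) (?V n) < \<eta>" by blast
    have "\<bar>\<Sum>i=j..J. u i\<bar> \<le> \<eta>" if "j > M" for j J
    proof (cases "j \<le> J")
      case True
      have "dist (?V J) (?V (j - 1)) < \<eta>" using M True that by auto
      thus ?thesis using V[of j J] True that by (simp add: dist_real_def)
    qed (use \<open>\<eta> > 0\<close> in auto)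
    thus ?thesis by blast
  qed
qed

lemma sum_Ioc_by_cells:
  fixes S :: "real set" and f :: "real \<Rightarrow> real"
  assumes "\<And>j. finite (S \<inter> {real j <.. real (Suc j)})"
  shows "finite (S \<inter> {0 <.. real J}) \<and>
    sum f (S \<inter> {0 <.. real J}) = (\<Sum>j=1..J. sum f (S \<inter> {real j - 1 <.. real j}))"
proof (induction J)
  case (Suc J)
  have "S \<inter> {0 <.. real (Suc J)} = (S \<inter> {0 <.. real J}) \<union> (S \<inter> {real J <.. real (Suc J)})"
    by auto
  moreover have "(S \<inter> {0 <.. real J}) \<inter> (S \<inter> {real J <.. real (Suc J)}) = {}" by auto
  ultimately show ?case using Suc assms[of J] by (simp add: sum.union_disjoint)
qed simp

text \<open>Moving each point to the right end of its unit cell costs a bounded amount, by the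
  derivative bound and \<open>sum_Poisson_kernel_le\<close>. What remains is the sum of
  \<open>u j\<close> times j * \<open>sector_log c (j / r)\<close>, where \<open>u j\<close> are the
  terms of the convergent series. Summation by parts weighs the tails of this series with increments
  whose total is O(r): tails beyond some I are tiny and give \<eta> * r, the first I give a
  constant. C depends on neither J nor r.\<close>

lemma sector_log_sum_estimate:
  fixes S :: "real set" and c e :: real and B :: nat
  assumes c: "0 \<le> c" "c < 1"
    and S: "\<And>j. finite (S \<inter> {real j <.. real (Suc j)})" "\<And>j. card (S \<inter> {real j <.. real (Suc j)}) \<le> B"
    and conv: "convergent (\<lambda>J. \<Sum>j=1..J. (real (card (S \<inter> {real j - 1 <.. real j})) - e) / real j)"
    and \<eta>: "\<eta> > 0"
  shows "\<exists>C. \<forall>J r. r > 0 \<longrightarrow>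
    \<bar>(\<Sum>x\<in>S \<inter> {0<..real J}. sector_log c (x / r)) - e * (\<Sum>j=1..J. sector_log c (real j / r))\<bar> \<le> \<eta> * r + C"
proof -
  define g where "g = sector_log c"
  define N where "N j = S \<inter> {real j - 1 <.. real j}" for j :: nat
  define u where "u j = (real (card (N j)) - e) / real j" for j
  define C1 where "C1 = 2 / (1 - c\<^sup>2)"
  define C2 where "C2 = 4 / (1 - c) + 6 / (1 - c\<^sup>2)"
  define G where "G = 1 + 1 / (1 - c)"
  have c2: "c\<^sup>2 < 1" using c by (auto simp: abs_square_less_1)
  have pos: "C1 > 0" "C2 > 0" "G > 0" using c c2 by (auto simp: C1_def C2_def G_def intro!: add_pos_pos)
  have N: "finite (N j)" "card (N j) \<le> B" if "j \<ge> 1" for j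
    using S[of "j - 1"] that by (auto simp: N_def of_nat_diff)
  have conv': "convergent (\<lambda>J. \<Sum>j=1..J. u j)" using conv unfolding u_def N_def .
  obtain K where K: "\<And>j J. j \<ge> 1 \<Longrightarrow> \<bar>\<Sum>i=j..J. u i\<bar> \<le> K"
    using convergent_sum_tails_small(1)[OF conv'] by blast
  have K0: "K \<ge> 0" using K[of 1 0] by simp
  \<comment> \<open>The increments met below add up to at most C2 + C2 * r * \<pi>/2, so this choice
    produces exactly \<eta> * r besides a constant.\<close>
  define \<eta>' where "\<eta>' = \<eta> / (C2 * (pi / 2))"
  have \<eta>': "\<eta>' > 0" using \<eta> pos by (simp add: \<eta>'_def)
  obtain I where I: "\<And>j J. j > I \<Longrightarrow> \<bar>\<Sum>i=j..J. u i\<bar> \<le> \<eta>'"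
    using convergent_sum_tails_small(2)[OF conv' \<eta>'] by blast
  define C where "C = real B * (2 * G + C1 * (pi / 2)) + (real I * (K * C2) + \<eta>' * C2)"
  have "\<bar>(\<Sum>x\<in>S \<inter> {0<..real J}. g (x / r)) - e * (\<Sum>j=1..J. g (real j / r))\<bar> \<le> \<eta> * r + C" if r: "r > 0" for J r
  proof -
    have kern: "1 / (1 + (real k / r)\<^sup>2) * (1 / r) = r / (r\<^sup>2 + (real k)\<^sup>2)" for k
      using r by (simp add: field_simps power2_eq_square)
    have split: "(\<Sum>x\<in>S \<inter> {0<..real J}. g (x / r)) - e * (\<Sum>j=1..J. g (real j / r))
       = (\<Sum>j=1..J. \<Sum>x\<in>N j. g (x / r) - g (real j / r)) + (\<Sum>j=1..J. u j * (real j * g (real j / r)))"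
    proof -
      have "(\<Sum>x\<in>S \<inter> {0<..real J}. g (x / r)) = (\<Sum>j=1..J. \<Sum>x\<in>N j. g (x / r))"
        using sum_Ioc_by_cells[of S J "\<lambda>x. g (x / r)"] S(1) by (simp add: N_def)
      moreover have "u j * (real j * g (real j / r)) = (\<Sum>x\<in>N j. g (real j / r)) - e * g (real j / r)" if "j \<in> {1..J}" for j
        using that by (simp add: u_def field_simps)
      ultimately show ?thesis
        by (simp add: sum.distrib sum_subtractf sum_distrib_left)
    qed
    have 1: "\<bar>\<Sum>j=1..J. \<Sum>x\<in>N j. g (x / r) - g (real j / r)\<bar> \<le> real B * (2 * G + C1 * (pi / 2))"
    proof -
      \<comment> \<open>In the first cell the kernel would be taken at 0, where it is 1/r and not
        bounded as r tends to 0; there the boundedness of \<open>sector_log\<close> is used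
        instead.\<close>
      define M where "M j = (if j = 1 then 2 * G else C1 * (r / (r\<^sup>2 + (real (j - 1))\<^sup>2)))" for j :: nat
      have M0: "M j \<ge> 0" for j using pos r by (auto simp: M_def)
      have each: "\<bar>g (x / r) - g (real j / r)\<bar> \<le> M j" if "j \<ge> 1" "x \<in> N j" for j x
      proof (cases "j = 1")
        case True
        have "\<bar>g (x / r)\<bar> \<le> G" "\<bar>g (real j / r)\<bar> \<le> G"
          unfolding g_def G_def using that r by (auto intro!: sector_log_bounded c simp: N_def True)
        thus ?thesis using True by (simp add: M_def)
      next
        case False
        have x: "real (j - 1) < x" "x \<le> real j" using that by (auto simp: N_def of_nat_diff)
        have x0: "0 \<le> x" using x by (simp add: order_trans[OF of_nat_0_le_iff[of "j - 1"]])
        have "\<bar>g (real j / r) - g (x / r)\<bar> \<le> C1 / (1 + (x / r)\<^sup>2) * (real j / r - x / r)"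
          unfolding g_def C1_def using x x0 r
          by (intro sector_log_diff_bound c) (auto intro: divide_right_mono)
        also have "\<dots> \<le> C1 / (1 + (real (j - 1) / r)\<^sup>2) * (1 / r)"
        proof (intro mult_mono)
          have "(real (j - 1) / r)\<^sup>2 \<le> (x / r)\<^sup>2"
            using x r by (intro power_mono divide_right_mono) auto
          thus "C1 / (1 + (x / r)\<^sup>2) \<le> C1 / (1 + (real (j - 1) / r)\<^sup>2)"
            using pos by (intro divide_left_mono) (auto intro!: mult_pos_pos add_pos_nonneg)
          have "real j - x \<le> 1" using x that by (simp add: of_nat_diff)
          thus "real j / r - x / r \<le> 1 / r" using r by (simp add: diff_divide_distrib [symmetric] divide_right_mono)
          show "0 \<le> real j / r - x / r" using x r by (simp add: divide_right_mono)
        qed (use pos in auto)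
        also have "\<dots> = C1 * (1 / (1 + (real (j - 1) / r)\<^sup>2) * (1 / r))" by simp
        also have "\<dots> = M j" unfolding kern M_def using False by simp
        finally show ?thesis by (simp add: abs_minus_commute)
      qed
      have "\<bar>\<Sum>j=1..J. \<Sum>x\<in>N j. g (x / r) - g (real j / r)\<bar> \<le> (\<Sum>j=1..J. \<Sum>x\<in>N j. \<bar>g (x / r) - g (real j / r)\<bar>)"
        by (rule order_trans[OF sum_abs], rule sum_mono, rule sum_abs)
      also have "\<dots> \<le> (\<Sum>j=1..J. real B * M j)"
      proof (intro sum_mono)
        fix j assume j: "j \<in> {1..J}"
        have "(\<Sum>x\<in>N j. \<bar>g (x / r) - g (real j / r)\<bar>) \<le> (\<Sum>x\<in>N j. M j)"
          using j each by (intro sum_mono) auto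
        also have "\<dots> = real (card (N j)) * M j" by simp
        also have "\<dots> \<le> real B * M j" using N(2)[of j] j M0 by (intro mult_right_mono) auto
        finally show "(\<Sum>x\<in>N j. \<bar>g (x / r) - g (real j / r)\<bar>) \<le> real B * M j" .
      qed
      also have "\<dots> = real B * (\<Sum>j=1..J. M j)" by (simp add: sum_distrib_left)
      also have "(\<Sum>j=1..J. M j) \<le> 2 * G + C1 * (\<Sum>k=1..J-1. r / (r\<^sup>2 + (real k)\<^sup>2))"
      proof (induction J)
        case (Suc J)
        show ?case
        proof (cases "J = 0")
          case False
          have "(\<Sum>k=1..J. r / (r\<^sup>2 + (real k)\<^sup>2)) = (\<Sum>k=1..J-1. r / (r\<^sup>2 + (real k)\<^sup>2)) + r / (r\<^sup>2 + (real J)\<^sup>2)"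
            using False by (cases J) auto
          thus ?thesis using Suc False by (simp add: M_def algebra_simps)
        qed (use pos in \<open>simp add: M_def\<close>)
      qed (use pos in simp)
      also have "\<dots> \<le> 2 * G + C1 * (pi / 2)"
        using sum_Poisson_kernel_le[OF r, of "J - 1"] pos by (intro add_left_mono mult_left_mono) auto
      finally show ?thesis by (simp add: mult_left_mono)
    qed
    have 2: "\<bar>\<Sum>j=1..J. u j * (real j * g (real j / r))\<bar> \<le> \<eta> * r + (real I * (K * C2) + \<eta>' * C2)"
    proof -
      define h where "h j = real j * g (real j / r)" for j :: nat
      \<comment> \<open>The additional factor r, which comes from writing \<open>h j\<close> as r
        times a function of j / r, keeps this at most C2, also for j = 1.\<close>
      define M where "M j = C2 * (r\<^sup>2 / (r\<^sup>2 + (real (j - 1))\<^sup>2))" for j :: nat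
      have M0: "M j \<ge> 0" for j using pos by (auto simp: M_def)
      have MC: "M j \<le> C2" for j
        unfolding M_def using pos r by (intro mult_left_le) (auto simp: divide_le_eq_1 intro!: add_pos_nonneg)
      have dh: "\<bar>h j - h (j - 1)\<bar> \<le> M j" if "j \<ge> 1" for j
      proof -
        have "\<bar>real j / r * g (real j / r) - real (j - 1) / r * g (real (j - 1) / r)\<bar>
           \<le> C2 / (1 + (real (j - 1) / r)\<^sup>2) * (real j / r - real (j - 1) / r)"
          unfolding g_def C2_def using r that
          by (intro mult_sector_log_diff_bound c) (auto intro: divide_right_mono)
        also have "real j / r - real (j - 1) / r = 1 / r"
          using that by (simp add: of_nat_diff diff_divide_distrib)
        finally have "r * \<bar>real j / r * g (real j / r) - real (j - 1) / r * g (real (j - 1) / r)\<bar>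
           \<le> r * (C2 / (1 + (real (j - 1) / r)\<^sup>2) * (1 / r))"
          using r by (intro mult_left_mono) auto
        also have "\<dots> = r * C2 * (1 / (1 + (real (j - 1) / r)\<^sup>2) * (1 / r))" by simp
        also have "\<dots> = M j" unfolding kern M_def by (simp add: power2_eq_square)
        also have "r * \<bar>real j / r * g (real j / r) - real (j - 1) / r * g (real (j - 1) / r)\<bar> = \<bar>h j - h (j - 1)\<bar>"
        proof -
          have "h j - h (j - 1) = r * (real j / r * g (real j / r) - real (j - 1) / r * g (real (j - 1) / r))"
            using r unfolding h_def right_diff_distrib by simp
          thus ?thesis using r by (simp add: abs_mult)
        qed
        finally show ?thesis .
      qed
      have "(\<Sum>j=1..J. u j * (real j * g (real j / r))) = (\<Sum>j=1..J. (\<Sum>i=j..J. u i) * (h j - h (j - 1)))"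
        using summation_by_parts_tails[of h u J] by (simp add: h_def)
      also have "\<bar>\<dots>\<bar> \<le> (\<Sum>j=1..J. \<bar>\<Sum>i=j..J. u i\<bar> * \<bar>h j - h (j - 1)\<bar>)"
        by (rule order_trans[OF sum_abs]) (simp add: abs_mult)
      also have "\<dots> \<le> (\<Sum>j=1..J. (if j \<le> I then K * C2 else 0) + \<eta>' * M j)"
      proof (intro sum_mono)
        fix j assume j: "j \<in> {1..J}"
        show "\<bar>\<Sum>i=j..J. u i\<bar> * \<bar>h j - h (j - 1)\<bar> \<le> (if j \<le> I then K * C2 else 0) + \<eta>' * M j"
        proof (cases "j \<le> I")
          case True
          have "\<bar>h j - h (j - 1)\<bar> \<le> C2" using dh[of j] MC[of j] j by auto
          hence "\<bar>\<Sum>i=j..J. u i\<bar> * \<bar>h j - h (j - 1)\<bar> \<le> K * C2"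
            using K[of j J] j K0 by (intro mult_mono) auto
          thus ?thesis using True M0[of j] \<eta>' by (simp add: add_increasing2)
        next
          case False
          have "\<bar>\<Sum>i=j..J. u i\<bar> * \<bar>h j - h (j - 1)\<bar> \<le> \<eta>' * M j"
            using I[of j J] False dh[of j] j \<eta>' by (intro mult_mono) auto
          thus ?thesis using False by simp
        qed
      qed
      also have "\<dots> = (\<Sum>j=1..J. if j \<le> I then K * C2 else 0) + \<eta>' * (\<Sum>j=1..J. M j)"
        by (simp add: sum.distrib sum_distrib_left)
      also have "(\<Sum>j=1..J. if j \<le> I then K * C2 else 0) \<le> real I * (K * C2)"
      proof -
        have "(\<Sum>j=1..J. if j \<le> I then K * C2 else 0) = (\<Sum>j\<in>{j\<in>{1..J}. j \<le> I}. K * C2)"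
          by (subst sum.inter_filter[symmetric]) auto
        also have "\<dots> = real (card {j\<in>{1..J}. j \<le> I}) * (K * C2)" by simp
        also have "card {j\<in>{1..J}. j \<le> I} \<le> card {1..I}" by (intro card_mono) auto
        finally show ?thesis using K0 pos by (simp add: mult_right_mono)
      qed
      also have "(\<Sum>j=1..J. M j) \<le> C2 + C2 * r * (\<Sum>k=1..J-1. r / (r\<^sup>2 + (real k)\<^sup>2))"
      proof (induction J)
        case (Suc J)
        show ?case
        proof (cases "J = 0")
          case False
          have "(\<Sum>k=1..J. r / (r\<^sup>2 + (real k)\<^sup>2)) = (\<Sum>k=1..J-1. r / (r\<^sup>2 + (real k)\<^sup>2)) + r / (r\<^sup>2 + (real J)\<^sup>2)"
            using False by (cases J) auto
          thus ?thesis using Suc False by (simp add: M_def algebra_simps power2_eq_square)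
        qed (use r in \<open>simp add: M_def\<close>)
      qed (use pos in simp)
      also have "\<dots> \<le> C2 + C2 * r * (pi / 2)"
        using sum_Poisson_kernel_le[OF r, of "J - 1"] pos r by (intro add_left_mono mult_left_mono) auto
      also have "\<eta>' * (C2 + C2 * r * (pi / 2)) = \<eta> * r + \<eta>' * C2"
        using pos by (simp add: \<eta>'_def algebra_simps)
      finally show ?thesis using \<eta>' by (simp add: mult_left_mono)
    qed
    show ?thesis unfolding split C_def using 1 2 by linarith
  qed
  thus ?thesis unfolding g_def by blast
qed

subsection \<open>Truncated cardinal sine\<close>

lemma norm_exp_i_le:
  fixes z :: complex
  shows "norm (exp (\<i> * z)) \<le> exp \<bar>Im z\<bar>" "norm (exp (- (\<i> * z))) \<le> exp \<bar>Im z\<bar>"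
  by simp_all

lemma norm_cos_le_exp: "norm (cos z) \<le> exp \<bar>Im z\<bar>" for z :: complex
proof -
  have "norm (exp (\<i> * z) + exp (- (\<i> * z))) \<le> exp \<bar>Im z\<bar> + exp \<bar>Im z\<bar>"
    by (rule norm_triangle_mono[OF norm_exp_i_le])
  thus ?thesis by (simp add: cos_exp_eq norm_divide)
qed

text \<open>Mean value inequality on the convex strip |Im w| \<le> |Im z|. The factor
  \<open>norm z\<close> lets sin(\<pi>s)/(\<pi>s) be bounded by exp(\<pi>|Im s|) for every s
  \<noteq> 0, however small.\<close>

lemma norm_sin_le: "norm (sin z) \<le> norm z * exp \<bar>Im z\<bar>" for z :: complex
proof -
  define S where "S = {w. \<bar>Im w\<bar> \<le> \<bar>Im z\<bar>}"
  have "convex S"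
  proof -
    have "S = {w. Im w \<le> \<bar>Im z\<bar>} \<inter> {w. Im w \<ge> - \<bar>Im z\<bar>}" by (auto simp: S_def)
    thus ?thesis by (simp add: convex_Int convex_halfspace_Im_le convex_halfspace_Im_ge)
  qed
  moreover have "(sin has_field_derivative cos w) (at w within S)" for w :: complex
    by (auto intro!: derivative_eq_intros)
  moreover have "norm (cos w) \<le> exp \<bar>Im z\<bar>" if "w \<in> S" for w
    using norm_cos_le_exp[of w] that by (auto simp: S_def intro: order_trans)
  ultimately have "norm (sin z - sin 0) \<le> exp \<bar>Im z\<bar> * norm (z - 0)"
    by (intro field_differentiable_bound[of S sin cos]) (auto simp: S_def)
  thus ?thesis by (simp add: mult.commute)
qed

text \<open>
  The entire function \<open>sin(\<pi>s)/(\<pi>s) \<Prod>\<^bsub>j\<le>J\<^esub> (j+s)/(j-s)\<close>, written with reciprocal Gamma factors so that the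
  removable singularities at \<open>1, \<dots>, J\<close> do not appear.
\<close>

definition trunc_sinc :: "nat \<Rightarrow> complex \<Rightarrow> complex" where
  "trunc_sinc J s = (\<Prod>j=1..J. of_nat j + s) * rGamma (1 + s) * rGamma (of_nat (Suc J) - s)"

lemma trunc_sinc_holomorphic [holomorphic_intros]: "trunc_sinc J holomorphic_on A"
  unfolding trunc_sinc_def [abs_def] by (intro holomorphic_intros)

lemma prod_atLeast1_atMost_pochhammer:
  "(\<Prod>j=1..J. of_nat j + s) = pochhammer (1 + s :: complex) J"
  by (induction J) (simp_all add: pochhammer_Suc add_ac)

text \<open>This is the reflection formula for \<open>rGamma\<close>, after the recurrence has
  absorbed s and the factors j - s. Being free of division, it also holds at the integers.\<close>

lemma trunc_sinc_mult:
  "trunc_sinc J s * (\<Prod>j=1..J. of_nat j - s) * (of_real pi * s) = (\<Prod>j=1..J. of_nat j + s) * sin (of_real pi * s)"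
proof -
  have 1: "(\<Prod>j=1..J. of_nat j - s) * rGamma (of_nat (Suc J) - s) = rGamma (1 - s)"
    using prod_atLeast1_atMost_pochhammer[of "-s" J] pochhammer_rGamma[of "1 - s" J]
    by (simp add: algebra_simps)
  have 2: "s * rGamma (1 + s) = rGamma s" using rGamma_plus1[of s] by (simp add: add.commute)
  have "trunc_sinc J s * (\<Prod>j=1..J. of_nat j - s) * (of_real pi * s)
     = (\<Prod>j=1..J. of_nat j + s) * of_real pi * ((s * rGamma (1 + s)) * ((\<Prod>j=1..J. of_nat j - s) * rGamma (of_nat (Suc J) - s)))"
    by (simp add: trunc_sinc_def mult_ac)
  also have "\<dots> = (\<Prod>j=1..J. of_nat j + s) * sin (of_real pi * s)"
    unfolding 1 2 rGamma_reflection_complex by simp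
  finally show ?thesis .
qed

lemma trunc_sinc_eq':
  assumes "s \<noteq> 0" "\<And>j. j \<in> {1..J} \<Longrightarrow> of_nat j - s \<noteq> 0"
  shows "trunc_sinc J s = sin (of_real pi * s) / (of_real pi * s) * (\<Prod>j=1..J. (of_nat j + s) / (of_nat j - s))"
proof -
  have "T = S / p * (A / B)" if "T * B * p = A * S" "B \<noteq> 0" "p \<noteq> 0" for T B p A S :: complex
    using that by (simp add: field_simps)
  moreover have "(\<Prod>j=1..J. of_nat j - s) \<noteq> 0" using assms(2) by (simp add: prod_zero_iff)
  ultimately show ?thesis
    unfolding prod_dividef using trunc_sinc_mult[of J s] assms(1) by simp
qed

lemma trunc_sinc_eq:
  assumes "s \<notin> \<nat>"
  shows "trunc_sinc J s = sin (of_real pi * s) / (of_real pi * s) * (\<Prod>j=1..J. (of_nat j + s) / (of_nat j - s))"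
  using assms by (intro trunc_sinc_eq') auto

lemma trunc_sinc_0: "trunc_sinc J 0 = 1"
proof -
  have "(\<Prod>j=1..J. of_nat j :: complex) = fact J" by (simp add: fact_prod)
  moreover have "rGamma (1 + complex_of_nat J) = inverse (fact J)"
    by (simp add: rGamma_inverse_Gamma Gamma_fact)
  ultimately show ?thesis by (simp add: trunc_sinc_def add.commute)
qed

lemma norm_prod_eq_1:
  fixes f :: "'a \<Rightarrow> complex"
  assumes "\<And>j. j \<in> A \<Longrightarrow> norm (f j) = 1"
  shows "norm (prod f A) = 1"
  using assms by (simp flip: prod_norm)

lemma norm_trunc_sinc_imaginary: "norm (trunc_sinc J (\<i> * of_real y)) \<le> exp (pi * \<bar>y\<bar>)"
proof (cases "y = 0")
  case False
  define s where "s = \<i> * of_real y"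
  have "s \<notin> \<nat>" using False by (auto simp: s_def Nats_def complex_eq_iff)
  have "norm ((of_nat j + s) / (of_nat j - s)) = 1" if "j \<in> {1..J}" for j
  proof -
    have "of_nat j + s = cnj (of_nat j - s)" by (simp add: s_def)
    hence "norm (of_nat j + s) = norm (of_nat j - s)" by (simp only: complex_mod_cnj)
    moreover have "of_nat j - s \<noteq> 0" using \<open>s \<notin> \<nat>\<close> by auto
    ultimately show ?thesis by (simp add: norm_divide)
  qed
  hence "norm (\<Prod>j=1..J. (of_nat j + s) / (of_nat j - s)) = 1"
    by (intro norm_prod_eq_1) auto
  hence "norm (trunc_sinc J s) = norm (sin (of_real pi * s)) / norm (of_real pi * s)"
    unfolding trunc_sinc_eq[OF \<open>s \<notin> \<nat>\<close>, of J] norm_mult norm_divide by simp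
  also have "\<dots> \<le> exp (pi * \<bar>y\<bar>)"
    using norm_sin_le[of "of_real pi * s"] False
    by (simp add: s_def norm_mult pos_divide_le_eq abs_mult mult_ac)
  finally show ?thesis unfolding s_def .
qed (simp add: trunc_sinc_0)

text \<open>The constant may depend on J, since this bound only serves to make closing sides of
  contours vanish. For |s| > 2J + 1 each factor (j + s)/(j - s) has modulus at most 3; the remaining
  disc is compact.\<close>

lemma trunc_sinc_growth:
  "\<exists>C. \<forall>s. Re s \<ge> 0 \<longrightarrow> norm (trunc_sinc J s) \<le> C * exp (pi * \<bar>Im s\<bar>)"
proof -
  have "continuous_on (cball 0 (2 * real J + 1)) (trunc_sinc J)"
    by (rule holomorphic_on_imp_continuous_on[OF trunc_sinc_holomorphic])
  hence "bounded (trunc_sinc J ` cball 0 (2 * real J + 1))"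
    using compact_continuous_image compact_cball compact_imp_bounded by metis
  then obtain M where "\<forall>x\<in>trunc_sinc J ` cball 0 (2 * real J + 1). norm x \<le> M"
    unfolding bounded_iff ..
  hence M: "\<And>s. s \<in> cball 0 (2 * real J + 1) \<Longrightarrow> norm (trunc_sinc J s) \<le> M"
    by (rule bspec[OF _ imageI])
  define C where "C = max (max M 0) (3 ^ J)"
  have "norm (trunc_sinc J s) \<le> C * exp (pi * \<bar>Im s\<bar>)" for s
  proof (cases "norm s \<le> 2 * real J + 1")
    case True
    hence "norm (trunc_sinc J s) \<le> C" using M[of s] by (simp add: C_def)
    also have "C * 1 \<le> C * exp (pi * \<bar>Im s\<bar>)" by (intro mult_left_mono) (auto simp: C_def)
    finally show ?thesis by simp
  next
    case False
    have fac: "norm ((of_nat j + s) / (of_nat j - s)) \<le> 3" "of_nat j - s \<noteq> 0" if "j \<in> {1..J}" for j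
    proof -
      have "norm (of_nat j + s) \<le> real j + norm s" using norm_triangle_ineq[of "of_nat j" s] by simp
      moreover have "norm (of_nat j - s) \<ge> norm s - real j" using norm_triangle_ineq2[of s "of_nat j"] by (simp add: norm_minus_commute)
      moreover have "real j \<le> real J" using that by simp
      ultimately have *: "norm (of_nat j + s) \<le> 3 * norm (of_nat j - s)" "norm (of_nat j - s) > 0"
        using False by linarith+
      show "norm ((of_nat j + s) / (of_nat j - s)) \<le> 3"
        unfolding norm_divide pos_divide_le_eq[OF *(2)] by (rule *(1))
      show "of_nat j - s \<noteq> 0" using *(2) by (simp only: zero_less_norm_iff not_False_eq_True)
    qed
    have s0: "s \<noteq> 0" using False by auto
    have eq: "trunc_sinc J s = sin (of_real pi * s) / (of_real pi * s) * (\<Prod>j=1..J. (of_nat j + s) / (of_nat j - s))"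
      using s0 fac(2) by (intro trunc_sinc_eq') auto
    have "norm (\<Prod>j=1..J. (of_nat j + s) / (of_nat j - s)) \<le> (\<Prod>j=1..J. 3)"
      unfolding prod_norm [symmetric] by (intro prod_mono conjI norm_ge_zero fac(1))
    also have "\<dots> \<le> C" by (simp add: C_def)
    finally have P: "norm (\<Prod>j=1..J. (of_nat j + s) / (of_nat j - s)) \<le> C" .
    have S: "norm (sin (of_real pi * s) / (of_real pi * s)) \<le> exp (pi * \<bar>Im s\<bar>)"
    proof -
      have "norm (of_real pi * s) > 0" using s0 by simp
      moreover have "\<bar>Im (of_real pi * s)\<bar> = pi * \<bar>Im s\<bar>" by (simp add: abs_mult)
      ultimately show ?thesis
        using norm_sin_le[of "of_real pi * s"] by (simp only: norm_divide pos_divide_le_eq mult.commute)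
    qed
    have "norm (trunc_sinc J s) = norm (sin (of_real pi * s) / (of_real pi * s)) * norm (\<Prod>j=1..J. (of_nat j + s) / (of_nat j - s))"
      by (simp only: eq norm_mult)
    also have "\<dots> \<le> exp (pi * \<bar>Im s\<bar>) * C"
      by (intro mult_mono S P) auto
    finally show ?thesis by (simp only: mult.commute)
  qed
  thus ?thesis by blast
qed

section \<open>Truncated sinc at a point and at its real part\<close>

lemma norm_of_nat_plus_minus_square:
  fixes x y :: real and j :: nat
  defines "s \<equiv> Complex x y"
  shows "(norm (of_nat j + s))\<^sup>2 = (real j + x)\<^sup>2 + y\<^sup>2" "(norm (of_nat j - s))\<^sup>2 = (real j - x)\<^sup>2 + y\<^sup>2"
  by (simp_all add: s_def cmod_power2)

lemma sqrt_ratio_bound: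
  fixes a b y n :: real
  assumes "n \<ge> 0" "n\<^sup>2 = a\<^sup>2 + y\<^sup>2" "0 < b" "b \<le> a"
  shows "n\<^sup>2 \<le> a\<^sup>2 * (1 + y\<^sup>2 / b\<^sup>2)" "n \<le> a * (1 + y\<^sup>2 / b\<^sup>2)"
proof -
  have "a\<^sup>2 \<ge> b\<^sup>2" using assms by (intro power_mono) auto
  hence "1 \<le> a\<^sup>2 / b\<^sup>2" using assms(3) by simp
  hence "y\<^sup>2 * 1 \<le> y\<^sup>2 * (a\<^sup>2 / b\<^sup>2)" by (rule mult_left_mono) simp
  moreover have "a\<^sup>2 * (1 + y\<^sup>2 / b\<^sup>2) = a\<^sup>2 + y\<^sup>2 * (a\<^sup>2 / b\<^sup>2)" by (simp add: algebra_simps)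
  ultimately show 1: "n\<^sup>2 \<le> a\<^sup>2 * (1 + y\<^sup>2 / b\<^sup>2)" using assms(2) by linarith
  have "1 + y\<^sup>2 / b\<^sup>2 \<le> (1 + y\<^sup>2 / b\<^sup>2)\<^sup>2" by (intro self_le_power) auto
  hence "a\<^sup>2 * (1 + y\<^sup>2 / b\<^sup>2) \<le> a\<^sup>2 * (1 + y\<^sup>2 / b\<^sup>2)\<^sup>2"
    by (rule mult_left_mono) simp
  hence "n\<^sup>2 \<le> (a * (1 + y\<^sup>2 / b\<^sup>2))\<^sup>2"
    unfolding power_mult_distrib using 1 by linarith
  thus "n \<le> a * (1 + y\<^sup>2 / b\<^sup>2)"
    using assms(3,4) by (rule_tac power2_le_imp_le) (auto intro!: mult_nonneg_nonneg)
qed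

text \<open>In the sine product the j-th factor becomes (j + s)^2/j^2 for j \<le> J, so the zeros
  near x are gone. For j > J it remains (j - s)(j + s)/j^2, and x \<le> J gives j - x \<ge> j - J.
  Passing from x to x + iy therefore costs at most the product of all 1 + y^2/j^2 times that of the
  1 + y^2/(j - J)^2 with j > J; each is at most exp(\<pi>|y|), independently of J.\<close>

lemma trunc_sinc_real_lower_noninteger:
  fixes x y :: real
  assumes x: "0 < x" "x \<le> real J" "x \<notin> \<nat>"
  shows "norm (trunc_sinc J (Complex x y)) \<le> exp (2 * pi * \<bar>y\<bar>) * norm (trunc_sinc J (of_real x))"
proof -
  have nx: "of_real x \<notin> (\<nat> :: complex set)" and ny: "Complex x y \<notin> \<nat>"
    using x by (auto simp: Nats_def complex_eq_iff)
  define P where "P s = (\<Prod>j=1..J. (of_nat j + s) / (of_nat j - s))" for s :: complex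
  define e where "e K s = (\<Prod>j=1..K. 1 - s\<^sup>2 / (of_nat j)\<^sup>2)" for K :: nat and s :: complex
  define t where "t j s = (if j \<le> J then (norm (of_nat j + s))\<^sup>2 / (real j)\<^sup>2
      else norm (of_nat j - s) * norm (of_nat j + s) / (real j)\<^sup>2)" for j :: nat and s :: complex
  have prod_t: "norm (e K s) * norm (P s) = (\<Prod>j=1..K. t j s)" if K: "K \<ge> J" and s: "s \<notin> \<nat>" for K s
  proof -
    have "P s = (\<Prod>j=1..K. if j \<le> J then (of_nat j + s) / (of_nat j - s) else 1)"
      unfolding P_def using K by (intro prod.mono_neutral_cong_left) auto
    hence "e K s * P s = (\<Prod>j=1..K. (1 - s\<^sup>2 / (of_nat j)\<^sup>2) * (if j \<le> J then (of_nat j + s) / (of_nat j - s) else 1))"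
      by (simp add: e_def prod.distrib)
    hence "norm (e K s * P s) = (\<Prod>j=1..K. norm ((1 - s\<^sup>2 / (of_nat j)\<^sup>2) * (if j \<le> J then (of_nat j + s) / (of_nat j - s) else 1)))"
      by (simp only: prod_norm)
    also have "\<dots> = (\<Prod>j=1..K. t j s)"
    proof (intro prod.cong refl)
      fix j assume j: "j \<in> {1..K}"
      have ne: "of_nat j - s \<noteq> 0" using s by auto
      have "1 - s\<^sup>2 / (of_nat j)\<^sup>2 = (of_nat j - s) * (of_nat j + s) / (of_nat j)\<^sup>2"
        using j by (simp add: field_simps power2_eq_square)
      hence n: "norm (1 - s\<^sup>2 / (of_nat j)\<^sup>2) = norm (of_nat j - s) * norm (of_nat j + s) / (real j)\<^sup>2"
        by (simp add: norm_mult norm_divide norm_power)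
      show "norm ((1 - s\<^sup>2 / (of_nat j)\<^sup>2) * (if j \<le> J then (of_nat j + s) / (of_nat j - s) else 1)) = t j s"
        unfolding norm_mult n t_def using ne by (auto simp: norm_divide power2_eq_square)
    qed
    finally show ?thesis by (simp add: norm_mult)
  qed
  have t0: "t j s \<ge> 0" for j s by (simp add: t_def)
  have tle: "t j (Complex x y) \<le> t j (of_real x) * ((1 + y\<^sup>2 / (real j)\<^sup>2) * (if j \<le> J then 1 else 1 + y\<^sup>2 / (real (j - J))\<^sup>2))" if "j \<ge> 1" for j
  proof -
    have a: "(norm (of_nat j + Complex x y))\<^sup>2 \<le> (real j + x)\<^sup>2 * (1 + y\<^sup>2 / (real j)\<^sup>2)"
      "norm (of_nat j + Complex x y) \<le> (real j + x) * (1 + y\<^sup>2 / (real j)\<^sup>2)"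
      using sqrt_ratio_bound[OF norm_ge_zero norm_of_nat_plus_minus_square(1), of "real j" j x y] that x by auto
    have nr: "norm (of_nat j + of_real x :: complex) = real j + x"
      using x by (metis norm_of_real of_real_add of_real_of_nat_eq abs_of_nonneg add_nonneg_nonneg of_nat_0_le_iff less_imp_le)
    show ?thesis
    proof (cases "j \<le> J")
      case True
      thus ?thesis unfolding t_def nr using a(1) that by (simp add: divide_right_mono)
    next
      case False
      have b: "norm (of_nat j - Complex x y) \<le> (real j - x) * (1 + y\<^sup>2 / (real (j - J))\<^sup>2)"
        using sqrt_ratio_bound[OF norm_ge_zero norm_of_nat_plus_minus_square(2), of "real (j - J)" j x y] False x
        by (auto simp: of_nat_diff)
      have nr': "norm (of_nat j - of_real x :: complex) = real j - x"
      proof -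
        have "norm (of_real (real j - x) :: complex) = real j - x" unfolding norm_of_real using False x by simp
        thus ?thesis by simp
      qed
      have "norm (of_nat j - Complex x y) * norm (of_nat j + Complex x y)
         \<le> ((real j - x) * (1 + y\<^sup>2 / (real (j - J))\<^sup>2)) * ((real j + x) * (1 + y\<^sup>2 / (real j)\<^sup>2))"
        using a b False x by (intro mult_mono) (auto intro!: mult_nonneg_nonneg)
      hence "norm (of_nat j - Complex x y) * norm (of_nat j + Complex x y) / (real j)\<^sup>2
         \<le> ((real j - x) * (1 + y\<^sup>2 / (real (j - J))\<^sup>2)) * ((real j + x) * (1 + y\<^sup>2 / (real j)\<^sup>2)) / (real j)\<^sup>2"
        by (rule divide_right_mono) simp
      thus ?thesis using False unfolding t_def nr nr' by (simp add: mult_ac)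
    qed
  qed
  have fin: "norm (e K (Complex x y)) * norm (P (Complex x y)) \<le> exp (2 * pi * \<bar>y\<bar>) * (norm (e K (of_real x)) * norm (P (of_real x)))"
    if K: "K \<ge> J" for K
  proof -
    have "(\<Prod>j=1..K. t j (Complex x y)) \<le> (\<Prod>j=1..K. t j (of_real x) * ((1 + y\<^sup>2 / (real j)\<^sup>2) * (if j \<le> J then 1 else 1 + y\<^sup>2 / (real (j - J))\<^sup>2)))"
      using t0 tle by (intro prod_mono) auto
    also have "\<dots> = (\<Prod>j=1..K. t j (of_real x)) * ((\<Prod>j=1..K. 1 + y\<^sup>2 / (real j)\<^sup>2) * (\<Prod>j=1..K. if j \<le> J then 1 else 1 + y\<^sup>2 / (real (j - J))\<^sup>2))"
      by (simp only: prod.distrib)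
    also have "(\<Prod>j=1..K. if j \<le> J then 1 else 1 + y\<^sup>2 / (real (j - J))\<^sup>2) = (\<Prod>j=1..K-J. 1 + y\<^sup>2 / (real j)\<^sup>2)"
    proof -
      have "(\<Prod>j=1..K. if j \<le> J then 1 else 1 + y\<^sup>2 / (real (j - J))\<^sup>2) = (\<Prod>j\<in>{J+1..K}. 1 + y\<^sup>2 / (real (j - J))\<^sup>2)"
        by (intro prod.mono_neutral_cong_right) auto
      also have "\<dots> = (\<Prod>j=1..K-J. 1 + y\<^sup>2 / (real j)\<^sup>2)"
        by (rule prod.reindex_bij_witness[of _ "\<lambda>j. j + J" "\<lambda>j. j - J"]) auto
      finally show ?thesis .
    qed
    also have "(\<Prod>j=1..K. t j (of_real x)) * ((\<Prod>j=1..K. 1 + y\<^sup>2 / (real j)\<^sup>2) * \<dots>)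
       \<le> (\<Prod>j=1..K. t j (of_real x)) * (exp (pi * \<bar>y\<bar>) * exp (pi * \<bar>y\<bar>))"
      by (intro mult_left_mono mult_mono prod_one_plus_square_le_exp prod_nonneg) (auto simp: t0)
    also have "exp (pi * \<bar>y\<bar>) * exp (pi * \<bar>y\<bar>) = exp (2 * pi * \<bar>y\<bar>)" by (simp flip: exp_add)
    finally show ?thesis using prod_t[OF K ny] prod_t[OF K nx] by (simp add: mult.commute)
  qed
  have lim: "(\<lambda>K. norm (e K s) * norm (P s)) \<longlonglongrightarrow> norm (trunc_sinc J s)" if s: "s \<notin> \<nat>" for s
  proof -
    have s0: "s \<noteq> 0" using s by auto
    have "(\<lambda>K. (of_real pi * s * e K s) / (of_real pi * s)) \<longlonglongrightarrow> sin (of_real pi * s) / (of_real pi * s)"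
      unfolding e_def using s0 by (intro tendsto_divide sin_product_formula_complex tendsto_const) auto
    hence "(\<lambda>K. e K s) \<longlonglongrightarrow> sin (of_real pi * s) / (of_real pi * s)" using s0 by simp
    hence "(\<lambda>K. norm (e K s * P s)) \<longlonglongrightarrow> norm (sin (of_real pi * s) / (of_real pi * s) * P s)"
      by (intro tendsto_intros)
    thus ?thesis unfolding trunc_sinc_eq[OF s] P_def[symmetric] by (simp only: norm_mult)
  qed
  show ?thesis
  proof (rule tendsto_le[OF sequentially_bot _ lim[OF ny]])
    show "(\<lambda>K. exp (2 * pi * \<bar>y\<bar>) * (norm (e K (of_real x)) * norm (P (of_real x)))) \<longlonglongrightarrow> exp (2 * pi * \<bar>y\<bar>) * norm (trunc_sinc J (of_real x))"
      by (intro tendsto_mult lim[OF nx] tendsto_const)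
    show "eventually (\<lambda>K. norm (e K (Complex x y)) * norm (P (Complex x y)) \<le> exp (2 * pi * \<bar>y\<bar>) * (norm (e K (of_real x)) * norm (P (of_real x)))) sequentially"
      using fin by (auto intro: eventually_sequentiallyI)
  qed
qed

lemma trunc_sinc_real_lower:
  fixes x y :: real
  assumes x: "0 < x" "x \<le> real J"
  shows "norm (trunc_sinc J (Complex x y)) \<le> exp (2 * pi * \<bar>y\<bar>) * norm (trunc_sinc J (of_real x))"
proof -
  \<comment> \<open>No integer lies strictly between m and x, so x can be approached from the left
    by noninteger points, which also stay below J.\<close>
  define m where "m = \<lceil>x\<rceil> - 1"
  have m: "real_of_int m < x" "x \<le> real_of_int m + 1" by (auto simp: m_def) linarith+
  have ev: "eventually (\<lambda>v. norm (trunc_sinc J (Complex v y)) \<le> exp (2 * pi * \<bar>y\<bar>) * norm (trunc_sinc J (of_real v))) (at_left x)"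
  proof -
    have "eventually (\<lambda>v. v \<in> {max 0 (real_of_int m)<..<x}) (at_left x)"
      using m x by (intro eventually_at_left_real) auto
    thus ?thesis
    proof eventually_elim
      case (elim v)
      have "v \<notin> \<nat>"
      proof
        assume "v \<in> \<nat>"
        then obtain k where "v = real k" by (auto simp: Nats_def)
        hence "real_of_int m < real_of_int (int k)" "real_of_int (int k) < real_of_int (m + 1)"
          using elim m by auto
        thus False by (simp only: of_int_less_iff)
      qed
      thus ?case using elim x by (intro trunc_sinc_real_lower_noninteger) auto
    qed
  qed
  have cont: "isCont (trunc_sinc J) s" for s
    using holomorphic_on_imp_continuous_on[OF trunc_sinc_holomorphic[of J UNIV]]
    by (simp add: continuous_on_eq_continuous_at)
  have l1: "((\<lambda>v. Complex v y) \<longlongrightarrow> Complex x y) (at_left x)"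
    unfolding Complex_eq by (intro tendsto_intros)
  have l2: "((\<lambda>v. of_real v :: complex) \<longlongrightarrow> of_real x) (at_left x)"
    by (intro tendsto_intros)
  show ?thesis
  proof (rule tendsto_le[OF _ _ _ ev])
    show "at_left x \<noteq> bot" by simp
    show "((\<lambda>v. norm (trunc_sinc J (Complex v y))) \<longlongrightarrow> norm (trunc_sinc J (Complex x y))) (at_left x)"
      by (intro tendsto_norm isCont_tendsto_compose[OF cont l1])
    show "((\<lambda>v. exp (2 * pi * \<bar>y\<bar>) * norm (trunc_sinc J (of_real v))) \<longlongrightarrow> exp (2 * pi * \<bar>y\<bar>) * norm (trunc_sinc J (of_real x))) (at_left x)"
      by (intro tendsto_mult tendsto_const tendsto_norm isCont_tendsto_compose[OF cont l2])
  qed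
qed

subsection \<open>Dual functions\<close>

text \<open>Rounding a / d down is injective on points with mutual distance at least d and yields
  positive integers, so the product is dominated by the one over the integers at y / d.\<close>

lemma prod_separated_le_exp:
  fixes A :: "real set" and d y :: real
  assumes "finite A" "d > 0" "\<And>a. a \<in> A \<Longrightarrow> a \<ge> d" "\<And>a b. a \<in> A \<Longrightarrow> b \<in> A \<Longrightarrow> a < b \<Longrightarrow> b - a \<ge> d"
  shows "(\<Prod>a\<in>A. 1 + y\<^sup>2 / a\<^sup>2) \<le> exp (pi * \<bar>y\<bar> / d)"
proof -
  define k where "k a = nat \<lfloor>a / d\<rfloor>" for a
  have k1: "k a \<ge> 1" "real (k a) * d \<le> a" if "a \<in> A" for a
  proof -
    have "a / d \<ge> 1" using assms(2) assms(3)[OF that] by simp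
    hence "\<lfloor>a / d\<rfloor> \<ge> 1" by (simp add: le_floor_iff)
    thus "k a \<ge> 1" by (simp add: k_def le_nat_iff)
    have "real (k a) = real_of_int \<lfloor>a / d\<rfloor>" using \<open>\<lfloor>a / d\<rfloor> \<ge> 1\<close> by (simp add: k_def)
    also have "\<dots> \<le> a / d" by simp
    finally show "real (k a) * d \<le> a" using assms(2) by (simp add: pos_le_divide_eq)
  qed
  have inj: "inj_on k A"
  proof (rule inj_onI)
    fix a b assume ab: "a \<in> A" "b \<in> A" "k a = k b"
    have "a / d \<ge> 1" "b / d \<ge> 1" using assms(2) assms(3) ab by simp_all
    hence "\<lfloor>a / d\<rfloor> = \<lfloor>b / d\<rfloor>" using ab(3) unfolding k_def
      by (subst (asm) eq_nat_nat_iff) (simp_all add: le_floor_iff)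
    hence "\<bar>a / d - b / d\<bar> < 1" by linarith
    hence "\<bar>a - b\<bar> < d" using assms(2) by (simp add: diff_divide_distrib [symmetric] abs_divide)
    thus "a = b" using assms(4)[of a b] assms(4)[of b a] ab by (cases a b rule: linorder_cases) auto
  qed
  obtain K where K: "k ` A \<subseteq> {1..K}"
  proof -
    have "finite (k ` A)" using assms(1) by simp
    then obtain K where "\<forall>n\<in>k ` A. n \<le> K" by (metis finite_nat_set_iff_bounded_le)
    hence "k ` A \<subseteq> {1..K}" using k1(1) by auto
    thus ?thesis by (rule that)
  qed
  have "(\<Prod>a\<in>A. 1 + y\<^sup>2 / a\<^sup>2) \<le> (\<Prod>a\<in>A. 1 + (y / d)\<^sup>2 / (real (k a))\<^sup>2)"
  proof (intro prod_mono conjI)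
    fix a assume a: "a \<in> A"
    have "(real (k a) * d)\<^sup>2 \<le> a\<^sup>2" using k1[OF a] assms(2) by (intro power_mono) auto
    hence "y\<^sup>2 / a\<^sup>2 \<le> y\<^sup>2 / (real (k a) * d)\<^sup>2" using k1[OF a] assms(2) assms(3)[OF a]
      by (intro divide_left_mono mult_pos_pos) auto
    thus "1 + y\<^sup>2 / a\<^sup>2 \<le> 1 + (y / d)\<^sup>2 / (real (k a))\<^sup>2" by (simp add: power_mult_distrib power_divide mult.commute)
  qed auto
  also have "\<dots> = (\<Prod>j\<in>k ` A. 1 + (y / d)\<^sup>2 / (real j)\<^sup>2)" by (simp add: prod.reindex[OF inj])
  also have "\<dots> \<le> (\<Prod>j=1..K. 1 + (y / d)\<^sup>2 / (real j)\<^sup>2)"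
    using K by (intro prod_mono2) auto
  also have "\<dots> \<le> exp (pi * \<bar>y / d\<bar>)" by (rule prod_one_plus_square_le_exp)
  finally show ?thesis using assms(2) by (simp add: abs_divide)
qed

section \<open>Blaschke factors and dual functions\<close>

definition Blaschke_factor :: "real \<Rightarrow> complex \<Rightarrow> complex" where
  "Blaschke_factor t s = (of_real t - s) / (of_real t + s)"

lemma of_real_plus_nonzero: "t > 0 \<Longrightarrow> Re s \<ge> 0 \<Longrightarrow> of_real t + s \<noteq> 0"
  by (auto simp: complex_eq_iff)

lemma norm_Blaschke_factor_le:
  assumes "t > 0" "Re s \<ge> 0" shows "norm (Blaschke_factor t s) \<le> 1"
proof -
  have "(t - Re s)\<^sup>2 \<le> (t + Re s)\<^sup>2" using assms by (simp add: power2_eq_square algebra_simps)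
  hence "(norm (of_real t - s))\<^sup>2 \<le> (norm (of_real t + s))\<^sup>2" by (simp add: cmod_power2)
  hence "norm (of_real t - s) \<le> norm (of_real t + s)" by (rule power2_le_imp_le) simp
  thus ?thesis using of_real_plus_nonzero[OF assms] by (simp add: Blaschke_factor_def norm_divide)
qed

lemma Blaschke_factor_holomorphic:
  assumes "t > 0" shows "Blaschke_factor t holomorphic_on {s. Re s \<ge> 0}"
  unfolding Blaschke_factor_def [abs_def] using assms
  by (intro holomorphic_intros) (auto simp: of_real_plus_nonzero)

text \<open>On a ray at angle \<theta> this makes |sin(\<pi>s)/(\<pi>s)| at least sin \<theta> / 2,
  so the sine factor cannot spoil lower bounds there.\<close>

lemma Im_le_norm_sin: "\<bar>Im z\<bar> / 2 \<le> norm (sin z)" for z :: complex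
proof -
  have *: "t \<le> exp t - exp (- t)" if "t \<ge> 0" for t :: real
  proof -
    have "exp (- t) \<le> 1 / (1 + t)"
      using exp_ge_add_one_self[of t] that by (simp add: exp_minus inverse_eq_divide frac_le)
    moreover have "1 / (1 + t) \<le> 1" using that by simp
    ultimately show ?thesis using exp_ge_add_one_self[of t] by linarith
  qed
  have "\<bar>Im z\<bar> \<le> \<bar>exp (- Im z) - exp (Im z)\<bar>"
    using *[of "Im z"] *[of "- Im z"] by (cases "Im z \<ge> 0") auto
  also have "\<dots> = \<bar>norm (exp (\<i> * z)) - norm (exp (- (\<i> * z)))\<bar>" by simp
  also have "\<dots> \<le> norm (exp (\<i> * z) - exp (- (\<i> * z)))" by (rule norm_triangle_ineq3)
  finally show ?thesis by (simp add: sin_exp_eq norm_divide norm_mult)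
qed

text \<open>The Blaschke product over T, divided by the e-th power of that over 1, ..., J and
  multiplied by the e-th power of sin(\<pi>s)/(\<pi>s). The values of e that matter are 1 for a
  sector of positive opening and 0 for the interval. T will be the completed sequence up to J
  without the exponent under study.\<close>

definition dual_fun :: "real set \<Rightarrow> nat \<Rightarrow> nat \<Rightarrow> complex \<Rightarrow> complex" where
  "dual_fun T J e s = (\<Prod>t\<in>T. Blaschke_factor t s) * trunc_sinc J s ^ e"

lemma dual_fun_holomorphic:
  assumes "finite T" "T \<subseteq> {0<..}"
  shows "dual_fun T J e holomorphic_on {s. Re s \<ge> 0}"
  unfolding dual_fun_def [abs_def] using assms
  by (intro holomorphic_intros Blaschke_factor_holomorphic) auto

lemma dual_fun_eq_0:
  assumes "finite T" "t \<in> T"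
  shows "dual_fun T J e (of_real t) = 0"
proof -
  have "(\<Prod>t'\<in>T. Blaschke_factor t' (of_real t)) = 0"
    using assms by (intro prod_zero) (auto simp: Blaschke_factor_def)
  thus ?thesis by (simp add: dual_fun_def)
qed

lemma norm_prod_Blaschke_le:
  assumes "T \<subseteq> {0<..}" "Re s \<ge> 0"
  shows "norm (\<Prod>t\<in>T. Blaschke_factor t s) \<le> 1"
  unfolding prod_norm [symmetric] using assms
  by (intro prod_le_1 conjI norm_ge_zero norm_Blaschke_factor_le) auto

lemma dual_fun_growth:
  assumes "T \<subseteq> {0<..}"
  shows "\<exists>C. \<forall>s. Re s \<ge> 0 \<longrightarrow> norm (dual_fun T J e s) \<le> C * exp (pi * real e * \<bar>Im s\<bar>)"
proof -
  obtain C where C: "\<And>s. Re s \<ge> 0 \<Longrightarrow> norm (trunc_sinc J s) \<le> C * exp (pi * \<bar>Im s\<bar>)"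
    using trunc_sinc_growth by blast
  have "norm (dual_fun T J e s) \<le> C ^ e * exp (pi * real e * \<bar>Im s\<bar>)" if "Re s \<ge> 0" for s
  proof -
    have "norm (dual_fun T J e s) \<le> 1 * (C * exp (pi * \<bar>Im s\<bar>)) ^ e"
      unfolding dual_fun_def norm_mult norm_power
      by (intro mult_mono power_mono C that norm_prod_Blaschke_le assms) auto
    also have "\<dots> = C ^ e * exp (pi * real e * \<bar>Im s\<bar>)"
      by (simp add: power_mult_distrib exp_of_nat_mult [symmetric] mult_ac)
    finally show ?thesis .
  qed
  thus ?thesis by blast
qed

lemma norm_dual_fun_imaginary:
  assumes "T \<subseteq> {0<..}"
  shows "norm (dual_fun T J e (\<i> * of_real y)) \<le> exp (pi * real e * \<bar>y\<bar>)"
proof -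
  have "norm (dual_fun T J e (\<i> * of_real y)) \<le> 1 * exp (pi * \<bar>y\<bar>) ^ e"
    unfolding dual_fun_def norm_mult norm_power
    by (intro mult_mono power_mono norm_trunc_sinc_imaginary norm_prod_Blaschke_le assms) auto
  thus ?thesis by (simp add: exp_of_nat_mult [symmetric] mult_ac)
qed

text \<open>It turns a lower bound at a point of the ray with real part \<mu> into one at \<mu>.
  Going from \<mu> + iy to \<mu> shrinks a numerator by at most the factor 1 + y^2/(t - \<mu>)^2 and
  does not enlarge the denominator; by the separation these factors multiply to at most
  exp(\<pi>|y|/d) on either side of \<mu>. The sine part is
  \<open>trunc_sinc_real_lower\<close>.\<close>

lemma dual_fun_lower_transfer:
  fixes \<mu> y d :: real
  assumes T: "finite T" "T \<subseteq> {0<..}" "\<mu> > 0" "\<mu> \<le> real J" and d: "d > 0"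
    and sep: "\<And>a b. a \<in> insert \<mu> T \<Longrightarrow> b \<in> insert \<mu> T \<Longrightarrow> a < b \<Longrightarrow> b - a \<ge> d" and \<mu>: "\<mu> \<notin> T"
  shows "norm (dual_fun T J e (Complex \<mu> y)) \<le> exp (2 * pi * (1 / d + real e) * \<bar>y\<bar>) * norm (dual_fun T J e (of_real \<mu>))"
proof -
  have each: "norm (Blaschke_factor t (Complex \<mu> y)) \<le> norm (Blaschke_factor t (of_real \<mu>)) * (1 + y\<^sup>2 / (t - \<mu>)\<^sup>2)"
    if t: "t \<in> T" for t
  proof -
    have tp: "t > 0" "t \<noteq> \<mu>" using t T \<mu> by auto
    have 1: "norm (of_real t - Complex \<mu> y) \<le> \<bar>t - \<mu>\<bar> * (1 + y\<^sup>2 / \<bar>t - \<mu>\<bar>\<^sup>2)"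
      using tp by (intro sqrt_ratio_bound(2)) (auto simp: cmod_power2)
    have 2: "norm (of_real t + Complex \<mu> y) \<ge> t + \<mu>"
      using complex_Re_le_cmod[of "of_real t + Complex \<mu> y"] by simp
    have "norm (of_real t - Complex \<mu> y) / norm (of_real t + Complex \<mu> y) \<le> \<bar>t - \<mu>\<bar> * (1 + y\<^sup>2 / \<bar>t - \<mu>\<bar>\<^sup>2) / (t + \<mu>)"
      using 1 2 tp T by (intro frac_le) auto
    moreover have "norm (Blaschke_factor t (of_real \<mu>)) = \<bar>t - \<mu>\<bar> / (t + \<mu>)"
    proof -
      have "Blaschke_factor t (of_real \<mu>) = of_real ((t - \<mu>) / (t + \<mu>))" by (simp add: Blaschke_factor_def)
      thus ?thesis using tp T by (simp only: norm_of_real abs_divide)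
    qed
    ultimately show ?thesis by (simp add: Blaschke_factor_def norm_divide)
  qed
  define A where "A = (\<lambda>t. t - \<mu>) ` {t\<in>T. t > \<mu>}"
  define B where "B = (\<lambda>t. \<mu> - t) ` {t\<in>T. t < \<mu>}"
  have AB: "finite A" "finite B" using T by (auto simp: A_def B_def)
  have pA: "(\<Prod>a\<in>A. 1 + y\<^sup>2 / a\<^sup>2) \<le> exp (pi * \<bar>y\<bar> / d)"
    using AB d sep by (intro prod_separated_le_exp) (auto simp: A_def)
  have pB: "(\<Prod>a\<in>B. 1 + y\<^sup>2 / a\<^sup>2) \<le> exp (pi * \<bar>y\<bar> / d)"
    using AB d by (intro prod_separated_le_exp) (auto simp: B_def dest: sep[rotated 2])
  have "(\<Prod>t\<in>T. 1 + y\<^sup>2 / (t - \<mu>)\<^sup>2) = (\<Prod>a\<in>A. 1 + y\<^sup>2 / a\<^sup>2) * (\<Prod>a\<in>B. 1 + y\<^sup>2 / a\<^sup>2)"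
  proof -
    have "T = {t\<in>T. t > \<mu>} \<union> {t\<in>T. t < \<mu>}" using \<mu> by (auto simp: not_less_iff_gr_or_eq)
    hence "(\<Prod>t\<in>T. 1 + y\<^sup>2 / (t - \<mu>)\<^sup>2) = (\<Prod>t\<in>{t\<in>T. t > \<mu>} \<union> {t\<in>T. t < \<mu>}. 1 + y\<^sup>2 / (t - \<mu>)\<^sup>2)" by simp
    also have "\<dots> = (\<Prod>t\<in>{t\<in>T. t > \<mu>}. 1 + y\<^sup>2 / (t - \<mu>)\<^sup>2) * (\<Prod>t\<in>{t\<in>T. t < \<mu>}. 1 + y\<^sup>2 / (t - \<mu>)\<^sup>2)"
      using T by (intro prod.union_disjoint) auto
    also have "(\<Prod>t\<in>{t\<in>T. t > \<mu>}. 1 + y\<^sup>2 / (t - \<mu>)\<^sup>2) = (\<Prod>a\<in>A. 1 + y\<^sup>2 / a\<^sup>2)"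
      unfolding A_def by (subst prod.reindex) (auto simp: inj_on_def)
    also have "(\<Prod>t\<in>{t\<in>T. t < \<mu>}. 1 + y\<^sup>2 / (t - \<mu>)\<^sup>2) = (\<Prod>a\<in>B. 1 + y\<^sup>2 / a\<^sup>2)"
      unfolding B_def by (subst prod.reindex) (auto simp: inj_on_def power2_commute)
    finally show ?thesis .
  qed
  also have "\<dots> \<le> exp (pi * \<bar>y\<bar> / d) * exp (pi * \<bar>y\<bar> / d)"
    by (intro mult_mono pA pB prod_nonneg) auto
  also have "\<dots> = exp (2 * pi * (1 / d) * \<bar>y\<bar>)" by (simp flip: exp_add)
  finally have prod: "(\<Prod>t\<in>T. 1 + y\<^sup>2 / (t - \<mu>)\<^sup>2) \<le> exp (2 * pi * (1 / d) * \<bar>y\<bar>)" .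
  have "norm (\<Prod>t\<in>T. Blaschke_factor t (Complex \<mu> y)) \<le> (\<Prod>t\<in>T. norm (Blaschke_factor t (of_real \<mu>)) * (1 + y\<^sup>2 / (t - \<mu>)\<^sup>2))"
    unfolding prod_norm [symmetric] using each by (intro prod_mono) auto
  also have "\<dots> = norm (\<Prod>t\<in>T. Blaschke_factor t (of_real \<mu>)) * (\<Prod>t\<in>T. 1 + y\<^sup>2 / (t - \<mu>)\<^sup>2)"
    by (simp only: prod.distrib prod_norm)
  also have "\<dots> \<le> norm (\<Prod>t\<in>T. Blaschke_factor t (of_real \<mu>)) * exp (2 * pi * (1 / d) * \<bar>y\<bar>)"
    by (intro mult_left_mono prod) auto
  finally have 1: "norm (\<Prod>t\<in>T. Blaschke_factor t (Complex \<mu> y)) \<le> norm (\<Prod>t\<in>T. Blaschke_factor t (of_real \<mu>)) * exp (2 * pi * (1 / d) * \<bar>y\<bar>)" .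
  have "norm (trunc_sinc J (Complex \<mu> y)) ^ e \<le> (exp (2 * pi * \<bar>y\<bar>) * norm (trunc_sinc J (of_real \<mu>))) ^ e"
    using T by (intro power_mono trunc_sinc_real_lower) auto
  hence "norm (dual_fun T J e (Complex \<mu> y)) \<le> (norm (\<Prod>t\<in>T. Blaschke_factor t (of_real \<mu>)) * exp (2 * pi * (1 / d) * \<bar>y\<bar>))
      * (exp (2 * pi * \<bar>y\<bar>) * norm (trunc_sinc J (of_real \<mu>))) ^ e"
    unfolding dual_fun_def norm_mult norm_power by (intro mult_mono 1) auto
  also have "\<dots> = (exp (2 * pi * (1 / d) * \<bar>y\<bar>) * exp (2 * pi * \<bar>y\<bar>) ^ e) * norm (dual_fun T J e (of_real \<mu>))"
    unfolding dual_fun_def norm_mult norm_power power_mult_distrib by (simp only: mult_ac)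
  also have "exp (2 * pi * (1 / d) * \<bar>y\<bar>) * exp (2 * pi * \<bar>y\<bar>) ^ e = exp (2 * pi * (1 / d + real e) * \<bar>y\<bar>)"
    by (simp add: exp_of_nat_mult [symmetric] exp_add [symmetric] algebra_simps)
  finally show ?thesis .
qed

text \<open>The hypothesis speaks of the moduli of the Blaschke factors and not of an angle, so that
  a ray and its conjugate are covered together.\<close>

lemma norm_dual_fun_on_ray:
  fixes c :: real and s :: complex
  assumes s: "Im s \<noteq> 0" "\<And>t. t > 0 \<Longrightarrow> norm (Blaschke_factor t s) = exp (sector_log c (t / r))"
    and T: "finite T" "T \<subseteq> {0<..}"
  shows "norm (dual_fun T J e s) = exp ((\<Sum>t\<in>T. sector_log c (t / r)) - real e * (\<Sum>j=1..J. sector_log c (real j / r)))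
     * norm (sin (of_real pi * s) / (of_real pi * s)) ^ e"
proof -
  have "s \<notin> \<nat>" using s(1) by (auto simp: Nats_def)
  have 1: "norm (\<Prod>t\<in>T. Blaschke_factor t s) = exp (\<Sum>t\<in>T. sector_log c (t / r))"
    unfolding prod_norm [symmetric] exp_sum[OF T(1)] using T s(2) by (intro prod.cong) auto
  have "norm (\<Prod>j=1..J. (of_nat j + s) / (of_nat j - s)) = (\<Prod>j=1..J. inverse (exp (sector_log c (real j / r))))"
    unfolding prod_norm [symmetric]
  proof (intro prod.cong refl)
    fix j assume "j \<in> {1..J}"
    hence "norm (Blaschke_factor (real j) s) = exp (sector_log c (real j / r))" by (intro s(2)) auto
    moreover have "(of_nat j + s) / (of_nat j - s) = inverse (Blaschke_factor (real j) s)"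
      by (simp add: Blaschke_factor_def)
    ultimately show "norm ((of_nat j + s) / (of_nat j - s)) = inverse (exp (sector_log c (real j / r)))"
      by (simp only: norm_inverse)
  qed
  also have "\<dots> = exp (- (\<Sum>j=1..J. sector_log c (real j / r)))"
    by (simp add: exp_sum sum_negf[symmetric] exp_minus)
  finally have 2: "norm (trunc_sinc J s) = norm (sin (of_real pi * s) / (of_real pi * s)) * exp (- (\<Sum>j=1..J. sector_log c (real j / r)))"
    unfolding trunc_sinc_eq[OF \<open>s \<notin> \<nat>\<close>] norm_mult by simp
  show ?thesis
    unfolding dual_fun_def norm_mult norm_power 1 2 power_mult_distrib exp_diff exp_of_nat_mult exp_minus power_inverse
    by (simp only: divide_inverse mult_ac)
qed

section \<open>Bounds for dual functions uniform in the truncation\<close>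

lemma separated_cell:
  fixes S :: "real set" and d :: real
  assumes "d > 0" "\<And>a b. a \<in> S \<Longrightarrow> b \<in> S \<Longrightarrow> a < b \<Longrightarrow> b - a \<ge> d"
  shows "finite (S \<inter> {x<..x+1}) \<and> card (S \<inter> {x<..x+1}) \<le> nat \<lfloor>1 / d\<rfloor> + 1"
proof -
  define k where "k a = nat \<lfloor>(a - x) / d\<rfloor>" for a
  have inj: "inj_on k (S \<inter> {x<..x+1})"
  proof (rule inj_onI)
    fix a b assume ab: "a \<in> S \<inter> {x<..x+1}" "b \<in> S \<inter> {x<..x+1}" "k a = k b"
    have "(a - x) / d \<ge> 0" "(b - x) / d \<ge> 0" using assms(1) ab by simp_all
    hence "\<lfloor>(a - x) / d\<rfloor> = \<lfloor>(b - x) / d\<rfloor>" using ab(3) unfolding k_def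
      by (subst (asm) eq_nat_nat_iff) (simp_all add: le_floor_iff)
    hence "\<bar>(a - x) / d - (b - x) / d\<bar> < 1" by linarith
    hence "\<bar>a - b\<bar> < d" using assms(1) by (simp add: diff_divide_distrib [symmetric] abs_divide)
    thus "a = b" using assms(2)[of a b] assms(2)[of b a] ab by (cases a b rule: linorder_cases) auto
  qed
  moreover have "k ` (S \<inter> {x<..x+1}) \<subseteq> {0..nat \<lfloor>1 / d\<rfloor>}"
  proof
    fix n assume "n \<in> k ` (S \<inter> {x<..x+1})"
    then obtain a where a: "a \<le> x + 1" "n = k a" by auto
    have "(a - x) / d \<le> 1 / d" using a assms(1) by (intro divide_right_mono) auto
    hence "\<lfloor>(a - x) / d\<rfloor> \<le> \<lfloor>1 / d\<rfloor>" by (rule floor_mono)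
    thus "n \<in> {0..nat \<lfloor>1 / d\<rfloor>}" using a by (auto simp: k_def nat_mono)
  qed
  ultimately show ?thesis
    using inj_on_finite[of k _ "{0..nat \<lfloor>1 / d\<rfloor>}"] card_inj_on_le[of k _ "{0..nat \<lfloor>1 / d\<rfloor>}"] by fastforce
qed

text \<open>On the rays the full product is controlled by \<open>sector_log_sum_estimate\<close>.
  The omitted factor of \<mu> lies between sin \<theta> / 2 and 1, the sine factor between sin
  \<theta> / 2 and exp(\<pi> r sin \<theta>), so both bounds survive up to a constant. The value at
  \<mu> is then reached from the ray by \<open>dual_fun_lower_transfer\<close>, at a cost that is
  small when \<theta> is small.\<close>

lemma dual_fun_estimate:
  fixes S :: "real set" and d \<theta> \<eta> :: real and e :: nat
  assumes d: "d > 0" and S: "S \<subseteq> {0<..}"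
    and sep: "\<And>a b. a \<in> S \<Longrightarrow> b \<in> S \<Longrightarrow> a < b \<Longrightarrow> b - a \<ge> d"
    and conv: "convergent (\<lambda>J. \<Sum>j=1..J. (real (card (S \<inter> {real j - 1 <.. real j})) - real e) / real j)"
    and \<theta>: "0 < \<theta>" "\<theta> < pi / 2" and \<eta>: "\<eta> > 0"
  defines "R \<equiv> \<lambda>J \<mu>. dual_fun (S \<inter> {0<..real J} - {\<mu>}) J e"
  shows "\<exists>C>0. \<forall>J \<mu>. \<mu> \<in> S \<longrightarrow> \<mu> \<le> real J \<longrightarrow>
    (\<forall>r\<ge>0. norm (R J \<mu> (of_real r * cis \<theta>)) \<le> C * exp ((\<eta> + pi * real e * sin \<theta>) * r) \<and>
           norm (R J \<mu> (of_real r * cis (- \<theta>))) \<le> C * exp ((\<eta> + pi * real e * sin \<theta>) * r)) \<and>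
    exp (- (\<eta> / cos \<theta> + 2 * pi * (1 / d + real e) * tan \<theta>) * \<mu>) \<le> C * norm (R J \<mu> (of_real \<mu>))"
proof -
  have trig: "0 < sin \<theta>" "0 < cos \<theta>" "cos \<theta> < 1" "sin \<theta> \<le> 1"
    using \<theta> sin_gt_zero[of \<theta>] cos_gt_zero[of \<theta>] cos_monotone_0_pi[of 0 \<theta>] by auto
  have cell: "finite (S \<inter> {real j<..real (Suc j)})" "card (S \<inter> {real j<..real (Suc j)}) \<le> nat \<lfloor>1 / d\<rfloor> + 1" for j
    using separated_cell[of d S "real j"] d sep by (auto simp: add.commute)
  obtain C0 where C0: "\<And>J r. r > 0 \<Longrightarrow> \<bar>(\<Sum>x\<in>S \<inter> {0<..real J}. sector_log (cos \<theta>) (x / r)) - real e * (\<Sum>j=1..J. sector_log (cos \<theta>) (real j / r))\<bar> \<le> \<eta> * r + C0"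
    using sector_log_sum_estimate[OF _ trig(3) cell conv \<eta>] trig by (meson less_imp_le)
  have fin: "finite (S \<inter> {0<..real J})" for J
    using sum_Ioc_by_cells[of S J] cell(1) by blast
  define C where "C = 1 + exp C0 * 2 / sin \<theta> + exp C0 * (2 / sin \<theta>) ^ e"
  have C: "C \<ge> 1" "C \<ge> exp C0 * 2 / sin \<theta>" "C \<ge> exp C0 * (2 / sin \<theta>) ^ e"
    using trig by (auto simp: C_def)
  have point: "norm (R J \<mu> s) \<le> C * exp ((\<eta> + pi * real e * sin \<theta>) * r)"
      "exp (- (\<eta> * r)) \<le> C * norm (R J \<mu> s)"
    if \<mu>: "\<mu> \<in> S" "\<mu> \<le> real J" and r: "r > 0" and s: "s = of_real r * cis \<theta> \<or> s = cnj (of_real r * cis \<theta>)" for J \<mu> r s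
  proof -
    let ?T = "S \<inter> {0<..real J}"
    have \<mu>T: "\<mu> \<in> ?T" using \<mu> S by auto
    have im: "\<bar>Im s\<bar> = r * sin \<theta>" and nm: "norm s = r" and re: "Re s = r * cos \<theta>"
      using s r trig by (auto simp: norm_mult abs_mult)
    have im0: "Im s \<noteq> 0" using im r trig by auto
    have s0: "s \<noteq> 0" using nm r by auto
    have re0: "Re s \<ge> 0" using re r trig by simp
    have bl: "norm (Blaschke_factor t s) = exp (sector_log (cos \<theta>) (t / r))" for t
      using Blaschke_factor_eq_sector_log[OF r, of \<theta> t] s trig unfolding Blaschke_factor_def by auto
    define q where "q = norm (sin (of_real pi * s) / (of_real pi * s))"
    have q_le: "q \<le> exp (pi * r * sin \<theta>)"
    proof -
      have "norm (of_real pi * s) > 0" using s0 by simp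
      moreover have "\<bar>Im (of_real pi * s)\<bar> = pi * r * sin \<theta>" using im by (simp add: abs_mult)
      ultimately show ?thesis
        using norm_sin_le[of "of_real pi * s"] by (simp only: q_def norm_divide pos_divide_le_eq mult.commute)
    qed
    have q_ge: "q \<ge> sin \<theta> / 2"
    proof -
      have "pi * r * sin \<theta> / 2 \<le> norm (sin (of_real pi * s))"
        using Im_le_norm_sin[of "of_real pi * s"] im by (simp add: abs_mult)
      moreover have "norm (of_real pi * s) = pi * r" using nm by (simp add: norm_mult)
      ultimately show ?thesis using r by (simp add: q_def norm_divide pos_le_divide_eq mult_ac)
    qed
    define b where "b = norm (Blaschke_factor \<mu> s)"
    have b_le: "b \<le> 1" using norm_Blaschke_factor_le[of \<mu> s] \<mu>T re0 by (simp add: b_def)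
    have b_ge: "b \<ge> sin \<theta> / 2"
    proof -
      have \<mu>0: "\<mu> > 0" using \<mu>T by simp
      have sc: "(sin \<theta>)\<^sup>2 + (cos \<theta>)\<^sup>2 = 1" by simp
      \<comment> \<open>The distance from \<mu> to s is at least r sin \<theta>, the distance of s
        from the real axis, and at least \<mu> sin \<theta>, the distance of \<mu> from the line
        carrying the ray; the claim uses the mean of the two.\<close>
      have n2: "(norm (of_real \<mu> - s))\<^sup>2 = (\<mu> - r * cos \<theta>)\<^sup>2 + (r * sin \<theta>)\<^sup>2"
        using re im by (simp add: cmod_power2 power2_abs[symmetric, of "Im s"])
      have "(r * sin \<theta>)\<^sup>2 \<le> (norm (of_real \<mu> - s))\<^sup>2" unfolding n2 by simp
      hence a1: "r * sin \<theta> \<le> norm (of_real \<mu> - s)" by (rule power2_le_imp_le) simp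
      \<comment> \<open>The last summand is zero; with it the equation is a polynomial identity in
        which sin \<theta> and cos \<theta> may be independent variables.\<close>
      have "(norm (of_real \<mu> - s))\<^sup>2 = (\<mu> * cos \<theta> - r)\<^sup>2 + (\<mu> * sin \<theta>)\<^sup>2
          + (\<mu>\<^sup>2 - r\<^sup>2) * (1 - ((sin \<theta>)\<^sup>2 + (cos \<theta>)\<^sup>2))"
        unfolding n2 by (simp only: power2_eq_square algebra_simps)
      hence "(\<mu> * sin \<theta>)\<^sup>2 \<le> (norm (of_real \<mu> - s))\<^sup>2" unfolding sc by simp
      hence a2: "\<mu> * sin \<theta> \<le> norm (of_real \<mu> - s)" by (rule power2_le_imp_le) simp
      have a3: "norm (of_real \<mu> + s) \<le> \<mu> + r" using norm_triangle_ineq[of "of_real \<mu>" s] nm \<mu>0 by simp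
      have "sin \<theta> / 2 * norm (of_real \<mu> + s) \<le> sin \<theta> / 2 * (\<mu> + r)" using a3 trig by (intro mult_left_mono) auto
      also have "\<dots> \<le> norm (of_real \<mu> - s)" using a1 a2 by (simp add: algebra_simps)
      finally show ?thesis
        using of_real_plus_nonzero[OF \<mu>0 re0] by (simp add: b_def Blaschke_factor_def norm_divide pos_le_divide_eq)
    qed
    have full: "b * norm (R J \<mu> s) = norm (dual_fun ?T J e s)"
      unfolding R_def dual_fun_def b_def
      by (subst prod.remove[OF fin \<mu>T]) (simp add: norm_mult)
    define X where "X = (\<Sum>x\<in>?T. sector_log (cos \<theta>) (x / r)) - real e * (\<Sum>j=1..J. sector_log (cos \<theta>) (real j / r))"
    have X: "\<bar>X\<bar> \<le> \<eta> * r + C0" unfolding X_def by (rule C0[OF r])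
    have val: "norm (dual_fun ?T J e s) = exp X * q ^ e"
      unfolding X_def q_def by (rule norm_dual_fun_on_ray[OF im0 bl fin]) auto
    have "sin \<theta> / 2 * norm (R J \<mu> s) \<le> b * norm (R J \<mu> s)" by (intro mult_right_mono b_ge) auto
    also have "\<dots> \<le> exp (\<eta> * r + C0) * exp (pi * r * sin \<theta>) ^ e"
      unfolding full val using X q_le by (intro mult_mono power_mono) (auto simp: q_def)
    also have "\<dots> = exp C0 * exp ((\<eta> + pi * real e * sin \<theta>) * r)"
      by (simp add: exp_of_nat_mult [symmetric] exp_add [symmetric] algebra_simps)
    finally have "norm (R J \<mu> s) \<le> exp C0 * 2 / sin \<theta> * exp ((\<eta> + pi * real e * sin \<theta>) * r)"
      using trig by (simp add: field_simps)
    also have "\<dots> \<le> C * exp ((\<eta> + pi * real e * sin \<theta>) * r)" by (intro mult_right_mono C) auto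
    finally show "norm (R J \<mu> s) \<le> C * exp ((\<eta> + pi * real e * sin \<theta>) * r)" .
    have "exp (- (\<eta> * r) - C0) * (sin \<theta> / 2) ^ e \<le> exp X * q ^ e"
      using X q_ge trig by (intro mult_mono power_mono) auto
    also have "\<dots> = b * norm (R J \<mu> s)" using full val by simp
    also have "\<dots> \<le> 1 * norm (R J \<mu> s)" by (intro mult_right_mono b_le) auto
    finally have l: "exp (- (\<eta> * r) - C0) * (sin \<theta> / 2) ^ e \<le> norm (R J \<mu> s)" by simp
    have "exp (- (\<eta> * r)) = (exp C0 * (2 / sin \<theta>) ^ e) * (exp (- (\<eta> * r) - C0) * (sin \<theta> / 2) ^ e)"
    proof -
      have "(2 / sin \<theta>) ^ e * (sin \<theta> / 2) ^ e = 1" using trig by (simp flip: power_mult_distrib)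
      moreover have "exp C0 * exp (- (\<eta> * r) - C0) = exp (- (\<eta> * r))" by (simp flip: exp_add)
      ultimately show ?thesis by (metis (no_types, lifting) mult.assoc mult.left_commute mult.right_neutral)
    qed
    also have "\<dots> \<le> C * norm (R J \<mu> s)"
      using l C trig by (intro mult_mono) auto
    finally show "exp (- (\<eta> * r)) \<le> C * norm (R J \<mu> s)" .
  qed
  show ?thesis
  proof (intro exI[of _ C] conjI allI impI)
    show "C > 0" using C by linarith
    fix J \<mu> assume \<mu>: "\<mu> \<in> S" "\<mu> \<le> real J"
    have zero: "norm (R J \<mu> 0) \<le> C"
    proof -
      have "norm (R J \<mu> (\<i> * of_real 0)) \<le> exp (pi * real e * \<bar>0\<bar>)"
        unfolding R_def using S by (intro norm_dual_fun_imaginary) auto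
      thus ?thesis using C by simp
    qed
    fix r :: real assume r: "r \<ge> 0"
    show "norm (R J \<mu> (of_real r * cis \<theta>)) \<le> C * exp ((\<eta> + pi * real e * sin \<theta>) * r)"
      using point(1)[OF \<mu>, of r "of_real r * cis \<theta>"] zero r by (cases "r = 0") auto
    show "norm (R J \<mu> (of_real r * cis (- \<theta>))) \<le> C * exp ((\<eta> + pi * real e * sin \<theta>) * r)"
      using point(1)[OF \<mu>, of r "of_real r * cis (-\<theta>)"] zero r by (cases "r = 0") (auto simp: cis_cnj)
  next
    fix J \<mu> assume \<mu>: "\<mu> \<in> S" "\<mu> \<le> real J"
    have \<mu>0: "\<mu> > 0" using \<mu> S by auto
    \<comment> \<open>The point of the ray with real part \<mu> has modulus \<mu> / cos \<theta> and
      imaginary part \<mu> tan \<theta>.\<close>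
    define r where "r = \<mu> / cos \<theta>"
    define y where "y = \<mu> * tan \<theta>"
    have r: "r > 0" using \<mu>0 trig by (simp add: r_def)
    have y: "\<bar>y\<bar> = \<mu> * tan \<theta>" using \<mu>0 trig by (simp add: y_def tan_def)
    have s: "Complex \<mu> y = of_real r * cis \<theta>"
      using trig by (simp add: complex_eq_iff r_def y_def tan_def)
    have "exp (- (\<eta> * r)) \<le> C * norm (R J \<mu> (Complex \<mu> y))"
      by (rule point(2)[OF \<mu> r]) (simp add: s)
    also have "norm (R J \<mu> (Complex \<mu> y)) \<le> exp (2 * pi * (1 / d + real e) * \<bar>y\<bar>) * norm (R J \<mu> (of_real \<mu>))"
      unfolding R_def using fin[of J] \<mu> \<mu>0 d by (intro dual_fun_lower_transfer) (auto intro: sep)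
    finally have "exp (- (\<eta> * r)) \<le> C * (exp (2 * pi * (1 / d + real e) * \<bar>y\<bar>) * norm (R J \<mu> (of_real \<mu>)))"
      using C by (simp add: mult_left_mono)
    hence "exp (- (2 * pi * (1 / d + real e) * \<bar>y\<bar>)) * exp (- (\<eta> * r))
      \<le> exp (- (2 * pi * (1 / d + real e) * \<bar>y\<bar>)) * (C * (exp (2 * pi * (1 / d + real e) * \<bar>y\<bar>) * norm (R J \<mu> (of_real \<mu>))))"
      by (rule mult_left_mono) simp
    also have "\<dots> = C * norm (R J \<mu> (of_real \<mu>))"
    proof -
      have "exp (- a) * (C * (exp a * N)) = C * N" for a N :: real by (simp add: exp_minus)
      thus ?thesis .
    qed
    also have "exp (- (2 * pi * (1 / d + real e) * \<bar>y\<bar>)) * exp (- (\<eta> * r)) = exp (- (\<eta> / cos \<theta> + 2 * pi * (1 / d + real e) * tan \<theta>) * \<mu>)"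
      unfolding y r_def exp_add [symmetric] by (simp add: algebra_simps)
    finally show "exp (- (\<eta> / cos \<theta> + 2 * pi * (1 / d + real e) * tan \<theta>) * \<mu>) \<le> C * norm (R J \<mu> (of_real \<mu>))" .
  qed
qed

subsection \<open>Coefficients of exponential sums in a half-strip\<close>

text \<open>M / (1 + t)^2 has integral M over the half-line, so the bound is independent of the
  length of the segment.\<close>

lemma contour_integral_ray_le:
  fixes f :: "complex \<Rightarrow> complex"
  assumes cont: "continuous_on (closed_segment 0 b) f" and M: "M \<ge> 0"
    and bound: "\<And>s. s \<in> closed_segment 0 b \<Longrightarrow> norm (f s) \<le> M / (1 + norm s)\<^sup>2"
  shows "norm (contour_integral (linepath 0 b) f) \<le> M"
proof -
  have "f contour_integrable_on linepath 0 b"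
    by (rule contour_integrable_continuous_linepath[OF cont])
  hence int: "(\<lambda>t. f (linepath 0 b t) * (b - 0)) integrable_on {0..1}"
    by (simp add: contour_integrable_on_def has_contour_integral_linepath integrable_on_def)
  define F where "F t = - M / (1 + t * norm b)" for t :: real
  have F: "((\<lambda>t. M * norm b / (1 + t * norm b)\<^sup>2) has_integral (F 1 - F 0)) {0..1}"
  proof (rule fundamental_theorem_of_calculus)
    fix t :: real assume t: "t \<in> {0..1}"
    have "1 + t * norm b > 0" using t by (auto intro: add_pos_nonneg)
    hence "((\<lambda>t. - M * inverse (1 + t * norm b)) has_real_derivative
        - M * (- (inverse (1 + t * norm b) * norm b * inverse (1 + t * norm b)))) (at t within {0..1})"
      by (intro DERIV_cmult DERIV_inverse') (auto intro!: derivative_eq_intros)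
    hence "(F has_real_derivative M * norm b / (1 + t * norm b)\<^sup>2) (at t within {0..1})"
      unfolding F_def [abs_def] by (simp add: divide_inverse power2_eq_square mult_ac)
    thus "(F has_vector_derivative M * norm b / (1 + t * norm b)\<^sup>2) (at t within {0..1})"
      by (simp add: has_real_derivative_iff_has_vector_derivative)
  qed simp
  have "norm (contour_integral (linepath 0 b) f) = norm (integral {0..1} (\<lambda>t. f (linepath 0 b t) * (b - 0)))"
    by (simp add: contour_integral_integral)
  also have "\<dots> \<le> integral {0..1} (\<lambda>t. M * norm b / (1 + t * norm b)\<^sup>2)"
  proof (rule integral_norm_bound_integral[OF int])
    show "(\<lambda>t. M * norm b / (1 + t * norm b)\<^sup>2) integrable_on {0..1}" using F by (auto simp: integrable_on_def)
    fix t :: real assume t: "t \<in> {0..1}"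
    have in_seg: "linepath 0 b t \<in> closed_segment 0 b" using t by (rule linepath_in_path)
    have n: "norm (linepath 0 b t) = t * norm b" using t by (simp add: linepath_def)
    have "norm (f (linepath 0 b t)) \<le> M / (1 + t * norm b)\<^sup>2"
      using bound[OF in_seg] unfolding n .
    hence "norm (f (linepath 0 b t)) * norm b \<le> M / (1 + t * norm b)\<^sup>2 * norm b" by (rule mult_right_mono) simp
    thus "norm (f (linepath 0 b t) * (b - 0)) \<le> M * norm b / (1 + t * norm b)\<^sup>2" by (simp add: norm_mult)
  qed
  also have "\<dots> = F 1 - F 0" using F by (rule integral_unique)
  also have "\<dots> \<le> M" using M by (simp add: F_def)
  finally show ?thesis .
qed

text \<open>A is the bound to be converted into one for the coefficients. The decay exp(- c u) makes
  the Laplace integral along an edge of the half-strip converge on the imaginary axis, with bound A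
  / c.\<close>

locale exponential_sum =
  fixes F :: "nat set" and a :: "nat \<Rightarrow> complex" and \<mu> :: "nat \<Rightarrow> real" and A \<beta> c :: real
  assumes finite_F: "finite F" and \<mu>_pos: "\<And>k. k \<in> F \<Longrightarrow> \<mu> k > 0"
    and \<beta>: "\<beta> \<ge> 0" and c: "c > 0"
    and sum_bound: "\<And>u v. u \<ge> 0 \<Longrightarrow> \<bar>v\<bar> \<le> \<beta> \<Longrightarrow>
      norm (\<Sum>k\<in>F. a k * exp (- of_real (\<mu> k) * Complex u v)) \<le> A * exp (- c * u)"
begin

definition Laplace_sum :: "complex \<Rightarrow> complex" where
  "Laplace_sum s = (\<Sum>k\<in>F. a k / (s - of_real (\<mu> k)))"

text \<open>
  \<open>Laplace_sum\<close> and \<open>Laplace_edge\<close> are, up to sign, the Laplace transforms of the exponential sum along the middle line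
  and along the edges \<open>Im w = \<plusminus>\<beta>\<close> of the half-strip. By Cauchy's theorem in the strip, the former minus \<open>e\<^bsup>i\<sigma>\<beta>s\<^esup>\<close> times the latter is
  an integral over the segment joining \<open>0\<close> to \<open>\<sigma>i\<beta>\<close>, which has no poles.
\<close>

definition Laplace_edge :: "real \<Rightarrow> complex \<Rightarrow> complex" where
  "Laplace_edge \<sigma> s = (\<Sum>k\<in>F. a k * exp (- (\<i> * of_real (\<sigma> * \<beta> * \<mu> k))) / (s - of_real (\<mu> k)))"

lemma A_nonneg: "A \<ge> 0"
proof -
  have "norm (\<Sum>k\<in>F. a k * exp (- of_real (\<mu> k) * Complex 0 0)) \<le> A"
    using sum_bound[of 0 0] \<beta> by simp
  thus ?thesis by (rule order_trans[OF norm_ge_zero])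
qed

text \<open>The difference is G \<beta> for an explicit G with G 0 = 0, whose derivative is, up to a
  unimodular constant, exp(i \<sigma> \<tau> s) times the exponential sum at i \<sigma> \<tau>. That
  exponential has modulus at most 1 because \<sigma> * Im s \<ge> 0, so the derivative is bounded by
  A on an interval of length \<beta>.\<close>

lemma Laplace_segment_bound:
  assumes \<sigma>: "\<bar>\<sigma>\<bar> = 1" and s: "\<sigma> * Im s \<ge> 0" "\<And>k. k \<in> F \<Longrightarrow> s \<noteq> of_real (\<mu> k)"
  shows "norm (Laplace_sum s - exp (\<i> * of_real (\<sigma> * \<beta>) * s) * Laplace_edge \<sigma> s) \<le> \<beta> * A"
proof (cases "\<beta> = 0")
  case True
  thus ?thesis unfolding Laplace_sum_def Laplace_edge_def by simp
next
  case False
  define G where "G \<tau> = (\<Sum>k\<in>F. a k * ((1 - exp (\<i> * of_real (\<sigma> * \<tau>) * (s - of_real (\<mu> k)))) / (s - of_real (\<mu> k))))" for \<tau> :: real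
  define G' where "G' \<tau> = - \<i> * of_real \<sigma> * (exp (\<i> * of_real (\<sigma> * \<tau>) * s) *
      (\<Sum>k\<in>F. a k * exp (- of_real (\<mu> k) * Complex 0 (\<sigma> * \<tau>))))" for \<tau> :: real
  have deriv: "(G has_vector_derivative G' \<tau>) (at \<tau> within X)" for \<tau> X
  proof -
    have "(G has_vector_derivative (\<Sum>k\<in>F. a k * (- (\<i> * of_real \<sigma> * (s - of_real (\<mu> k)) * exp (\<i> * of_real (\<sigma> * \<tau>) * (s - of_real (\<mu> k)))) / (s - of_real (\<mu> k))))) (at \<tau> within X)"
      unfolding G_def [abs_def]
    proof (intro has_vector_derivative_sum)
      fix k assume k: "k \<in> F"
      have "((\<lambda>z. a k * ((1 - exp (\<i> * (of_real \<sigma> * z) * (s - of_real (\<mu> k)))) / (s - of_real (\<mu> k)))) has_field_derivative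
         a k * (- (\<i> * of_real \<sigma> * (s - of_real (\<mu> k)) * exp (\<i> * (of_real \<sigma> * of_real \<tau>) * (s - of_real (\<mu> k)))) / (s - of_real (\<mu> k)))) (at (of_real \<tau>))"
        using s(2)[OF k] by (auto intro!: derivative_eq_intros)
      from has_vector_derivative_real_field[OF this]
      show "((\<lambda>\<tau>. a k * ((1 - exp (\<i> * of_real (\<sigma> * \<tau>) * (s - of_real (\<mu> k)))) / (s - of_real (\<mu> k)))) has_vector_derivative
         a k * (- (\<i> * of_real \<sigma> * (s - of_real (\<mu> k)) * exp (\<i> * of_real (\<sigma> * \<tau>) * (s - of_real (\<mu> k)))) / (s - of_real (\<mu> k)))) (at \<tau> within X)"
        by (simp only: of_real_mult)
    qed
    also have "(\<Sum>k\<in>F. a k * (- (\<i> * of_real \<sigma> * (s - of_real (\<mu> k)) * exp (\<i> * of_real (\<sigma> * \<tau>) * (s - of_real (\<mu> k)))) / (s - of_real (\<mu> k)))) = G' \<tau>"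
      unfolding G'_def sum_distrib_left
    proof (intro sum.cong refl)
      fix k assume k: "k \<in> F"
      have e: "exp (\<i> * of_real (\<sigma> * \<tau>) * (s - of_real (\<mu> k))) = exp (\<i> * of_real (\<sigma> * \<tau>) * s) * exp (- of_real (\<mu> k) * Complex 0 (\<sigma> * \<tau>))"
        by (simp add: exp_add [symmetric] Complex_eq algebra_simps)
      have "s - of_real (\<mu> k) \<noteq> 0" using s(2)[OF k] by simp
      thus "a k * (- (\<i> * of_real \<sigma> * (s - of_real (\<mu> k)) * exp (\<i> * of_real (\<sigma> * \<tau>) * (s - of_real (\<mu> k)))) / (s - of_real (\<mu> k))) =
        - \<i> * of_real \<sigma> * (exp (\<i> * of_real (\<sigma> * \<tau>) * s) * (a k * exp (- of_real (\<mu> k) * Complex 0 (\<sigma> * \<tau>))))"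
        unfolding e by simp
    qed
    finally show ?thesis .
  qed
  have bound: "norm (G' \<tau>) \<le> A" if "0 < \<tau>" "\<tau> < \<beta>" for \<tau>
  proof -
    have "\<bar>\<sigma> * \<tau>\<bar> \<le> \<beta>" using \<sigma> that by (simp add: abs_mult)
    hence 1: "norm (\<Sum>k\<in>F. a k * exp (- of_real (\<mu> k) * Complex 0 (\<sigma> * \<tau>))) \<le> A"
      using sum_bound[of 0 "\<sigma> * \<tau>"] by simp
    have 2: "norm (exp (\<i> * of_real (\<sigma> * \<tau>) * s)) \<le> 1"
    proof -
      have "\<tau> * (\<sigma> * Im s) \<ge> 0" using that mult_nonneg_nonneg[OF _ s(1), of \<tau>] by simp
      thus ?thesis by (simp add: mult_ac)
    qed
    have "norm (exp (\<i> * of_real (\<sigma> * \<tau>) * s)) * norm (\<Sum>k\<in>F. a k * exp (- of_real (\<mu> k) * Complex 0 (\<sigma> * \<tau>))) \<le> 1 * A"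
      using 1 2 A_nonneg by (intro mult_mono) auto
    thus ?thesis using \<sigma> unfolding G'_def norm_mult by simp
  qed
  have "norm (G \<beta> - G 0) \<le> A * \<beta> - A * 0"
  proof (rule differentiable_bound_general[of 0 \<beta>])
    show "0 < \<beta>" using False \<beta> by simp
    show "continuous_on {0..\<beta>} G"
      using deriv by (meson has_vector_derivative_continuous continuous_on_eq_continuous_within)
    show "continuous_on {0..\<beta>} (\<lambda>\<tau>. A * \<tau>)" by (intro continuous_intros)
    show "(G has_vector_derivative G' x) (at x)" for x using deriv[of x UNIV] by simp
    show "((\<lambda>\<tau>. A * \<tau>) has_vector_derivative A) (at x)" for x
      by (auto intro!: derivative_eq_intros)
  qed (use bound in auto)
  moreover have "G 0 = 0" by (simp add: G_def)
  moreover have "G \<beta> = Laplace_sum s - exp (\<i> * of_real (\<sigma> * \<beta>) * s) * Laplace_edge \<sigma> s"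
    unfolding G_def Laplace_sum_def Laplace_edge_def sum_distrib_left sum_subtractf [symmetric]
  proof (intro sum.cong refl)
    fix k assume k: "k \<in> F"
    have e: "exp (\<i> * of_real (\<sigma> * \<beta>) * (s - of_real (\<mu> k))) = exp (\<i> * of_real (\<sigma> * \<beta>) * s) * exp (- (\<i> * of_real (\<sigma> * \<beta> * \<mu> k)))"
      by (simp add: exp_add [symmetric] algebra_simps)
    show "a k * ((1 - exp (\<i> * of_real (\<sigma> * \<beta>) * (s - of_real (\<mu> k)))) / (s - of_real (\<mu> k))) =
      a k / (s - of_real (\<mu> k)) - exp (\<i> * of_real (\<sigma> * \<beta>) * s) * (a k * exp (- (\<i> * of_real (\<sigma> * \<beta> * \<mu> k))) / (s - of_real (\<mu> k)))"
      unfolding e by (simp add: diff_divide_distrib algebra_simps)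
  qed
  ultimately show ?thesis by (simp add: mult.commute)
qed

text \<open>G is the antiderivative, vanishing at infinity, of exp(iyu) times the exponential sum on
  the edge, and G 0 is the edge sum. On the imaginary axis the first factor is unimodular, so the
  integral of A exp(- c u) is a bound.\<close>

lemma Laplace_edge_bound:
  assumes \<sigma>: "\<bar>\<sigma>\<bar> = 1"
  shows "norm (Laplace_edge \<sigma> (\<i> * of_real y)) \<le> A / c"
proof -
  let ?s = "\<i> * of_real y"
  define E where "E k = a k * exp (- (\<i> * of_real (\<sigma> * \<beta> * \<mu> k)))" for k
  have ne: "?s - of_real (\<mu> k) \<noteq> 0" if "k \<in> F" for k
    using \<mu>_pos[OF that] by (auto simp: complex_eq_iff)
  define G where "G u = (\<Sum>k\<in>F. E k * (exp ((?s - of_real (\<mu> k)) * of_real u) / (?s - of_real (\<mu> k))))" for u :: real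
  define G' where "G' u = exp (?s * of_real u) * (\<Sum>k\<in>F. a k * exp (- of_real (\<mu> k) * Complex u (\<sigma> * \<beta>)))" for u :: real
  have deriv: "(G has_vector_derivative G' u) (at u within X)" for u X
  proof -
    have "(G has_vector_derivative (\<Sum>k\<in>F. E k * exp ((?s - of_real (\<mu> k)) * of_real u))) (at u within X)"
      unfolding G_def [abs_def]
    proof (intro has_vector_derivative_sum)
      fix k assume k: "k \<in> F"
      have "((\<lambda>z. E k * (exp ((?s - of_real (\<mu> k)) * z) / (?s - of_real (\<mu> k)))) has_field_derivative
         E k * exp ((?s - of_real (\<mu> k)) * of_real u)) (at (of_real u))"
        using ne[OF k] by (auto intro!: derivative_eq_intros)
      from has_vector_derivative_real_field[OF this]
      show "((\<lambda>u. E k * (exp ((?s - of_real (\<mu> k)) * of_real u) / (?s - of_real (\<mu> k)))) has_vector_derivative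
         E k * exp ((?s - of_real (\<mu> k)) * of_real u)) (at u within X)" .
    qed
    also have "(\<Sum>k\<in>F. E k * exp ((?s - of_real (\<mu> k)) * of_real u)) = G' u"
      unfolding G'_def sum_distrib_left E_def
    proof (intro sum.cong refl)
      fix k
      have "exp (- (\<i> * of_real (\<sigma> * \<beta> * \<mu> k))) * exp ((?s - of_real (\<mu> k)) * of_real u) = exp (?s * of_real u) * exp (- of_real (\<mu> k) * Complex u (\<sigma> * \<beta>))"
        by (simp add: exp_add [symmetric] Complex_eq algebra_simps)
      thus "a k * exp (- (\<i> * of_real (\<sigma> * \<beta> * \<mu> k))) * exp ((?s - of_real (\<mu> k)) * of_real u) =
         exp (?s * of_real u) * (a k * exp (- of_real (\<mu> k) * Complex u (\<sigma> * \<beta>)))"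
        by (metis mult.assoc mult.left_commute)
    qed
    finally show ?thesis .
  qed
  have bound: "norm (G' u) \<le> A * exp (- c * u)" if "u > 0" for u
  proof -
    have "norm (exp (?s * of_real u)) = 1" by simp
    thus ?thesis using sum_bound[of u "\<sigma> * \<beta>"] that \<sigma> \<beta> unfolding G'_def norm_mult by (simp add: abs_mult)
  qed
  define \<phi> where "\<phi> u = - (A / c) * exp (- c * u)" for u
  have le: "norm (G U - G 0) \<le> A / c" if U: "U > 0" for U
  proof -
    have "norm (G U - G 0) \<le> \<phi> U - \<phi> 0"
    proof (rule differentiable_bound_general[of 0 U])
      show "0 < U" by fact
      show "continuous_on {0..U} G"
        using deriv by (meson has_vector_derivative_continuous continuous_on_eq_continuous_within)
      show "continuous_on {0..U} \<phi>" unfolding \<phi>_def [abs_def] by (intro continuous_intros)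
      show "(G has_vector_derivative G' x) (at x)" for x using deriv[of x UNIV] by simp
      show "(\<phi> has_vector_derivative A * exp (- c * x)) (at x)" for x
        unfolding \<phi>_def [abs_def] has_real_derivative_iff_has_vector_derivative [symmetric]
        using c by (auto intro!: derivative_eq_intros)
    qed (use bound in auto)
    also have "\<dots> \<le> A / c" using A_nonneg c by (simp add: \<phi>_def)
    finally show ?thesis .
  qed
  have "(G \<longlongrightarrow> 0) at_top"
    unfolding G_def [abs_def]
  proof (rule tendsto_null_sum)
    fix k assume k: "k \<in> F"
    have "((\<lambda>u. norm (E k) * (exp (- \<mu> k * u) / norm (?s - of_real (\<mu> k)))) \<longlongrightarrow> 0) at_top"
      using \<mu>_pos[OF k] ne[OF k] by real_asymp
    thus "((\<lambda>u. E k * (exp ((?s - of_real (\<mu> k)) * of_real u) / (?s - of_real (\<mu> k)))) \<longlongrightarrow> 0) at_top"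
      by (subst tendsto_norm_zero_iff[symmetric]) (simp add: norm_mult norm_divide)
  qed
  hence lim: "((\<lambda>U. norm (G U - G 0)) \<longlongrightarrow> norm (0 - G 0)) at_top"
    by (intro tendsto_intros)
  have "norm (0 - G 0) \<le> A / c"
    by (rule tendsto_upperbound[OF lim]) (use le in \<open>auto intro: eventually_mono[OF eventually_gt_at_top[of 0]]\<close>)
  moreover have "G 0 = Laplace_edge \<sigma> ?s" by (simp add: G_def Laplace_edge_def E_def)
  ultimately show ?thesis by simp
qed

text \<open>\<open>Laplace_sum\<close> is split into its difference from the edge term, bounded by
  \<beta> * A and hence kept on the ray, and the edge term itself. The latter has no poles between
  the ray and the imaginary axis and is rotated to that axis, where its factor exp(i \<sigma>
  \<beta> s) exactly cancels the growth exp(\<beta> |y|) allowed to K. M0 enters only the closing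
  side and is absent from the result.\<close>

lemma ray_integral_bound:
  assumes \<sigma>: "\<sigma> = 1 \<or> \<sigma> = - 1" and \<theta>: "0 < \<theta>" "\<theta> < pi / 2"
    and hol: "K holomorphic_on {s. Re s \<ge> 0}" and M: "M \<ge> 0"
    and crude: "\<And>s. Re s \<ge> 0 \<Longrightarrow> norm (K s) \<le> M0 * exp (\<beta> * \<bar>Im s\<bar>) / (1 + norm s)\<^sup>2"
    and imag: "\<And>y. norm (K (\<i> * of_real y)) \<le> M * exp (\<beta> * \<bar>y\<bar>) / (1 + \<bar>y\<bar>)\<^sup>2"
    and ray: "\<And>r. r \<ge> 0 \<Longrightarrow> norm (K (of_real r * cis (\<sigma> * \<theta>))) \<le> M / (1 + r)\<^sup>2"
    and \<epsilon>: "\<epsilon> > 0"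
  shows "\<exists>R0. \<forall>R\<ge>R0. norm (contour_integral (linepath 0 (of_real R * cis (\<sigma> * \<theta>))) (\<lambda>s. K s * Laplace_sum s))
    \<le> M * A * (\<beta> + 1 / c) + \<epsilon>"
proof -
  have trig: "0 < sin \<theta>" "0 < cos \<theta>" "cos \<theta> \<le> 1"
    using \<theta> sin_gt_zero[of \<theta>] cos_gt_zero[of \<theta>] by auto
  have \<sigma>': "\<bar>\<sigma>\<bar> = 1" "\<sigma> * \<sigma> = 1" using \<sigma> by auto
  have sinc: "sin (\<sigma> * \<theta>) = \<sigma> * sin \<theta>" "cos (\<sigma> * \<theta>) = cos \<theta>" using \<sigma> by auto
  \<comment> \<open>The wedge between the ray and the imaginary half-axis on the same side: it is
    convex, and free of poles because \<theta> > 0.\<close>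
  define W where "W = {s. Re s \<ge> 0 \<and> \<sigma> * Im s * cos \<theta> \<ge> Re s * sin \<theta>}"
  define E where "E s = exp (\<i> * of_real (\<sigma> * \<beta>) * s)" for s
  define f1 where "f1 s = K s * (Laplace_sum s - E s * Laplace_edge \<sigma> s)" for s
  define f2 where "f2 s = K s * (E s * Laplace_edge \<sigma> s)" for s
  define Sa where "Sa = (\<Sum>k\<in>F. norm (a k))"
  have Sa: "Sa \<ge> 0" by (simp add: Sa_def sum_nonneg)
  have "M0 \<ge> 0"
    using crude[of 0] by (simp add: order_trans[OF norm_ge_zero])
  have convW: "convex W"
  proof (rule convexI)
    fix x y :: complex and u v :: real assume xy: "x \<in> W" "y \<in> W" "0 \<le> u" "0 \<le> v" "u + v = 1"
    have "u * (Re x * sin \<theta>) + v * (Re y * sin \<theta>) \<le> u * (\<sigma> * Im x * cos \<theta>) + v * (\<sigma> * Im y * cos \<theta>)"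
      using xy by (intro add_mono mult_left_mono) (auto simp: W_def)
    thus "u *\<^sub>R x + v *\<^sub>R y \<in> W" using xy by (auto simp: W_def algebra_simps)
  qed
  have WD: "Re s \<ge> 0" "\<sigma> * Im s \<ge> 0" "k \<in> F \<Longrightarrow> s \<noteq> of_real (\<mu> k)" if "s \<in> W" for s k
  proof -
    show "Re s \<ge> 0" using that by (simp add: W_def)
    have "0 \<le> Re s * sin \<theta>" using that trig by (auto simp: W_def)
    hence "0 \<le> (\<sigma> * Im s) * cos \<theta>" using that by (auto simp: W_def)
    thus "\<sigma> * Im s \<ge> 0" using trig by (simp add: zero_le_mult_iff)
    show "s \<noteq> of_real (\<mu> k)" if "k \<in> F"
      using \<open>s \<in> W\<close> \<mu>_pos[OF that] trig by (auto simp: W_def mult_le_0_iff)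
  qed
  have holK: "K holomorphic_on W" using hol by (rule holomorphic_on_subset) (auto simp: W_def)
  have holL: "Laplace_sum holomorphic_on W" "Laplace_edge \<sigma> holomorphic_on W"
    unfolding Laplace_sum_def [abs_def] Laplace_edge_def [abs_def]
    by (intro holomorphic_intros; use WD(3) in auto)+
  have hol12: "f1 holomorphic_on W" "f2 holomorphic_on W"
    unfolding f1_def [abs_def] f2_def [abs_def] E_def
    by (intro holomorphic_intros holK holL)+
  have normE: "norm (E s) = exp (- (\<beta> * \<bar>Im s\<bar>))" if "\<sigma> * Im s \<ge> 0" for s
  proof -
    have "\<sigma> * Im s = \<bar>Im s\<bar>" using that \<sigma> by auto
    hence "\<beta> * (\<sigma> * Im s) = \<beta> * \<bar>Im s\<bar>" by simp
    thus ?thesis by (simp add: E_def mult_ac)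
  qed
  \<comment> \<open>On the closing side K times the exponential is at most M0 / (R sin \<theta>)^2,
    the edge sum at most Sa / (R sin \<theta>), and the length is R cos \<theta>; for R \<ge> 1 the
    product is at most D / R.\<close>
  define D where "D = M0 * Sa / (sin \<theta>)^3"
  have D: "D \<ge> 0" using \<open>M0 \<ge> 0\<close> Sa trig by (simp add: D_def)
  show ?thesis
  proof (intro exI[of _ "max 1 (D / \<epsilon>)"] allI impI)
    fix R :: real assume R: "R \<ge> max 1 (D / \<epsilon>)"
    hence R1: "R \<ge> 1" "R > 0" "D / \<epsilon> \<le> R" by auto
    define P where "P = of_real R * cis (\<sigma> * \<theta>)"
    \<comment> \<open>Y has the same imaginary part as P, so the closing side is horizontal and |Im
      s| = R sin \<theta> all along it.\<close>
    define Y where "Y = \<i> * of_real (\<sigma> * (R * sin \<theta>))"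
    have ReP: "Re P = R * cos \<theta>" "Im P = \<sigma> * (R * sin \<theta>)" by (simp_all add: P_def sinc)
    have inW: "0 \<in> W" "P \<in> W" "Y \<in> W"
      using R1 trig \<sigma>' by (auto simp: W_def ReP Y_def mult.assoc[symmetric])
    have segW: "closed_segment x y \<subseteq> W" if "x \<in> W" "y \<in> W" for x y
      using convW that by (simp add: closed_segment_subset)
    have int: "f contour_integrable_on linepath x y" if "f holomorphic_on W" "x \<in> W" "y \<in> W" for f x y
      using that segW by (intro contour_integrable_continuous_linepath holomorphic_on_imp_continuous_on) (blast intro: holomorphic_on_subset)
    have I1: "norm (contour_integral (linepath 0 P) f1) \<le> M * (\<beta> * A)"
    proof (rule contour_integral_ray_le)
      show "continuous_on (closed_segment 0 P) f1"
        using hol12 segW inW by (meson holomorphic_on_imp_continuous_on holomorphic_on_subset)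
      show "M * (\<beta> * A) \<ge> 0" using M \<beta> A_nonneg by simp
      fix s assume s: "s \<in> closed_segment 0 P"
      hence sW: "s \<in> W" using segW inW by blast
      obtain t where t: "0 \<le> t" "t \<le> 1" "s = t *\<^sub>R P" using s by (auto simp: closed_segment_def)
      have s': "s = of_real (t * R) * cis (\<sigma> * \<theta>)" using t by (simp add: P_def scaleR_conv_of_real)
      have tR: "t * R \<ge> 0" using t R1 by simp
      have ns: "norm s = t * R" unfolding s' norm_mult norm_of_real norm_cis using tR by simp
      have "norm (K s) \<le> M / (1 + norm s)\<^sup>2" using ray[OF tR] unfolding s'[symmetric] ns .
      moreover have "norm (Laplace_sum s - E s * Laplace_edge \<sigma> s) \<le> \<beta> * A"
        unfolding E_def using WD(2,3)[OF sW] by (intro Laplace_segment_bound \<sigma>') auto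
      ultimately have "norm (f1 s) \<le> M / (1 + norm s)\<^sup>2 * (\<beta> * A)"
        unfolding f1_def norm_mult using M by (intro mult_mono) auto
      thus "norm (f1 s) \<le> M * (\<beta> * A) / (1 + norm s)\<^sup>2" by simp
    qed
    have I2: "norm (contour_integral (linepath 0 Y) f2) \<le> M * (A / c)"
    proof (rule contour_integral_ray_le)
      show "continuous_on (closed_segment 0 Y) f2"
        using hol12 segW inW by (meson holomorphic_on_imp_continuous_on holomorphic_on_subset)
      show "M * (A / c) \<ge> 0" using M c A_nonneg by simp
      fix s assume s: "s \<in> closed_segment 0 Y"
      hence sW: "s \<in> W" using segW inW by blast
      obtain t where t: "0 \<le> t" "t \<le> 1" "s = t *\<^sub>R Y" using s by (auto simp: closed_segment_def)
      define y where "y = t * (\<sigma> * (R * sin \<theta>))"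
      have s': "s = \<i> * of_real y" using t by (simp add: Y_def scaleR_conv_of_real y_def)
      have ns: "norm s = \<bar>y\<bar>" "Im s = y" by (simp_all add: s' norm_mult)
      have "norm (f2 s) = norm (K s) * (exp (- (\<beta> * \<bar>y\<bar>)) * norm (Laplace_edge \<sigma> s))"
        unfolding f2_def norm_mult normE[OF WD(2)[OF sW]] ns by simp
      also have "\<dots> \<le> (M * exp (\<beta> * \<bar>y\<bar>) / (1 + \<bar>y\<bar>)\<^sup>2) * (exp (- (\<beta> * \<bar>y\<bar>)) * (A / c))"
        unfolding s' using M by (intro mult_mono imag Laplace_edge_bound \<sigma>') auto
      also have "\<dots> = M * (A / c) / (1 + norm s)\<^sup>2 * (exp (\<beta> * \<bar>y\<bar>) * exp (- (\<beta> * \<bar>y\<bar>)))"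
        unfolding ns by (simp only: divide_inverse mult_ac)
      also have "exp (\<beta> * \<bar>y\<bar>) * exp (- (\<beta> * \<bar>y\<bar>)) = 1" by (simp flip: exp_add)
      finally show "norm (f2 s) \<le> M * (A / c) / (1 + norm s)\<^sup>2" by simp
    qed
    have I3: "norm (contour_integral (linepath P Y) f2) \<le> \<epsilon>"
    proof -
      have Rs: "R * sin \<theta> > 0" using R1 trig by simp
      have "norm (contour_integral (linepath P Y) f2) \<le> (M0 / (R * sin \<theta>)\<^sup>2 * (Sa / (R * sin \<theta>))) * norm (Y - P)"
      proof (rule contour_integral_bound_linepath[OF int[OF hol12(2) inW(2,3)]])
        show "0 \<le> M0 / (R * sin \<theta>)\<^sup>2 * (Sa / (R * sin \<theta>))" using \<open>M0 \<ge> 0\<close> Sa Rs by simp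
        fix s assume s: "s \<in> closed_segment P Y"
        hence sW: "s \<in> W" using segW inW by blast
        have Ims: "Im s = \<sigma> * (R * sin \<theta>)"
        proof -
          obtain t where t: "s = (1 - t) *\<^sub>R P + t *\<^sub>R Y" using s by (auto simp: closed_segment_def)
          show ?thesis unfolding t by (simp add: ReP Y_def algebra_simps)
        qed
        have absIm: "\<bar>Im s\<bar> = R * sin \<theta>" unfolding Ims abs_mult[of \<sigma>] \<sigma>'(1) abs_of_pos[OF Rs] by simp
        have ns: "norm s \<ge> R * sin \<theta>" using abs_Im_le_cmod[of s] absIm by simp
        have L: "norm (Laplace_edge \<sigma> s) \<le> Sa / (R * sin \<theta>)"
        proof -
          have "norm (Laplace_edge \<sigma> s) \<le> (\<Sum>k\<in>F. norm (a k) / (R * sin \<theta>))"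
            unfolding Laplace_edge_def
          proof (intro sum_norm_le)
            fix k assume "k \<in> F"
            have "norm (s - of_real (\<mu> k)) \<ge> R * sin \<theta>" using abs_Im_le_cmod[of "s - of_real (\<mu> k)"] absIm by simp
            thus "norm (a k * exp (- (\<i> * of_real (\<sigma> * \<beta> * \<mu> k))) / (s - of_real (\<mu> k))) \<le> norm (a k) / (R * sin \<theta>)"
              using Rs by (simp add: norm_divide norm_mult frac_le)
          qed
          thus ?thesis by (simp add: Sa_def sum_divide_distrib)
        qed
        have "norm (K s) * norm (E s) \<le> M0 * exp (\<beta> * \<bar>Im s\<bar>) / (1 + norm s)\<^sup>2 * exp (- (\<beta> * \<bar>Im s\<bar>))"
          unfolding normE[OF WD(2)[OF sW]] by (intro mult_right_mono crude WD(1)[OF sW]) auto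
        also have "\<dots> = M0 / (1 + norm s)\<^sup>2 * (exp (\<beta> * \<bar>Im s\<bar>) * exp (- (\<beta> * \<bar>Im s\<bar>)))" by simp
        also have "exp (\<beta> * \<bar>Im s\<bar>) * exp (- (\<beta> * \<bar>Im s\<bar>)) = 1" by (simp flip: exp_add)
        also have "M0 / (1 + norm s)\<^sup>2 * 1 \<le> M0 / (R * sin \<theta>)\<^sup>2"
        proof -
          have "(R * sin \<theta>)\<^sup>2 \<le> (1 + norm s)\<^sup>2" using ns Rs by (intro power_mono) auto
          moreover have "(R * sin \<theta>)\<^sup>2 > 0" using Rs by (rule zero_less_power)
          ultimately show ?thesis using \<open>M0 \<ge> 0\<close> by (simp only: frac_le order_refl mult_1_right)
        qed
        finally have KE: "norm (K s) * norm (E s) \<le> M0 / (R * sin \<theta>)\<^sup>2" .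
        have "(norm (K s) * norm (E s)) * norm (Laplace_edge \<sigma> s) \<le> M0 / (R * sin \<theta>)\<^sup>2 * (Sa / (R * sin \<theta>))"
          using \<open>M0 \<ge> 0\<close> by (intro mult_mono KE L) auto
        thus "norm (f2 s) \<le> M0 / (R * sin \<theta>)\<^sup>2 * (Sa / (R * sin \<theta>))" unfolding f2_def norm_mult by (simp only: mult.assoc)
      qed
      also have "norm (Y - P) = R * cos \<theta>"
      proof -
        have "Y - P = of_real (- (R * cos \<theta>))" by (simp add: complex_eq_iff ReP) (simp add: Y_def)
        thus ?thesis using R1 trig by (simp only: norm_of_real) simp
      qed
      also have "M0 / (R * sin \<theta>)\<^sup>2 * (Sa / (R * sin \<theta>)) * (R * cos \<theta>) = D * cos \<theta> / R\<^sup>2"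
        using R1 trig by (simp add: D_def field_simps power2_eq_square power3_eq_cube)
      also have "\<dots> \<le> D * 1 / (R * 1)" using D trig R1
        by (intro frac_le mult_left_mono) (auto simp: power2_eq_square)
      also have "\<dots> \<le> \<epsilon>" using R1 \<epsilon> by (simp add: field_simps)
      finally show ?thesis .
    qed
    have closed: "contour_integral (linepath 0 P) f2 + (contour_integral (linepath P Y) f2 + contour_integral (linepath Y 0) f2) = 0"
    proof -
      have "(f2 has_contour_integral 0) (linepath 0 P +++ linepath P Y +++ linepath Y 0)"
        by (rule Cauchy_theorem_triangle, rule holomorphic_on_subset[OF hol12(2)])
           (intro hull_minimal convW; use inW in auto)
      hence "contour_integral (linepath 0 P +++ linepath P Y +++ linepath Y 0) f2 = 0"
        by (rule contour_integral_unique)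
      thus ?thesis using int[OF hol12(2)] inW by simp
    qed
    have rev: "contour_integral (linepath Y 0) f2 = - contour_integral (linepath 0 Y) f2"
      using contour_integral_reversepath[of "linepath 0 Y" f2] by simp
    have "contour_integral (linepath 0 P) (\<lambda>s. K s * Laplace_sum s) = contour_integral (linepath 0 P) (\<lambda>s. f1 s + f2 s)"
      by (simp add: f1_def f2_def algebra_simps)
    also have "\<dots> = contour_integral (linepath 0 P) f1 + contour_integral (linepath 0 P) f2"
      using inW by (intro contour_integral_add int hol12)
    also have "\<dots> = contour_integral (linepath 0 P) f1 + (contour_integral (linepath 0 Y) f2 - contour_integral (linepath P Y) f2)"
      using closed rev by (simp add: algebra_simps eq_neg_iff_add_eq_0)
    also have "norm \<dots> \<le> M * (\<beta> * A) + (M * (A / c) + \<epsilon>)"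
      by (intro norm_triangle_mono I1 order_trans[OF norm_triangle_ineq4] add_mono I2 I3)
    finally show "norm (contour_integral (linepath 0 (of_real R * cis (\<sigma> * \<theta>))) (\<lambda>s. K s * Laplace_sum s)) \<le> M * A * (\<beta> + 1 / c) + \<epsilon>"
      unfolding P_def by (simp add: algebra_simps)
  qed
qed

text \<open>K times \<open>Laplace_sum\<close> is integrated around a triangle with two sides on the
  rays. K kills every residue but the one at \<mu> n, which is a n. The sides on the rays are
  handled by \<open>ray_integral_bound\<close>; the vertical side vanishes in the limit by the decay
  of K between the rays.\<close>

lemma coefficient_bound:
  assumes n: "n \<in> F" and Kn: "K (of_real (\<mu> n)) = 1" and K0: "\<And>k. k \<in> F \<Longrightarrow> k \<noteq> n \<Longrightarrow> K (of_real (\<mu> k)) = 0"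
    and \<theta>: "0 < \<theta>" "\<theta> < pi / 2"
    and hol: "K holomorphic_on {s. Re s \<ge> 0}" and M: "M \<ge> 0"
    and crude: "\<And>s. Re s \<ge> 0 \<Longrightarrow> norm (K s) \<le> M0 * exp (\<beta> * \<bar>Im s\<bar>) / (1 + norm s)\<^sup>2"
    and crude': "\<And>s. Re s \<ge> 0 \<Longrightarrow> \<bar>Im s\<bar> \<le> Re s * tan \<theta> \<Longrightarrow> norm (K s) \<le> M0 / (1 + norm s)\<^sup>2"
    and imag: "\<And>y. norm (K (\<i> * of_real y)) \<le> M * exp (\<beta> * \<bar>y\<bar>) / (1 + \<bar>y\<bar>)\<^sup>2"
    and ray: "\<And>r. r \<ge> 0 \<Longrightarrow> norm (K (of_real r * cis \<theta>)) \<le> M / (1 + r)\<^sup>2"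
      "\<And>r. r \<ge> 0 \<Longrightarrow> norm (K (of_real r * cis (- \<theta>))) \<le> M / (1 + r)\<^sup>2"
  shows "norm (a n) \<le> M * A * (\<beta> + 1 / c)"
proof -
  have trig: "0 < sin \<theta>" "0 < cos \<theta>" "cos \<theta> \<le> 1" "sin \<theta> \<le> 1"
    using \<theta> sin_gt_zero[of \<theta>] cos_gt_zero[of \<theta>] by auto
  define f where "f s = K s * Laplace_sum s" for s
  define B where "B = M * A * (\<beta> + 1 / c)"
  have M0: "M0 \<ge> 0"
    using crude[of 0] by (simp add: order_trans[OF norm_ge_zero])
  define Sa where "Sa = (\<Sum>k\<in>F. norm (a k))"
  have Sa: "Sa \<ge> 0" by (simp add: Sa_def sum_nonneg)
  define m where "m = Max (\<mu> ` F)"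
  have m: "\<mu> k \<le> m" if "k \<in> F" for k using that finite_F by (auto simp: m_def)
  have m0: "m > 0" using m[OF n] \<mu>_pos[OF n] by linarith
  have main: "2 * pi * norm (a n) \<le> 2 * B + 3 * \<epsilon>" if \<epsilon>: "\<epsilon> > 0" for \<epsilon>
  proof -
    obtain R1 where R1: "\<And>R. R \<ge> R1 \<Longrightarrow> norm (contour_integral (linepath 0 (of_real R * cis \<theta>)) f) \<le> B + \<epsilon>"
      using ray_integral_bound[of 1 \<theta> K M M0 \<epsilon>] \<theta> hol M crude imag ray \<epsilon> unfolding f_def B_def by auto
    obtain R2 where R2: "\<And>R. R \<ge> R2 \<Longrightarrow> norm (contour_integral (linepath 0 (of_real R * cis (- \<theta>))) f) \<le> B + \<epsilon>"
      using ray_integral_bound[of "-1" \<theta> K M M0 \<epsilon>] \<theta> hol M crude imag ray \<epsilon> unfolding f_def B_def by auto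
    \<comment> \<open>Apart from the two thresholds for the rays: R cos \<theta> \<ge> m + 1 places
      the vertical side at distance at least 1 to the right of all poles, and the last entry makes
      its integral at most \<epsilon>.\<close>
    define R where "R = max (max R1 R2) (max ((m + 1) / cos \<theta>) (M0 * Sa * 2 / (cos \<theta>)\<^sup>2 / \<epsilon>))"
    have Rge: "R \<ge> R1" "R \<ge> R2" "R \<ge> (m + 1) / cos \<theta>" "R \<ge> M0 * Sa * 2 / (cos \<theta>)\<^sup>2 / \<epsilon>"
      by (auto simp: R_def)
    have Rc: "R * cos \<theta> \<ge> m + 1" using Rge(3) trig by (simp add: pos_divide_le_eq)
    have R0: "R > 0"
    proof -
      have "R * cos \<theta> > 0" using Rc m0 by linarith
      thus ?thesis using trig by (simp add: zero_less_mult_iff)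
    qed
    define P where "P = of_real R * cis \<theta>"
    define Q where "Q = of_real R * cis (- \<theta>)"
    have PQ: "Re P = R * cos \<theta>" "Im P = R * sin \<theta>" "Re Q = R * cos \<theta>" "Im Q = - (R * sin \<theta>)"
      by (simp_all add: P_def Q_def)
    define H where "H = {s. Re s \<ge> (0::real)}"
    have convH: "convex H" unfolding H_def by (rule convex_halfspace_Re_ge)
    have PQH: "0 \<in> H" "P \<in> H" "Q \<in> H" using R0 trig by (auto simp: H_def PQ)
    have segH: "closed_segment x y \<subseteq> H" if "x \<in> H" "y \<in> H" for x y
      using convH that by (simp add: closed_segment_subset)
    have avoid: "of_real (\<mu> k) \<notin> closed_segment 0 Q" "of_real (\<mu> k) \<notin> closed_segment Q P" "of_real (\<mu> k) \<notin> closed_segment P 0"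
      if k: "k \<in> F" for k
    proof -
      show "of_real (\<mu> k) \<notin> closed_segment 0 Q"
        using \<mu>_pos[OF k] R0 trig by (auto simp: closed_segment_def complex_eq_iff PQ)
      show "of_real (\<mu> k) \<notin> closed_segment P 0"
        using \<mu>_pos[OF k] R0 trig by (auto simp: closed_segment_def complex_eq_iff PQ)
      show "of_real (\<mu> k) \<notin> closed_segment Q P"
      proof
        assume "of_real (\<mu> k) \<in> closed_segment Q P"
        then obtain t where "of_real (\<mu> k) = (1 - t) *\<^sub>R Q + t *\<^sub>R P" by (auto simp: closed_segment_def)
        hence "\<mu> k = Re ((1 - t) *\<^sub>R Q + t *\<^sub>R P)" by (metis Re_complex_of_real)
        hence "\<mu> k = R * cos \<theta>" by (simp add: PQ algebra_simps)
        thus False using Rc m[OF k] by simp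
      qed
    qed
    \<comment> \<open>Q lies below the real axis and P above, so this order runs
      counterclockwise.\<close>
    define g where "g = linepath 0 Q +++ linepath Q P +++ linepath P 0"
    have hull: "of_real (\<mu> n) \<in> interior (convex hull {0, Q, P})"
    proof -
      have len: "R * cos \<theta> > \<mu> n" "\<mu> n > 0" using Rc m[OF n] \<mu>_pos[OF n] by linarith+
      \<comment> \<open>By symmetry P and Q have the same barycentric weight v, and comparing real
        parts gives \<mu> n = 2 v R cos \<theta>.\<close>
      define v where "v = \<mu> n / (2 * (R * cos \<theta>))"
      have v: "0 < v" "v < 1 / 2" using len by (auto simp: v_def field_simps)
      have "of_real (\<mu> n) = (1 - 2 * v) *\<^sub>R 0 + v *\<^sub>R Q + v *\<^sub>R P"
        using len R0 trig by (simp add: complex_eq_iff PQ v_def field_simps)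
      hence "of_real (\<mu> n) \<in> convex hull {0, Q, P}"
        unfolding convex_hull_3 using v by (intro CollectI exI[of _ "1 - 2 * v"] exI[of _ v] conjI) auto
      thus ?thesis using avoid[OF n] by (simp add: interior_of_triangle)
    qed
    have wn: "winding_number g (of_real (\<mu> n)) = 1"
    proof -
      have "Im ((Q - 0) * cnj (Q - of_real (\<mu> n))) = \<mu> n * (R * sin \<theta>)"
        by (simp add: PQ algebra_simps)
      moreover have "\<mu> n * (R * sin \<theta>) > 0" using \<mu>_pos[OF n] R0 trig by simp
      ultimately show ?thesis unfolding g_def winding_number_triangle[OF hull] by simp
    qed
    have pg: "path_image g \<subseteq> H" "valid_path g" "pathfinish g = pathstart g"
      using segH PQH by (auto simp: g_def path_image_join)
    have hc: "((\<lambda>s. K s / (s - of_real (\<mu> k))) has_contour_integral (2 * pi * \<i> * winding_number g (of_real (\<mu> k)) * K (of_real (\<mu> k)))) g"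
      if k: "k \<in> F" for k
    proof (rule Cauchy_integral_formula_convex_simple[OF convH])
      show "K holomorphic_on H" using hol unfolding H_def .
      have "of_real (\<mu> k) \<in> {s. Re s > 0}" using \<mu>_pos[OF k] by simp
      moreover have "{s. Re s > 0} \<subseteq> interior H"
        by (intro interior_maximal open_halfspace_Re_gt) (auto simp: H_def)
      ultimately show "of_real (\<mu> k) \<in> interior H" by blast
      show "path_image g \<subseteq> H - {of_real (\<mu> k)}"
        using pg(1) avoid[OF k] by (auto simp: g_def path_image_join)
    qed (use pg in auto)
    have "(f has_contour_integral (\<Sum>k\<in>F. a k * (2 * pi * \<i> * winding_number g (of_real (\<mu> k)) * K (of_real (\<mu> k))))) g"
    proof -
      have "((\<lambda>s. \<Sum>k\<in>F. a k * (K s / (s - of_real (\<mu> k)))) has_contour_integral (\<Sum>k\<in>F. a k * (2 * pi * \<i> * winding_number g (of_real (\<mu> k)) * K (of_real (\<mu> k))))) g"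
        by (intro has_contour_integral_sum has_contour_integral_lmul hc finite_F)
      moreover have "(\<lambda>s. \<Sum>k\<in>F. a k * (K s / (s - of_real (\<mu> k)))) = f"
        by (auto simp: f_def Laplace_sum_def sum_distrib_left fun_eq_iff mult_ac)
      ultimately show ?thesis by simp
    qed
    moreover have "(\<Sum>k\<in>F. a k * (2 * pi * \<i> * winding_number g (of_real (\<mu> k)) * K (of_real (\<mu> k)))) = (\<Sum>k\<in>F. if k = n then a n * (2 * pi * \<i>) else 0)"
      by (intro sum.cong) (auto simp: K0 Kn wn)
    ultimately have "(f has_contour_integral (a n * (2 * pi * \<i>))) g" using n finite_F by simp
    hence gi: "contour_integral g f = a n * (2 * pi * \<i>)" by (rule contour_integral_unique)
    have contf: "continuous_on (closed_segment x y) f" if "closed_segment x y \<subseteq> H" "\<And>k. k \<in> F \<Longrightarrow> of_real (\<mu> k) \<notin> closed_segment x y" for x y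
    proof -
      have "continuous_on (closed_segment x y) K"
        using hol that(1) unfolding H_def by (meson holomorphic_on_imp_continuous_on holomorphic_on_subset)
      thus ?thesis unfolding f_def [abs_def] Laplace_sum_def
        using that(2) by (intro continuous_intros) auto
    qed
    have int: "f contour_integrable_on linepath 0 Q" "f contour_integrable_on linepath Q P" "f contour_integrable_on linepath P 0"
      by (intro contour_integrable_continuous_linepath contf segH PQH avoid; assumption)+
    have split: "contour_integral g f = contour_integral (linepath 0 Q) f + (contour_integral (linepath Q P) f + contour_integral (linepath P 0) f)"
      unfolding g_def using int by simp
    have rev: "contour_integral (linepath P 0) f = - contour_integral (linepath 0 P) f"
      using contour_integral_reversepath[of "linepath 0 P" f] by simp
    have side: "norm (contour_integral (linepath Q P) f) \<le> \<epsilon>"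
    proof -
      have "norm (contour_integral (linepath Q P) f) \<le> (M0 / (R * cos \<theta>)\<^sup>2 * Sa) * norm (P - Q)"
      proof (rule contour_integral_bound_linepath[OF int(2)])
        show "0 \<le> M0 / (R * cos \<theta>)\<^sup>2 * Sa" using M0 Sa by simp
        fix s assume "s \<in> closed_segment Q P"
        then obtain t where t: "0 \<le> t" "t \<le> 1" "s = (1 - t) *\<^sub>R Q + t *\<^sub>R P" by (auto simp: closed_segment_def)
        have Res: "Re s = R * cos \<theta>" unfolding t by (simp add: PQ algebra_simps)
        have Ims: "\<bar>Im s\<bar> \<le> R * sin \<theta>"
        proof -
          have "Im s = (2 * t - 1) * (R * sin \<theta>)" unfolding t by (simp add: PQ algebra_simps)
          hence "\<bar>Im s\<bar> = \<bar>2 * t - 1\<bar> * (R * sin \<theta>)" using R0 trig by (simp add: abs_mult)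
          also have "\<dots> \<le> 1 * (R * sin \<theta>)" using t R0 trig by (intro mult_right_mono) auto
          finally show ?thesis by simp
        qed
        have "norm (K s) \<le> M0 / (1 + norm s)\<^sup>2"
          using Res Ims R0 trig by (intro crude') (auto simp: tan_def)
        also have "\<dots> \<le> M0 / (R * cos \<theta>)\<^sup>2"
        proof -
          have "R * cos \<theta> \<le> 1 + norm s" using complex_Re_le_cmod[of s] Res by simp
          hence "(R * cos \<theta>)\<^sup>2 \<le> (1 + norm s)\<^sup>2" using R0 trig by (intro power_mono) auto
          thus ?thesis using M0 R0 trig by (intro frac_le) auto
        qed
        finally have Kb: "norm (K s) \<le> M0 / (R * cos \<theta>)\<^sup>2" .
        have "norm (Laplace_sum s) \<le> Sa"
          unfolding Laplace_sum_def Sa_def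
        proof (intro sum_norm_le)
          fix k assume k: "k \<in> F"
          have "1 \<le> norm (s - of_real (\<mu> k))"
            using complex_Re_le_cmod[of "s - of_real (\<mu> k)"] Res Rc m[OF k] by simp
          hence "norm (a k) / norm (s - of_real (\<mu> k)) \<le> norm (a k) / 1" by (intro frac_le) auto
          thus "norm (a k / (s - of_real (\<mu> k))) \<le> norm (a k)" by (simp add: norm_divide)
        qed
        thus "norm (f s) \<le> M0 / (R * cos \<theta>)\<^sup>2 * Sa"
          unfolding f_def norm_mult using Kb M0 by (intro mult_mono) auto
      qed
      also have "\<dots> \<le> (M0 / (R * cos \<theta>)\<^sup>2 * Sa) * (2 * R)"
      proof (rule mult_left_mono)
        have "norm (P - Q) \<le> norm P + norm Q" by (rule norm_triangle_ineq4)
        thus "norm (P - Q) \<le> 2 * R" using R0 by (simp add: P_def Q_def norm_mult)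
        show "0 \<le> M0 / (R * cos \<theta>)\<^sup>2 * Sa" using M0 Sa by simp
      qed
      also have "M0 / (R * cos \<theta>)\<^sup>2 * Sa * (2 * R) = (M0 * Sa * 2 / (cos \<theta>)\<^sup>2) / R"
        using R0 trig by (simp add: power2_eq_square field_simps)
      also have "\<dots> \<le> \<epsilon>"
      proof -
        have "X / R \<le> \<epsilon>" if "X / \<epsilon> \<le> R" for X
          using that \<epsilon> R0 by (simp add: pos_divide_le_eq mult.commute)
        thus ?thesis using Rge(4) .
      qed
      finally show ?thesis .
    qed
    have "2 * pi * norm (a n) = norm (contour_integral g f)"
      unfolding gi by (simp add: norm_mult)
    also have "\<dots> \<le> norm (contour_integral (linepath 0 Q) f) + (norm (contour_integral (linepath Q P) f) + norm (contour_integral (linepath 0 P) f))"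
      unfolding split rev diff_conv_add_uminus[symmetric]
      by (rule order_trans[OF norm_triangle_ineq add_left_mono[OF norm_triangle_ineq4]])
    also have "\<dots> \<le> (B + \<epsilon>) + (\<epsilon> + (B + \<epsilon>))"
      using R1[OF Rge(1)] R2[OF Rge(2)] side unfolding P_def[symmetric] Q_def[symmetric] by linarith
    finally show ?thesis by simp
  qed
  have "2 * pi * norm (a n) \<le> 2 * B"
  proof (rule field_le_epsilon)
    fix e :: real assume "e > 0"
    thus "2 * pi * norm (a n) \<le> 2 * B + e" using main[of "e / 3"] by simp
  qed
  hence "pi * norm (a n) \<le> B" by simp
  moreover have "1 * norm (a n) \<le> pi * norm (a n)" using pi_gt3 by (intro mult_right_mono) auto
  ultimately show ?thesis unfolding B_def by simp
qed

end

text \<open>The rate \<eta> is shared out in three equal parts h: the lower bound for the dual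
  function at \<mu> n, the normalisation of the damping factor, and the square of 1 + \<mu> n each
  cost a multiple of exp(h * \<mu> n). The angle \<theta> is then chosen so that all losses on the
  rays fit into h.\<close>

lemma exponential_sum_coefficient_estimate:
  fixes S :: "real set" and \<mu> :: "nat \<Rightarrow> real" and d c \<eta> :: real and e :: nat
  assumes d: "d > 0" and S: "S \<subseteq> {0<..}"
    and sep: "\<And>a b. a \<in> S \<Longrightarrow> b \<in> S \<Longrightarrow> a < b \<Longrightarrow> b - a \<ge> d"
    and conv: "convergent (\<lambda>J. \<Sum>j=1..J. (real (card (S \<inter> {real j - 1 <.. real j})) - real e) / real j)"
    and \<mu>: "\<And>n. \<mu> n \<in> S" "inj \<mu>" and c: "c > 0" and \<eta>: "\<eta> > 0"
  shows "\<exists>C\<ge>0. \<forall>F a A n. finite F \<longrightarrow> n \<in> F \<longrightarrow>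
     (\<forall>u v. u \<ge> 0 \<longrightarrow> \<bar>v\<bar> \<le> pi * real e \<longrightarrow>
        norm (\<Sum>k\<in>F. a k * exp (- of_real (\<mu> k) * Complex u v)) \<le> A * exp (- c * u)) \<longrightarrow>
     norm (a n) \<le> C * exp (\<eta> * \<mu> n) * A"
proof -
  define h where "h = \<eta> / 3"
  have h: "h > 0" using \<eta> by (simp add: h_def)
  define L where "L = 2 * pi * (1 / d + real e)"
  have L: "L > 0" using d by (auto simp: L_def intro!: mult_pos_pos add_pos_nonneg)
  \<comment> \<open>The slope of the rays. It is so small that moving from the ray to the axis costs
    at most exp(h m / 2), and \<tau> \<le> 1 ensures cos \<theta> \<ge> 1/2.\<close>
  define \<tau> where "\<tau> = min 1 (h / (2 * L))"
  have \<tau>: "0 < \<tau>" "\<tau> \<le> 1" "L * \<tau> \<le> h / 2"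
  proof -
    show "0 < \<tau>" "\<tau> \<le> 1" using h L by (auto simp: \<tau>_def)
    have "L * \<tau> \<le> L * (h / (2 * L))" using L by (intro mult_left_mono) (auto simp: \<tau>_def)
    thus "L * \<tau> \<le> h / 2" using L by simp
  qed
  define \<theta> where "\<theta> = arctan \<tau>"
  have \<theta>: "0 < \<theta>" "\<theta> < pi / 2" using \<tau> arctan_ubound[of \<tau>] by (auto simp: \<theta>_def)
  have tan: "tan \<theta> = \<tau>" by (simp add: \<theta>_def tan_arctan)
  have cos: "cos \<theta> \<ge> 1 / 2"
  proof -
    have "\<tau>\<^sup>2 \<le> 1" using \<tau> by (simp add: power_le_one)
    hence "sqrt (1 + \<tau>\<^sup>2) \<le> sqrt (2\<^sup>2)" by (intro real_sqrt_le_mono) simp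
    hence "sqrt (1 + \<tau>\<^sup>2) \<le> 2" by simp
    moreover have "sqrt (1 + \<tau>\<^sup>2) > 0" by (auto intro: add_pos_nonneg)
    ultimately show ?thesis by (simp add: \<theta>_def cos_arctan frac_le)
  qed
  have sin: "sin \<theta> = \<tau> * cos \<theta>" using tan cos by (auto simp: tan_def field_simps)
  define \<beta> where "\<beta> = pi * real e"
  have \<beta>: "\<beta> \<ge> 0" by (simp add: \<beta>_def)
  have \<beta>\<tau>: "\<beta> * \<tau> \<le> h / 2"
  proof -
    have "\<beta> \<le> L" using d by (simp add: \<beta>_def L_def algebra_simps)
    hence "\<beta> * \<tau> \<le> L * \<tau>" using \<tau> by (intro mult_right_mono) auto
    thus ?thesis using \<tau> by linarith
  qed
  \<comment> \<open>On the rays, where Re s = r cos \<theta>, the damping exp(- h Re s) outweighs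
    the growth allowed to the dual function. Likewise \<open>exp2\<close> fits the loss in its lower
    bound at the exponent into the rate h.\<close>
  have exp1: "h / 4 + pi * real e * sin \<theta> \<le> h * cos \<theta>"
  proof -
    have "pi * real e * sin \<theta> = (\<beta> * \<tau>) * cos \<theta>" by (simp add: sin \<beta>_def)
    also have "\<dots> \<le> h / 2 * cos \<theta>" using \<beta>\<tau> cos by (intro mult_right_mono) auto
    finally have "pi * real e * sin \<theta> \<le> h / 2 * cos \<theta>" .
    moreover have "h / 2 * (1 / 2) \<le> h / 2 * cos \<theta>" using cos h by (intro mult_left_mono) auto
    ultimately show ?thesis by simp
  qed
  have exp2: "h / 4 / cos \<theta> + L * tan \<theta> \<le> h"
  proof -
    have "h / 4 / cos \<theta> \<le> h / 4 / (1 / 2)" using cos h by (intro divide_left_mono) auto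
    thus ?thesis using \<tau> unfolding tan by simp
  qed
  define R where "R = (\<lambda>J m. dual_fun (S \<inter> {0<..real J} - {m}) J e)"
  have "h / 4 > 0" using h by simp
  from dual_fun_estimate[OF d S sep conv \<theta> this]
  obtain C where C: "C > 0" and
    ray: "\<And>J m r. m \<in> S \<Longrightarrow> m \<le> real J \<Longrightarrow> r \<ge> 0 \<Longrightarrow> norm (R J m (of_real r * cis \<theta>)) \<le> C * exp ((h / 4 + pi * real e * sin \<theta>) * r)"
      "\<And>J m r. m \<in> S \<Longrightarrow> m \<le> real J \<Longrightarrow> r \<ge> 0 \<Longrightarrow> norm (R J m (of_real r * cis (-\<theta>))) \<le> C * exp ((h / 4 + pi * real e * sin \<theta>) * r)" and
    low: "\<And>J m. m \<in> S \<Longrightarrow> m \<le> real J \<Longrightarrow> exp (- (h / 4 / cos \<theta> + L * tan \<theta>) * m) \<le> C * norm (R J m (of_real m))"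
    unfolding R_def L_def by blast
  have cell: "finite (S \<inter> {real j<..real (Suc j)})" for j
    using separated_cell[of d S "real j"] d sep by (auto simp: add.commute)
  have fin: "finite (S \<inter> {0<..real J})" for J
    using sum_Ioc_by_cells[of S J] cell by blast
  \<comment> \<open>Chosen so that 1 + m \<le> D exp(h m / 2) for all m > 0.\<close>
  define D where "D = max 1 (2 / h)"
  have D: "D \<ge> 1" "D * (h / 2) \<ge> 1" using h by (auto simp: D_def max_def field_simps)
  define C' where "C' = (1 + C) * (2 * D\<^sup>2 * C) * (\<beta> + 1 / c)"
  have main: "norm (a n) \<le> C' * exp (\<eta> * \<mu> n) * A"
    if F: "finite F" "n \<in> F" and bd: "\<And>u v. u \<ge> 0 \<Longrightarrow> \<bar>v\<bar> \<le> \<beta> \<Longrightarrow>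
        norm (\<Sum>k\<in>F. a k * exp (- of_real (\<mu> k) * Complex u v)) \<le> A * exp (- c * u)" for F a A n
  proof -
    interpret exponential_sum F a \<mu> A \<beta> c
      by unfold_locales (use F bd \<mu> S \<beta> c in auto)
    define m where "m = \<mu> n"
    have m: "m \<in> S" "m > 0" using \<mu> S by (auto simp: m_def)
    obtain J where J: "\<And>k. k \<in> F \<Longrightarrow> \<mu> k \<le> real J"
    proof -
      have "\<mu> k \<le> real (nat \<lceil>Max (\<mu> ` F)\<rceil>)" if "k \<in> F" for k
        using F(1) that by (intro order_trans[OF Max_ge real_nat_ceiling_ge]) auto
      thus ?thesis by (rule that)
    qed
    have mJ: "m \<le> real J" using J F by (simp add: m_def)
    define T where "T = S \<inter> {0<..real J} - {m}"
    have T: "finite T" "T \<subseteq> {0<..}" using fin[of J] by (auto simp: T_def)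
    define Rs where "Rs = dual_fun T J e"
    have Rs: "Rs = R J m" by (simp add: Rs_def R_def T_def)
    define w where "w = norm (Rs (of_real m))"
    have w: "exp (- (h * m)) \<le> C * w"
    proof -
      have "(h / 4 / cos \<theta> + L * tan \<theta>) * m \<le> h * m" using exp2 m by (intro mult_right_mono) auto
      hence "exp (- (h * m)) \<le> exp (- (h / 4 / cos \<theta> + L * tan \<theta>) * m)"
        by (simp only: exp_le_cancel_iff mult_minus_left neg_le_iff_le)
      also have "\<dots> \<le> C * w" using low[OF m(1) mJ] by (simp add: w_def Rs)
      finally show ?thesis .
    qed
    have w0: "w > 0"
    proof -
      have "C * w > 0" using w by (rule less_le_trans[OF exp_gt_zero])
      thus ?thesis using C by (simp add: zero_less_mult_iff)
    qed
    have winv: "1 / w \<le> C * exp (h * m)"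
    proof -
      have "exp (h * m) * exp (- (h * m)) \<le> exp (h * m) * (C * w)" by (intro mult_left_mono w) auto
      moreover have "exp (h * m) * exp (- (h * m)) = 1" by (simp flip: exp_add)
      ultimately show ?thesis using w0 by (simp add: pos_divide_le_eq mult_ac)
    qed
    \<comment> \<open>The value at m is 1. The factor (1 + s)^-2, regular for Re s \<ge> 0, supplies
      the integrable decay. exp(- h s) damps the rays but has modulus 1 on the imaginary axis, so
      the bound there keeps its shape.\<close>
    define K where "K s = Rs s / Rs (of_real m) * ((1 + of_real m) / (1 + s))\<^sup>2 * exp (- of_real h * (s - of_real m))" for s
    define M1 where "M1 = 2 * (1 + m)\<^sup>2 * exp (h * m) / w"
    have M1: "M1 \<ge> 0" using w0 by (simp add: M1_def)
    have normK: "norm (K s) \<le> norm (Rs s) * (M1 / (1 + norm s)\<^sup>2 * exp (- h * Re s))" if s: "Re s \<ge> 0" for s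
    proof -
      have s1: "(1 + norm s)\<^sup>2 \<le> 2 * (norm (1 + s))\<^sup>2"
      proof -
        have "(norm (1 + s))\<^sup>2 = 1 + 2 * Re s + (norm s)\<^sup>2" unfolding cmod_power2 by (simp add: power2_eq_square algebra_simps)
        moreover have "0 \<le> (1 - norm s)\<^sup>2" by simp
        ultimately show ?thesis using s by (simp add: power2_eq_square algebra_simps)
      qed
      have n1: "norm (1 + s) > 0" using s of_real_plus_nonzero[of 1 s] by simp
      have "1 / (norm (1 + s))\<^sup>2 \<le> 2 / (1 + norm s)\<^sup>2"
      proof -
        have "1 / x \<le> 2 / y" if "y \<le> 2 * x" "x > 0" "y > 0" for x y :: real
          using that by (simp add: field_simps)
        moreover have "(1 + norm s)\<^sup>2 > 0" by (intro zero_less_power add_pos_nonneg) auto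
        ultimately show ?thesis using s1 n1 by simp
      qed
      hence q: "(1 + m)\<^sup>2 * (1 / (norm (1 + s))\<^sup>2) \<le> (1 + m)\<^sup>2 * (2 / (1 + norm s)\<^sup>2)" by (rule mult_left_mono) simp
      have nm: "norm (1 + of_real m :: complex) = 1 + m"
      proof -
        have "norm (of_real (1 + m) :: complex) = 1 + m" unfolding norm_of_real using m by simp
        thus ?thesis by simp
      qed
      have "norm (K s) = norm (Rs s) / w * ((1 + m)\<^sup>2 * (1 / (norm (1 + s))\<^sup>2)) * exp (h * m - h * Re s)"
        unfolding K_def norm_mult norm_divide norm_power nm w_def
        by (simp add: power_divide algebra_simps)
      also have "\<dots> \<le> norm (Rs s) / w * ((1 + m)\<^sup>2 * (2 / (1 + norm s)\<^sup>2)) * exp (h * m - h * Re s)"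
        using w0 by (intro mult_right_mono mult_left_mono q) auto
      also have "\<dots> = norm (Rs s) * (M1 / (1 + norm s)\<^sup>2 * exp (- h * Re s))"
        by (simp add: M1_def exp_diff exp_minus divide_inverse mult_ac)
      finally show ?thesis .
    qed
    have holK: "K holomorphic_on {s. Re s \<ge> 0}"
    proof -
      have "1 + s \<noteq> 0" if "Re s \<ge> 0" for s using of_real_plus_nonzero[of 1 s] that by simp
      moreover have "Rs (of_real m) \<noteq> 0" using w0 by (simp add: w_def)
      ultimately show ?thesis unfolding K_def [abs_def] Rs_def
        by (intro holomorphic_intros dual_fun_holomorphic T) auto
    qed
    obtain C0 where C0: "\<And>s. Re s \<ge> 0 \<Longrightarrow> norm (Rs s) \<le> C0 * exp (\<beta> * \<bar>Im s\<bar>)"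
      using dual_fun_growth[OF T(2), of J e] unfolding Rs_def \<beta>_def by (auto simp: mult_ac)
    have C00: "C0 \<ge> 0" using C0[of 0] by (simp add: order_trans[OF norm_ge_zero])
    \<comment> \<open>One constant for the imaginary axis, where M1 suffices, and for the rays,
      where C * M1 is needed.\<close>
    define M where "M = (1 + C) * M1"
    have MM: "M1 \<le> M" "C * M1 \<le> M" using C M1 by (auto simp: M_def algebra_simps)
    have raygen: "norm (K s) \<le> M / (1 + r)\<^sup>2"
      if "r \<ge> 0" "norm (Rs s) \<le> C * exp ((h / 4 + pi * real e * sin \<theta>) * r)" "Re s = r * cos \<theta>" "norm s = r" for r s
    proof -
      have "norm (K s) \<le> norm (Rs s) * (M1 / (1 + norm s)\<^sup>2 * exp (- h * Re s))"
        using that(1,3) cos by (intro normK) (simp only: mult_nonneg_nonneg)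
      also have "\<dots> \<le> C * exp ((h / 4 + pi * real e * sin \<theta>) * r) * (M1 / (1 + r)\<^sup>2 * exp (- h * (r * cos \<theta>)))"
        unfolding that(3,4) using that(2) M1 by (intro mult_right_mono) auto
      also have "\<dots> = C * M1 / (1 + r)\<^sup>2 * exp ((h / 4 + pi * real e * sin \<theta>) * r - h * cos \<theta> * r)"
      proof -
        have "exp ((h / 4 + pi * real e * sin \<theta>) * r - h * cos \<theta> * r) = exp ((h / 4 + pi * real e * sin \<theta>) * r) * exp (- h * (r * cos \<theta>))"
          unfolding exp_add [symmetric] by (rule arg_cong[where f = exp]) (simp only: mult_minus_left mult_minus_right diff_conv_add_uminus mult_ac)
        thus ?thesis by (simp only: divide_inverse mult_ac)
      qed
      also have "\<dots> \<le> C * M1 / (1 + r)\<^sup>2 * 1"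
      proof (rule mult_left_mono)
        have "(h / 4 + pi * real e * sin \<theta>) * r \<le> h * cos \<theta> * r" using exp1 that by (intro mult_right_mono) auto
        thus "exp ((h / 4 + pi * real e * sin \<theta>) * r - h * cos \<theta> * r) \<le> 1"
          by (simp only: exp_le_one_iff diff_le_0_iff_le)
      qed (use C M1 in auto)
      also have "\<dots> \<le> M / (1 + r)\<^sup>2" using MM by (simp add: divide_right_mono)
      finally show ?thesis .
    qed
    have "norm (a n) \<le> M * A * (\<beta> + 1 / c)"
    proof (rule coefficient_bound[where K = K and \<theta> = \<theta> and ?M0.0 = "C0 * M1"])
      show "n \<in> F" by fact
      show "K (of_real (\<mu> n)) = 1"
      proof -
        have "Rs (of_real m) \<noteq> 0" using w0 by (simp add: w_def)
        moreover have "1 + of_real m \<noteq> (0 :: complex)" using of_real_plus_nonzero[of 1 "of_real m"] m by simp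
        ultimately show ?thesis by (simp add: K_def m_def [symmetric])
      qed
      show "K (of_real (\<mu> k)) = 0" if "k \<in> F" "k \<noteq> n" for k
      proof -
        have "\<mu> k \<noteq> m" using \<mu>(2) that by (auto simp: m_def inj_eq)
        hence "\<mu> k \<in> T" using that J \<mu> S by (auto simp: T_def)
        thus ?thesis using dual_fun_eq_0[OF T(1)] by (simp add: K_def Rs_def)
      qed
      show "K holomorphic_on {s. Re s \<ge> 0}" by (rule holK)
      show "M \<ge> 0" using MM M1 by linarith
      show "norm (K s) \<le> C0 * M1 * exp (\<beta> * \<bar>Im s\<bar>) / (1 + norm s)\<^sup>2" if s: "Re s \<ge> 0" for s
      proof -
        have "norm (K s) \<le> norm (Rs s) * (M1 / (1 + norm s)\<^sup>2 * exp (- h * Re s))" by (rule normK[OF s])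
        also have "\<dots> \<le> (C0 * exp (\<beta> * \<bar>Im s\<bar>)) * (M1 / (1 + norm s)\<^sup>2 * 1)"
          using h s M1 C00 by (intro mult_mono C0) auto
        finally show ?thesis by (simp add: mult_ac)
      qed
      show "norm (K s) \<le> C0 * M1 / (1 + norm s)\<^sup>2" if s: "Re s \<ge> 0" "\<bar>Im s\<bar> \<le> Re s * tan \<theta>" for s
      proof -
        \<comment> \<open>Between the rays |Im s| \<le> \<tau> * Re s, and \<beta> * \<tau> \<le> h
          / 2, so the damping absorbs the growth exp(\<beta> |Im s|).\<close>
        have "\<beta> * \<bar>Im s\<bar> \<le> \<beta> * (Re s * \<tau>)" using s \<beta> unfolding tan by (intro mult_left_mono) auto
        also have "\<dots> = \<beta> * \<tau> * Re s" by simp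
        also have "\<dots> \<le> h * Re s" using \<beta>\<tau> h s by (intro mult_right_mono) auto
        finally have E: "exp (\<beta> * \<bar>Im s\<bar>) * exp (- h * Re s) \<le> 1" by (simp flip: exp_add)
        have "norm (K s) \<le> norm (Rs s) * (M1 / (1 + norm s)\<^sup>2 * exp (- h * Re s))" by (rule normK[OF s(1)])
        also have "\<dots> \<le> (C0 * exp (\<beta> * \<bar>Im s\<bar>)) * (M1 / (1 + norm s)\<^sup>2 * exp (- h * Re s))"
          using M1 by (intro mult_right_mono C0 s) auto
        also have "\<dots> = C0 * M1 / (1 + norm s)\<^sup>2 * (exp (\<beta> * \<bar>Im s\<bar>) * exp (- h * Re s))" by (simp add: mult_ac)
        also have "\<dots> \<le> C0 * M1 / (1 + norm s)\<^sup>2 * 1" using C00 M1 by (intro mult_left_mono E) auto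
        finally show ?thesis by simp
      qed
      show "norm (K (\<i> * of_real y)) \<le> M * exp (\<beta> * \<bar>y\<bar>) / (1 + \<bar>y\<bar>)\<^sup>2" for y
      proof -
        have "norm (K (\<i> * of_real y)) \<le> norm (Rs (\<i> * of_real y)) * (M1 / (1 + \<bar>y\<bar>)\<^sup>2)"
          using normK[of "\<i> * of_real y"] by (simp add: norm_mult)
        also have "\<dots> \<le> exp (\<beta> * \<bar>y\<bar>) * (M / (1 + \<bar>y\<bar>)\<^sup>2)"
          unfolding Rs_def \<beta>_def using M1 MM
          by (intro mult_mono norm_dual_fun_imaginary T divide_right_mono) auto
        finally show ?thesis by (simp add: mult_ac)
      qed
      show "norm (K (of_real r * cis \<theta>)) \<le> M / (1 + r)\<^sup>2" if "r \<ge> 0" for r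
        using that ray(1)[OF m(1) mJ that] by (intro raygen) (auto simp: Rs norm_mult)
      show "norm (K (of_real r * cis (- \<theta>))) \<le> M / (1 + r)\<^sup>2" if "r \<ge> 0" for r
        using that ray(2)[OF m(1) mJ that] by (intro raygen) (auto simp: Rs norm_mult)
    qed (use \<theta> in auto)
    also have "M * A * (\<beta> + 1 / c) \<le> ((1 + C) * (2 * D\<^sup>2 * C * exp (\<eta> * m))) * A * (\<beta> + 1 / c)"
    proof (intro mult_right_mono)
      have "1 + m \<le> D * 1 + D * (h / 2) * m" using D m by (intro add_mono) (simp_all add: mult_le_cancel_right1)
      also have "\<dots> = D * (1 + h * m / 2)" by (simp add: algebra_simps)
      also have "\<dots> \<le> D * exp (h * m / 2)" using D by (intro mult_left_mono) (auto simp: exp_ge_add_one_self)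
      finally have "(1 + m)\<^sup>2 \<le> (D * exp (h * m / 2))\<^sup>2" using m by (intro power_mono) auto
      also have "\<dots> = D\<^sup>2 * exp (h * m)" by (simp add: power_mult_distrib exp_double [symmetric])
      finally have p: "(1 + m)\<^sup>2 \<le> D\<^sup>2 * exp (h * m)" .
      have "M1 = 2 * (1 + m)\<^sup>2 * exp (h * m) * (1 / w)" by (simp add: M1_def)
      also have "\<dots> \<le> 2 * (D\<^sup>2 * exp (h * m)) * exp (h * m) * (C * exp (h * m))"
        using w0 by (intro mult_mono p winv) auto
      also have "\<dots> = 2 * D\<^sup>2 * C * (exp (h * m) * exp (h * m) * exp (h * m))" by (simp only: mult_ac)
      also have "exp (h * m) * exp (h * m) * exp (h * m) = exp (\<eta> * m)"
        by (simp add: h_def flip: exp_add)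
      finally show "M \<le> (1 + C) * (2 * D\<^sup>2 * C * exp (\<eta> * m))" unfolding M_def using C by (intro mult_left_mono) auto
    qed (use A_nonneg \<beta> c in auto)
    finally show ?thesis by (simp only: C'_def m_def mult_ac)
  qed
  have "C' \<ge> 0" using C \<beta> c by (simp add: C'_def)
  with main show ?thesis unfolding \<beta>_def by blast
qed

subsection \<open>Exponents of bounded logarithmic density\<close>

lemma sum_inverse_ge_ln:
  assumes "I \<le> J"
  shows "ln (real J + 1) - ln (real I + 1) \<le> (\<Sum>j\<in>{I<..J}. 1 / real j)"
  using assms
proof (induction J rule: dec_induct)
  case (step J)
  have "ln ((real J + 2) / (real J + 1)) \<le> (real J + 2) / (real J + 1) - 1"
    by (intro ln_le_minus_one divide_pos_pos) auto
  also have "\<dots> = 1 / real (Suc J)" by (simp add: field_simps)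
  finally have "ln (real J + 2) - ln (real J + 1) \<le> 1 / real (Suc J)" by (simp add: ln_div)
  moreover have "{I<..Suc J} = insert (Suc J) {I<..J}" using step by auto
  hence "(\<Sum>j\<in>{I<..Suc J}. 1 / real j) = 1 / real (Suc J) + (\<Sum>j\<in>{I<..J}. 1 / real j)" by simp
  moreover have "real (Suc J) + 1 = real J + 2" by simp
  ultimately show ?case using step.IH by (simp only:)
qed simp

lemma sum_cells_le:
  fixes S :: "real set"
  assumes "\<And>j. finite (S \<inter> {real j <.. real (Suc j)})" "I \<le> J"
  shows "finite (S \<inter> {real I <.. real J}) \<and>
    (\<Sum>j\<in>{I<..J}. real (card (S \<inter> {real j - 1 <.. real j})) / real j) \<le> (\<Sum>x\<in>S \<inter> {real I <.. real J}. 1 / x)"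
  using assms(2)
proof (induction J rule: dec_induct)
  case (step J)
  let ?C = "S \<inter> {real J <.. real (Suc J)}"
  have un: "S \<inter> {real I <.. real (Suc J)} = (S \<inter> {real I <.. real J}) \<union> ?C" using step by auto
  have disj: "(S \<inter> {real I <.. real J}) \<inter> ?C = {}" by auto
  have "real (card ?C) / real (Suc J) = (\<Sum>x\<in>?C. 1 / real (Suc J))" by simp
  also have "\<dots> \<le> (\<Sum>x\<in>?C. 1 / x)" by (intro sum_mono divide_left_mono) (auto intro!: mult_pos_pos intro: order.strict_trans1[OF of_nat_0_le_iff])
  finally have c: "real (card ?C) / real (Suc J) \<le> (\<Sum>x\<in>?C. 1 / x)" .
  have "{I<..Suc J} = insert (Suc J) {I<..J}" using step by auto
  hence "(\<Sum>j\<in>{I<..Suc J}. real (card (S \<inter> {real j - 1 <.. real j})) / real j)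
     = real (card ?C) / real (Suc J) + (\<Sum>j\<in>{I<..J}. real (card (S \<inter> {real j - 1 <.. real j})) / real j)"
    by simp
  moreover have "(\<Sum>x\<in>S \<inter> {real I <.. real (Suc J)}. 1 / x) = (\<Sum>x\<in>S \<inter> {real I <.. real J}. 1 / x) + (\<Sum>x\<in>?C. 1 / x)"
    unfolding un using step.IH assms(1) disj by (intro sum.union_disjoint) auto
  ultimately show ?case using c step.IH assms(1)[of J] unfolding un by auto
qed simp

lemma min_gap_le:
  assumes "mono l" "min_gap l > 0"
  shows "m < n \<Longrightarrow> l n - l m \<ge> min_gap l" "l n - l 0 \<ge> real n * min_gap l"
proof -
  have bdd: "bdd_below (range (\<lambda>n. l (Suc n) - l n))"
    using assms(1) by (intro bdd_belowI[of _ 0]) (auto simp: mono_def)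
  have step: "l (Suc n) - l n \<ge> min_gap l" for n
    unfolding min_gap_def by (rule cINF_lower[OF bdd]) simp
  show "l n - l m \<ge> min_gap l" if "m < n"
    using step[of m] monoD[OF assms(1), of "Suc m" n] that by simp
  show "l n - l 0 \<ge> real n * min_gap l"
    using step by (induction n) (auto simp: algebra_simps intro: order_trans[OF add_mono])
qed

lemma shifted_range_separated:
  assumes mono: "mono l" and gap: "min_gap l > 0" and \<rho>: "\<rho> > 0"
    and ab: "a \<in> range (\<lambda>n. \<rho> * (l n + 1))" "b \<in> range (\<lambda>n. \<rho> * (l n + 1))" "a < b"
  shows "b - a \<ge> \<rho> * min_gap l"
proof -
  obtain m n where mn: "a = \<rho> * (l m + 1)" "b = \<rho> * (l n + 1)" using ab(1,2) by blast
  hence "l m < l n" using ab(3) \<rho> by simp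
  hence "m < n" using monoD[OF mono, of n m] by (meson not_le)
  hence "\<rho> * min_gap l \<le> \<rho> * (l n - l m)"
    using min_gap_le(1)[OF mono gap] \<rho> by (intro mult_left_mono) auto
  thus ?thesis by (simp add: mn algebra_simps)
qed

lemma inj_shifted:
  assumes "mono l" "min_gap l > 0" "\<rho> > 0"
  shows "inj (\<lambda>n. \<rho> * (l n + 1))"
proof (rule injI)
  fix m n assume "\<rho> * (l m + 1) = \<rho> * (l n + 1)"
  hence "l m = l n" using assms(3) by simp
  thus "m = n" using min_gap_le(1)[OF assms(1,2), of m n] min_gap_le(1)[OF assms(1,2), of n m] assms(2)
    by (cases m n rule: linorder_cases) auto
qed

text \<open>As e \<le> 1, a negative term \<open>u j\<close> forces e = 1 and an empty cell. The
  greedy correction by 1/j at j is then realised by putting one point into that cell, since this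
  raises its count from 0 to 1.\<close>

lemma fill_empty_cells:
  fixes S0 :: "real set" and d :: real and e :: nat
  assumes d: "d > 0" and S0: "S0 \<subseteq> {0<..}" and e: "e \<le> 1"
    and sep: "\<And>a b. a \<in> S0 \<Longrightarrow> b \<in> S0 \<Longrightarrow> a < b \<Longrightarrow> b - a \<ge> d"
    and upper: "\<And>\<eta>. \<eta> > 0 \<Longrightarrow> \<exists>I0. \<forall>I\<ge>I0. \<forall>J\<ge>I. (\<Sum>j\<in>{I<..J}. (real (card (S0 \<inter> {real j - 1 <.. real j})) - real e) / real j) \<le> \<eta>"
  obtains S where "S0 \<subseteq> S" "S \<subseteq> {0<..}"
    "\<And>a b. a \<in> S \<Longrightarrow> b \<in> S \<Longrightarrow> a < b \<Longrightarrow> b - a \<ge> min d (1 / 2)"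
    "convergent (\<lambda>J. \<Sum>j=1..J. (real (card (S \<inter> {real j - 1 <.. real j})) - real e) / real j)"
proof -
  define u where "u j = (real (card (S0 \<inter> {real j - 1 <.. real j})) - real e) / real j" for j
  have lower: "u (Suc j) \<ge> - 1 / real (Suc j)" for j
    unfolding u_def using e by (intro divide_right_mono) auto
  have upper': "\<exists>I0. \<forall>I\<ge>I0. \<forall>J\<ge>I. (\<Sum>j\<in>{I<..J}. u j) \<le> \<eta>" if "\<eta> > 0" for \<eta>
    unfolding u_def using upper[OF that] .
  obtain F where F: "\<And>j. j \<in> F \<Longrightarrow> j \<ge> 1 \<and> u j < 0"
    and conv: "convergent (\<lambda>J. \<Sum>j=1..J. u j + (if j \<in> F then 1 / real j else 0))"
  proof (rule greedy_correction_converges[of u, OF lower upper'])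
    fix F :: "nat set"
    assume "\<And>j. j \<in> F \<Longrightarrow> j \<ge> 1 \<and> u j < 0" "convergent (\<lambda>J. \<Sum>j=1..J. u j + (if j \<in> F then 1 / real j else 0))"
    thus thesis by (rule that)
  qed
  have fin: "finite (S0 \<inter> {real j - 1 <.. real j})" for j
    using separated_cell[of d S0 "real j - 1"] d sep by simp
  have emp: "S0 \<inter> {real j - 1 <.. real j} = {}" if "j \<in> F" for j
  proof -
    have "real (card (S0 \<inter> {real j - 1 <.. real j})) - real e < 0"
      using F[OF that] by (auto simp: u_def divide_less_0_iff)
    hence "card (S0 \<inter> {real j - 1 <.. real j}) = 0" using e by linarith
    thus ?thesis using fin[of j] by simp
  qed
  \<comment> \<open>The midpoint of a cell has distance at least 1/2 from every point outside the
    cell, so the separation survives.\<close>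
  define G where "G = (\<lambda>j. real j - 1 / 2) ` F"
  have G1: "G \<inter> {real j - 1 <.. real j} = (if j \<in> F then {real j - 1 / 2} else {})" for j
  proof -
    have *: "i = j" if "real j - 1 < real i - 1 / 2" "real i - 1 / 2 \<le> real j" for i
    proof -
      have "real i < real (Suc j)" "real j < real (Suc i)" using that by auto
      thus ?thesis unfolding of_nat_less_iff by linarith
    qed
    show ?thesis by (auto simp: G_def dest: *)
  qed
  have cross: "b - a \<ge> 1 / 2" if "a \<in> S0 \<and> b \<in> G \<or> a \<in> G \<and> b \<in> S0" "a < b" for a b
    using that(1)
  proof
    assume "a \<in> S0 \<and> b \<in> G"
    then obtain j where j: "j \<in> F" "b = real j - 1 / 2" "a \<in> S0" by (auto simp: G_def)
    have "a \<notin> {real j - 1 <.. real j}" using emp[OF j(1)] j(3) by blast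
    thus ?thesis using that(2) j(2) by auto
  next
    assume "a \<in> G \<and> b \<in> S0"
    then obtain j where j: "j \<in> F" "a = real j - 1 / 2" "b \<in> S0" by (auto simp: G_def)
    have "b \<notin> {real j - 1 <.. real j}" using emp[OF j(1)] j(3) by blast
    thus ?thesis using that(2) j(2) by auto
  qed
  have GG: "b - a \<ge> 1 / 2" if ab: "a \<in> G" "b \<in> G" "a < b" for a b
  proof -
    obtain i j where "a = real i - 1 / 2" "b = real j - 1 / 2" using ab(1,2) unfolding G_def by blast
    moreover from this have "real (Suc i) \<le> real j" using ab(3) by (simp only: of_nat_le_iff)
    ultimately show ?thesis by simp
  qed
  have Gpos: "x > 0" if x: "x \<in> G" for x
  proof -
    obtain j where "j \<in> F" "x = real j - 1 / 2" using x unfolding G_def by blast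
    moreover from this have "real j \<ge> 1" using F by simp
    ultimately show ?thesis by simp
  qed
  show ?thesis
  proof (rule that[of "S0 \<union> G"])
    show "S0 \<union> G \<subseteq> {0<..}" using S0 Gpos by auto
    show "b - a \<ge> min d (1 / 2)" if "a \<in> S0 \<union> G" "b \<in> S0 \<union> G" "a < b" for a b
      using that sep[of a b] cross[of a b] GG[of a b] by (auto simp: min_le_iff_disj)
    have "(real (card ((S0 \<union> G) \<inter> {real j - 1 <.. real j})) - real e) / real j = u j + (if j \<in> F then 1 / real j else 0)" for j
    proof -
      have "(S0 \<union> G) \<inter> {real j - 1 <.. real j} = (S0 \<inter> {real j - 1 <.. real j}) \<union> (G \<inter> {real j - 1 <.. real j})" by auto
      thus ?thesis using emp[of j] unfolding G1 u_def by (auto simp: diff_divide_distrib)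
    qed
    thus "convergent (\<lambda>J. \<Sum>j=1..J. (real (card ((S0 \<union> G) \<inter> {real j - 1 <.. real j})) - real e) / real j)"
      using conv by simp
  qed auto
qed

text \<open>Rounding a point up to the end of its cell and shifting the exponents by 1 both lower
  the reciprocals, so the cell sums inherit the upper bound on \<open>char_log\<close>. Its
  logarithm is offset by the sum of e / j, up to a term that tends to 0 with I.\<close>

lemma log_density_bound_to_cells:
  fixes l :: "nat \<Rightarrow> real" and \<epsilon> :: "real \<Rightarrow> real" and \<rho> :: real and e :: nat
  assumes l0: "l 0 = 0" and lpos: "\<And>n. n \<ge> 1 \<Longrightarrow> 0 < l n" and mono: "mono l" and gap: "min_gap l > 0"
    and \<epsilon>: "(\<epsilon> \<longlongrightarrow> 0) at_top" and \<rho>: "\<rho> > 0"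
    and dens: "\<And>x y. 1 \<le> x \<Longrightarrow> x < y \<Longrightarrow> char_log l y - char_log l x \<le> \<rho> * real e * (ln y - ln x) + \<epsilon> x"
    and \<eta>: "\<eta> > 0"
  defines "S0 \<equiv> range (\<lambda>n. \<rho> * (l n + 1))"
  shows "\<exists>I0. \<forall>I\<ge>I0. \<forall>J\<ge>I. (\<Sum>j\<in>{I<..J}. (real (card (S0 \<inter> {real j - 1 <.. real j})) - real e) / real j) \<le> \<eta>"
proof -
  note gp = min_gap_le[OF mono gap]
  have lnn: "l n \<ge> 0" for n using lpos[of n] l0 by (cases "n = 0") auto
  have finl: "finite {n. l n \<le> y}" for y
  proof (rule finite_subset)
    show "{n. l n \<le> y} \<subseteq> {..nat \<lceil>y / min_gap l\<rceil>}"
    proof clarsimp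
      fix n assume "l n \<le> y"
      hence "real n * min_gap l \<le> y" using gp(2)[of n] l0 by simp
      hence "real n \<le> y / min_gap l" using gap by (simp add: pos_le_divide_eq)
      thus "n \<le> nat \<lceil>y / min_gap l\<rceil>" by linarith
    qed
  qed simp
  note sep = shifted_range_separated[OF mono gap \<rho>, folded S0_def]
  have cell: "finite (S0 \<inter> {real j <.. real (Suc j)})" for j
    using separated_cell[of "\<rho> * min_gap l" S0 "real j"] \<rho> gap sep by (auto simp: add.commute)
  note inj = inj_shifted[OF mono gap \<rho>]
  have main: "(\<Sum>j\<in>{I<..J}. (real (card (S0 \<inter> {real j - 1 <.. real j})) - real e) / real j)
      \<le> real e * (ln (real I + 1) - ln \<rho> - ln (real I / \<rho> - 1)) + \<epsilon> (real I / \<rho> - 1) / \<rho>"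
    if I: "real I / \<rho> - 1 \<ge> 1" "I \<le> J" for I J
  proof -
    \<comment> \<open>x is the preimage of I under the map from t to \<rho> * (t + 1). At J the
      shift is dropped, which only enlarges the range of summation.\<close>
    define x where "x = real I / \<rho> - 1"
    define y where "y = real J / \<rho>"
    have "real I / \<rho> \<le> real J / \<rho>" using I \<rho> by (intro divide_right_mono) auto
    hence xy: "1 \<le> x" "x < y" using I by (auto simp: x_def y_def)
    have "y > 0" using xy by linarith
    hence J0: "real J > 0" using \<rho> unfolding y_def by (simp add: zero_less_divide_iff)
    define A where "A = {n. real I < \<rho> * (l n + 1) \<and> \<rho> * (l n + 1) \<le> real J}"
    have A: "x < l n" "l n \<le> y" if "n \<in> A" for n
    proof -
      have "real I / \<rho> < l n + 1" "l n + 1 \<le> real J / \<rho>" using that \<rho> by (auto simp: A_def field_simps)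
      thus "x < l n" "l n \<le> y" by (auto simp: x_def y_def)
    qed
    have "(\<Sum>j\<in>{I<..J}. real (card (S0 \<inter> {real j - 1 <.. real j})) / real j) \<le> (\<Sum>x\<in>S0 \<inter> {real I <.. real J}. 1 / x)"
      using sum_cells_le[of S0 I J] cell I by blast
    also have "S0 \<inter> {real I <.. real J} = (\<lambda>n. \<rho> * (l n + 1)) ` A" by (auto simp: S0_def A_def)
    also have "(\<Sum>x\<in>\<dots>. 1 / x) = (\<Sum>n\<in>A. 1 / (\<rho> * (l n + 1)))"
      by (subst sum.reindex) (auto intro: inj_on_subset[OF inj])
    also have "\<dots> \<le> (\<Sum>n\<in>A. inverse (l n) / \<rho>)"
    proof (intro sum_mono)
      fix n assume n: "n \<in> A"
      have "l n > 0" using A[OF n] xy by simp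
      hence "1 / (\<rho> * (l n + 1)) \<le> 1 / (\<rho> * l n)" using \<rho> by (intro divide_left_mono mult_left_mono mult_pos_pos) auto
      thus "1 / (\<rho> * (l n + 1)) \<le> inverse (l n) / \<rho>" by (simp add: inverse_eq_divide mult.commute)
    qed
    also have "\<dots> \<le> (\<Sum>n | x < l n \<and> l n \<le> y. inverse (l n) / \<rho>)"
      using A \<rho> lnn by (intro sum_mono2 finite_subset[OF _ finl[of y]]) auto
    also have "\<dots> = (char_log l y - char_log l x) / \<rho>"
    proof -
      have "{n. 0 < l n \<and> l n \<le> y} = {n. 0 < l n \<and> l n \<le> x} \<union> {n. x < l n \<and> l n \<le> y}" using xy by auto
      moreover have "(\<Sum>n\<in>{n. 0 < l n \<and> l n \<le> x} \<union> {n. x < l n \<and> l n \<le> y}. inverse (l n))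
         = (\<Sum>n | 0 < l n \<and> l n \<le> x. inverse (l n)) + (\<Sum>n | x < l n \<and> l n \<le> y. inverse (l n))"
        by (intro sum.union_disjoint finite_subset[OF _ finl[of y]]) (use xy in auto)
      ultimately have "char_log l y - char_log l x = (\<Sum>n | x < l n \<and> l n \<le> y. inverse (l n))"
        unfolding char_log_def by simp
      thus ?thesis by (simp add: sum_divide_distrib)
    qed
    also have "\<dots> \<le> (\<rho> * real e * (ln y - ln x) + \<epsilon> x) / \<rho>"
      using dens[OF xy] \<rho> by (intro divide_right_mono) auto
    also have "\<dots> = real e * (ln y - ln x) + \<epsilon> x / \<rho>" using \<rho> by (simp add: field_simps)
    finally have 1: "(\<Sum>j\<in>{I<..J}. real (card (S0 \<inter> {real j - 1 <.. real j})) / real j) \<le> real e * (ln y - ln x) + \<epsilon> x / \<rho>" .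
    have "ln y = ln (real J) - ln \<rho>" unfolding y_def using J0 \<rho> by (simp add: ln_div)
    also have "\<dots> \<le> ln (real J + 1) - ln \<rho>" using J0 by simp
    finally have "ln y - (\<Sum>j\<in>{I<..J}. 1 / real j) \<le> ln (real I + 1) - ln \<rho>"
      using sum_inverse_ge_ln[OF I(2)] by linarith
    hence "real e * (ln y - (\<Sum>j\<in>{I<..J}. 1 / real j)) \<le> real e * (ln (real I + 1) - ln \<rho>)"
      by (rule mult_left_mono) simp
    moreover have "(\<Sum>j\<in>{I<..J}. (real (card (S0 \<inter> {real j - 1 <.. real j})) - real e) / real j)
      = (\<Sum>j\<in>{I<..J}. real (card (S0 \<inter> {real j - 1 <.. real j})) / real j) - real e * (\<Sum>j\<in>{I<..J}. 1 / real j)"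
      by (simp add: diff_divide_distrib sum_subtractf sum_distrib_left)
    ultimately show ?thesis using 1 unfolding x_def[symmetric] by (simp add: algebra_simps)
  qed
  have xlim: "filterlim (\<lambda>I. real I / \<rho> - 1) at_top sequentially" using \<rho> by real_asymp
  have "(\<lambda>I. ln (real I + 1) + ln (inverse \<rho>) - ln (real I / \<rho> - 1)) \<longlonglongrightarrow> 0" using \<rho> by real_asymp
  hence "(\<lambda>I. ln (real I + 1) - ln \<rho> - ln (real I / \<rho> - 1)) \<longlonglongrightarrow> 0" using \<rho> by (simp add: ln_inverse)
  moreover have "(\<lambda>I. \<epsilon> (real I / \<rho> - 1)) \<longlonglongrightarrow> 0" by (rule filterlim_compose[OF \<epsilon> xlim])
  ultimately have "(\<lambda>I. real e * (ln (real I + 1) - ln \<rho> - ln (real I / \<rho> - 1)) + \<epsilon> (real I / \<rho> - 1) / \<rho>) \<longlonglongrightarrow> real e * 0 + 0 / \<rho>"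
    by (intro tendsto_intros) (use \<rho> in auto)
  hence "eventually (\<lambda>I. real e * (ln (real I + 1) - ln \<rho> - ln (real I / \<rho> - 1)) + \<epsilon> (real I / \<rho> - 1) / \<rho> < \<eta>) sequentially"
    using \<eta> by (intro order_tendstoD(2)) auto
  moreover have "eventually (\<lambda>I. real I / \<rho> - 1 \<ge> 1) sequentially"
    using xlim unfolding filterlim_at_top by blast
  ultimately have "eventually (\<lambda>I. \<forall>J\<ge>I. (\<Sum>j\<in>{I<..J}. (real (card (S0 \<inter> {real j - 1 <.. real j})) - real e) / real j) \<le> \<eta>) sequentially"
    by eventually_elim (use main in \<open>force intro: order_trans less_imp_le\<close>)
  thus ?thesis by (simp add: eventually_sequentially)
qed

section \<open>Coefficient estimate for powers on the sector\<close>

definition coefficient_bound_const :: "real \<Rightarrow> (nat \<Rightarrow> real) \<Rightarrow> real \<Rightarrow> real \<Rightarrow> bool" where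
  "coefficient_bound_const \<alpha> l \<eta> C \<longleftrightarrow> (\<forall>F a M n. finite F \<longrightarrow> n \<in> F \<longrightarrow>
      (\<forall>z\<in>sector \<alpha>. norm (\<Sum>k\<in>F. a k * cpower (of_real (l k)) z) \<le> M) \<longrightarrow>
      norm (a n) \<le> C * exp (\<eta> * l n) * M)"

lemma power_coefficient_estimate:
  fixes \<alpha> :: real and l :: "nat \<Rightarrow> real"
  assumes \<alpha>: "0 \<le> \<alpha>" "\<alpha> < pi" and l0: "l 0 = 0" and lpos: "\<And>n. n \<ge> 1 \<Longrightarrow> 0 < l n"
    and mono: "mono l" and gap: "min_gap l > 0" and \<epsilon>: "(\<epsilon> \<longlongrightarrow> 0) at_top"
    and dens: "\<And>x y. 1 \<le> x \<Longrightarrow> x < y \<Longrightarrow> char_log l y - char_log l x \<le> \<alpha> / pi * ln y - \<alpha> / pi * ln x + \<epsilon> x"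
    and \<eta>: "\<eta> > 0"
  shows "\<exists>C\<ge>0. coefficient_bound_const \<alpha> l \<eta> C"
proof -
  \<comment> \<open>For \<alpha> = 0 the half-strip degenerates to a half-line at every scale, so
    any positive value would serve there.\<close>
  define \<rho> where "\<rho> = (if \<alpha> = 0 then 1 else \<alpha> / pi)"
  define e :: nat where "e = (if \<alpha> = 0 then 0 else 1)"
  have \<rho>: "\<rho> > 0" using \<alpha> by (auto simp: \<rho>_def)
  have e: "e \<le> 1" by (simp add: e_def)
  have \<alpha>e: "\<alpha> = \<rho> * (pi * real e)" "\<alpha> / pi = \<rho> * real e" by (auto simp: \<rho>_def e_def)
  note gp = min_gap_le[OF mono gap]
  have lnn: "l n \<ge> 0" for n using lpos[of n] l0 by (cases "n = 0") auto
  define \<mu> where "\<mu> n = \<rho> * (l n + 1)" for n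
  define S0 where "S0 = range (\<lambda>n. \<rho> * (l n + 1))"
  note sep = shifted_range_separated[OF mono gap \<rho>, folded S0_def]
  have inj: "inj \<mu>" unfolding \<mu>_def [abs_def] by (rule inj_shifted[OF mono gap \<rho>])
  have dens': "char_log l y - char_log l x \<le> \<rho> * real e * (ln y - ln x) + \<epsilon> x" if "1 \<le> x" "x < y" for x y
    using dens[OF that] unfolding \<alpha>e(2) by (simp add: algebra_simps)
  have S0pos: "S0 \<subseteq> {0<..}" using \<rho> lnn by (auto simp: S0_def intro!: mult_pos_pos add_nonneg_pos)
  have d0: "\<rho> * min_gap l > 0" using \<rho> gap by simp
  note up = log_density_bound_to_cells[OF l0 lpos mono gap \<epsilon> \<rho> dens', folded S0_def]
  obtain S where S: "S0 \<subseteq> S" "S \<subseteq> {0<..}"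
    "\<And>a b. a \<in> S \<Longrightarrow> b \<in> S \<Longrightarrow> a < b \<Longrightarrow> b - a \<ge> min (\<rho> * min_gap l) (1 / 2)"
    "convergent (\<lambda>J. \<Sum>j=1..J. (real (card (S \<inter> {real j - 1 <.. real j})) - real e) / real j)"
  proof (rule fill_empty_cells[OF d0 S0pos e sep up])
    fix S
    assume "S0 \<subseteq> S" "S \<subseteq> {0<..}"
      "\<And>a b. a \<in> S \<Longrightarrow> b \<in> S \<Longrightarrow> a < b \<Longrightarrow> b - a \<ge> min (\<rho> * min_gap l) (1 / 2)"
      "convergent (\<lambda>J. \<Sum>j=1..J. (real (card (S \<inter> {real j - 1 <.. real j})) - real e) / real j)"
    thus thesis by (rule that)
  qed
  have dmin: "min (\<rho> * min_gap l) (1 / 2) > 0" using d0 by simp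
  have \<mu>S: "\<mu> n \<in> S" for n using S(1) by (auto simp: S0_def \<mu>_def)
  have "\<eta> / \<rho> > 0" using \<eta> \<rho> by simp
  from exponential_sum_coefficient_estimate[OF dmin S(2,3,4) \<mu>S inj \<rho> this]
  obtain C where C: "C \<ge> 0" and est: "\<And>F a A n. finite F \<Longrightarrow> n \<in> F \<Longrightarrow>
     (\<And>u v. u \<ge> 0 \<Longrightarrow> \<bar>v\<bar> \<le> pi * real e \<Longrightarrow>
        norm (\<Sum>k\<in>F. a k * exp (- of_real (\<mu> k) * Complex u v)) \<le> A * exp (- \<rho> * u)) \<Longrightarrow>
     norm (a n) \<le> C * exp (\<eta> / \<rho> * \<mu> n) * A" by blast
  \<comment> \<open>The factor exp \<eta> is the price of the shift: \<eta> / \<rho> * \<mu> n =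
    \<eta> + \<eta> * l n.\<close>
  have main: "norm (a n) \<le> (C * exp \<eta>) * exp (\<eta> * l n) * M"
    if F: "finite F" "n \<in> F" and bd: "\<And>z. z \<in> sector \<alpha> \<Longrightarrow> norm (\<Sum>k\<in>F. a k * cpower (of_real (l k)) z) \<le> M" for F a M n
  proof -
    have "norm (\<Sum>k\<in>F. a k * exp (- of_real (\<mu> k) * Complex u v)) \<le> M * exp (- \<rho> * u)"
      if uv: "u \<ge> 0" "\<bar>v\<bar> \<le> pi * real e" for u v
    proof -
      define w where "w = - of_real \<rho> * Complex u v"
      have Imw: "\<bar>Im w\<bar> \<le> \<alpha>"
      proof -
        have "\<rho> * \<bar>v\<bar> \<le> \<rho> * (pi * real e)" using uv \<rho> by (intro mult_left_mono) auto
        thus ?thesis using \<rho> unfolding \<alpha>e(1)[symmetric] by (simp add: w_def abs_mult)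
      qed
      have z: "exp w \<in> sector \<alpha>"
      proof -
        have "exp w = of_real (exp (- \<rho> * u)) * cis (Im w)"
          by (simp add: w_def exp_eq_polar)
        moreover have "exp (- \<rho> * u) \<le> 1" using \<rho> uv by simp
        ultimately have "\<exists>r \<theta>. exp w = of_real r * cis \<theta> \<and> 0 \<le> r \<and> r \<le> 1 \<and> \<bar>\<theta>\<bar> \<le> \<alpha>"
          using Imw by (intro exI[of _ "exp (- \<rho> * u)"] exI[of _ "Im w"] conjI) auto
        thus ?thesis by (simp only: sector_def mem_Collect_eq)
      qed
      \<comment> \<open>|Im w| \<le> \<alpha> < \<pi> keeps w in the range of the principal
        logarithm, so the powers of exp w are exponentials in w.\<close>
      have Ln: "Ln (exp w) = w" using Imw \<alpha> by (intro Ln_exp) auto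
      have "a k * exp (- of_real (\<mu> k) * Complex u v) = exp w * (a k * cpower (of_real (l k)) (exp w))" for k
      proof -
        have "cpower (of_real (l k)) (exp w) = exp (of_real (l k) * w)"
          unfolding cpower_def powr_def Ln by simp
        moreover have "exp (- of_real (\<mu> k) * Complex u v) = exp w * exp (of_real (l k) * w)"
          unfolding exp_add [symmetric] by (rule arg_cong[where f = exp]) (simp add: \<mu>_def w_def algebra_simps)
        ultimately show ?thesis by (simp only: mult_ac)
      qed
      hence "norm (\<Sum>k\<in>F. a k * exp (- of_real (\<mu> k) * Complex u v)) = norm (exp w) * norm (\<Sum>k\<in>F. a k * cpower (of_real (l k)) (exp w))"
        by (simp only: sum_distrib_left [symmetric] norm_mult)
      also have "\<dots> \<le> norm (exp w) * M" by (intro mult_left_mono bd z) auto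
      also have "norm (exp w) = exp (- \<rho> * u)" by (simp add: w_def)
      finally show ?thesis by (simp only: mult.commute)
    qed
    from est[OF F this] have "norm (a n) \<le> C * exp (\<eta> / \<rho> * \<mu> n) * M" .
    also have "\<eta> / \<rho> * \<mu> n = \<eta> + \<eta> * l n" using \<rho> by (simp add: \<mu>_def field_simps)
    finally show ?thesis by (simp only: exp_add mult_ac)
  qed
  hence "coefficient_bound_const \<alpha> l \<eta> (C * exp \<eta>)"
    unfolding coefficient_bound_const_def by blast
  moreover have "C * exp \<eta> \<ge> 0" using C by simp
  ultimately show ?thesis by blast
qed

subsection \<open>Closed spans of powers\<close>

lemma sum_fun_apply: "sum f A z = (\<Sum>x\<in>A. f x z)" for f :: "'a \<Rightarrow> complex \<Rightarrow> complex"
  by (induction A rule: infinite_finite_induct) auto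

lemma of_real_in_sector: "0 \<le> \<alpha> \<Longrightarrow> 0 \<le> x \<Longrightarrow> x \<le> 1 \<Longrightarrow> of_real x \<in> sector \<alpha>"
  unfolding sector_def by (intro CollectI exI[of _ x] exI[of _ 0]) auto

lemma cpower_real:
  assumes "x > 0" shows "cpower (of_real t) (of_real x) = of_real (x powr t)"
  using assms by (simp add: cpower_def powr_of_real)

lemma norm_cpower_le:
  assumes "t \<ge> 0" "norm z \<le> exp (- \<tau>)"
  shows "norm (cpower (of_real t) z) \<le> exp (- \<tau> * t)"
proof (cases "t = 0 \<or> z = 0")
  case True
  thus ?thesis by (auto simp: cpower_def)
next
  case False
  hence "norm (cpower (of_real t) z) = exp (t * ln (norm z))"
    by (simp add: cpower_def powr_def)
  moreover have "ln (norm z) \<le> - \<tau>" using False assms(2) by (metis ln_exp ln_le_cancel_iff exp_gt_zero zero_less_norm_iff)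
  hence "t * ln (norm z) \<le> t * - \<tau>" using assms(1) by (rule mult_left_mono)
  ultimately show ?thesis by (simp add: mult.commute)
qed

lemma in_slit_disc_iff: "z \<in> slit_disc \<longleftrightarrow> norm z < 1 \<and> z \<notin> \<real>\<^sub>\<le>\<^sub>0"
proof -
  have "\<bar>Arg z\<bar> < pi \<longleftrightarrow> \<not> (Re z < 0 \<and> Im z = 0)"
    using Arg_bounded[of z] Arg_eq_pi[of z] by (auto simp: abs_less_iff)
  moreover have "z \<in> \<real>\<^sub>\<le>\<^sub>0 \<longleftrightarrow> Re z < 0 \<and> Im z = 0 \<or> z = 0"
    by (auto simp: complex_nonpos_Reals_iff complex_eq_iff)
  ultimately show ?thesis by (auto simp: slit_disc_def)
qed

lemma open_slit_disc: "open slit_disc"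
proof -
  have "slit_disc = ball 0 1 - \<real>\<^sub>\<le>\<^sub>0" by (auto simp: in_slit_disc_iff)
  thus ?thesis using open_Diff[OF open_ball closed_nonpos_Reals_complex] by metis
qed

lemma cpower_holomorphic_slit_disc: "cpower t holomorphic_on slit_disc"
proof -
  have "(\<lambda>z. z powr t) holomorphic_on slit_disc"
    by (intro holomorphic_intros) (auto simp: in_slit_disc_iff)
  thus ?thesis unfolding cpower_def [abs_def] by (cases "t = 0") simp_all
qed

section \<open>Consequences of the coefficient estimate for closed spans\<close>

lemma coefficient_bound_constD:
  assumes "coefficient_bound_const \<alpha> l \<eta> C" "finite F" "n \<in> F"
    "\<And>z. z \<in> sector \<alpha> \<Longrightarrow> norm (\<Sum>k\<in>F. a k * cpower (of_real (l k)) z) \<le> M"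
  shows "norm (a n) \<le> C * exp (\<eta> * l n) * M"
  using assms unfolding coefficient_bound_const_def by blast

locale coefficient_system =
  fixes \<alpha> :: real and l :: "nat \<Rightarrow> real" and \<delta> :: real
  assumes \<alpha>: "0 \<le> \<alpha>" "\<alpha> < pi" and l0: "l 0 = 0" and \<delta>: "\<delta> > 0"
    and gap: "\<And>m n. m < n \<Longrightarrow> l n - l m \<ge> \<delta>" and growth: "\<And>n. l n \<ge> real n * \<delta>"
    and estimate: "\<And>\<eta>. \<eta> > 0 \<Longrightarrow> \<exists>C\<ge>0. coefficient_bound_const \<alpha> l \<eta> C"
begin

definition pw :: "nat \<Rightarrow> complex \<Rightarrow> complex" where "pw k = H_power \<alpha> (of_real (l k))"

lemma l_nonneg: "l n \<ge> 0"
  using growth[of n] \<delta> by (meson mult_nonneg_nonneg of_nat_0_le_iff less_imp_le order_trans)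

lemma pw_in_H: "pw k \<in> H_space \<alpha>"
proof -
  have "of_real (l k) = (0::complex) \<or> Re (of_real (l k)) > 0" using l_nonneg[of k] by auto
  thus ?thesis unfolding pw_def by (intro H_power_in_H_space \<alpha>)
qed

lemma pw_sector: "z \<in> sector \<alpha> \<Longrightarrow> pw k z = cpower (of_real (l k)) z"
  by (simp add: pw_def H_power_def)

text \<open>Thanks to this, removing a function from the system is the same as removing its index,
  and span coefficients can be indexed by numbers.\<close>

lemma inj_pw: "inj pw"
proof (rule injI)
  fix m n assume "pw m = pw n"
  moreover have "(1/2 :: complex) \<in> sector \<alpha>" using of_real_in_sector[of \<alpha> "1/2"] \<alpha> by simp
  ultimately have "cpower (of_real (l m)) (1/2) = cpower (of_real (l n)) (1/2)" using pw_sector by metis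
  hence "of_real ((1/2) powr l m) = (of_real ((1/2) powr l n) :: complex)"
    using cpower_real[of "1/2"] by simp
  hence "(1/2) powr l m = (1/2 :: real) powr l n" by (simp only: of_real_eq_iff)
  hence "l m = l n" by (simp add: powr_inj)
  thus "m = n" using gap[of m n] gap[of n m] \<delta> by (cases m n rule: linorder_cases) auto
qed

definition lincomb :: "nat set \<Rightarrow> (nat \<Rightarrow> complex) \<Rightarrow> complex \<Rightarrow> complex" where
  "lincomb F a z = (\<Sum>k\<in>F. a k * pw k z)"

lemma lincomb_in_H: "lincomb F a \<in> H_space \<alpha>"
proof -
  have "lincomb F a = (\<Sum>k\<in>F. (\<lambda>z. a k * pw k z))" by (simp add: fun_eq_iff lincomb_def sum_fun_apply)
  thus ?thesis by (simp add: cfun.subspace_sum[OF subspace_H_space] cfun.subspace_scale[OF subspace_H_space] pw_in_H)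
qed

lemma span_pw:
  assumes "g \<in> cfun.span (pw ` X)"
  obtains F a where "finite F" "F \<subseteq> X" "g = lincomb F a" "\<And>k. k \<notin> F \<Longrightarrow> a k = 0"
proof -
  obtain t r where t: "finite t" "t \<subseteq> pw ` X" "g = (\<Sum>a\<in>t. (\<lambda>z. r a * a z))"
    using assms unfolding cfun.span_explicit by blast
  obtain F where F: "F \<subseteq> X" "t = pw ` F" using t(2) by (meson subset_imageE)
  have "finite F" using t(1) F(2) inj_pw by (simp add: finite_image_iff inj_on_subset)
  have "g = lincomb F (\<lambda>k. if k \<in> F then r (pw k) else 0)"
  proof
    fix z
    have "g z = (\<Sum>a\<in>pw ` F. r a * a z)" by (simp add: t(3) F(2) sum_fun_apply)
    also have "\<dots> = (\<Sum>k\<in>F. r (pw k) * pw k z)"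
      using inj_pw by (subst sum.reindex) (auto intro: inj_on_subset)
    finally show "g z = lincomb F (\<lambda>k. if k \<in> F then r (pw k) else 0) z" by (simp add: lincomb_def)
  qed
  with \<open>finite F\<close> F(1) show ?thesis by (rule that) auto
qed

lemma in_closure_approx:
  assumes "f \<in> closed_span \<alpha> (pw ` X)" "\<epsilon> > 0"
  obtains F a where "finite F" "F \<subseteq> X" "\<And>k. k \<notin> F \<Longrightarrow> a k = 0"
    "\<And>z. z \<in> sector \<alpha> \<Longrightarrow> norm (f z - lincomb F a z) \<le> \<epsilon>"
proof -
  have X: "pw ` X \<subseteq> H_space \<alpha>" using pw_in_H by auto
  obtain g where g: "g \<in> cfun.span (pw ` X)" "H_norm \<alpha> (f - g) < \<epsilon>" and f: "f \<in> H_space \<alpha>"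
    using assms in_closed_span_iff[OF \<alpha>(1) X] by blast
  obtain F a where Fa: "finite F" "F \<subseteq> X" "g = lincomb F a" "\<And>k. k \<notin> F \<Longrightarrow> a k = 0"
    using span_pw[OF g(1)] by blast
  have "norm (f z - lincomb F a z) \<le> \<epsilon>" if "z \<in> sector \<alpha>" for z
  proof -
    have "f - g \<in> H_space \<alpha>" unfolding Fa(3) by (rule cfun.subspace_diff[OF subspace_H_space f lincomb_in_H])
    from norm_le_H_norm[OF this that] show ?thesis using g(2) Fa(3) by simp
  qed
  with Fa show ?thesis by (intro that[of F a]) auto
qed

lemma lincomb_mono:
  assumes "finite G" "F \<subseteq> G" "\<And>k. k \<notin> F \<Longrightarrow> a k = 0"
  shows "lincomb F a z = lincomb G a z"
  unfolding lincomb_def using assms by (intro sum.mono_neutral_left) auto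

lemma coefficient_difference:
  assumes C: "coefficient_bound_const \<alpha> l \<eta> C"
    and F: "finite F" "\<And>k. k \<notin> F \<Longrightarrow> a k = 0" and G: "finite G" "\<And>k. k \<notin> G \<Longrightarrow> b k = 0"
    and bd: "\<And>z. z \<in> sector \<alpha> \<Longrightarrow> norm (lincomb F a z - lincomb G b z) \<le> M"
  shows "norm (a n - b n) \<le> C * exp (\<eta> * l n) * M"
\<comment> \<open>The index n is inserted because it may lie in neither F nor G.\<close>
proof (rule coefficient_bound_constD[OF C, where F = "insert n (F \<union> G)" and a = "\<lambda>k. a k - b k"])
  fix z assume z: "z \<in> sector \<alpha>"
  have "lincomb F a z = lincomb (insert n (F \<union> G)) a z" "lincomb G b z = lincomb (insert n (F \<union> G)) b z"
    using F G by (intro lincomb_mono; auto)+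
  hence "lincomb F a z - lincomb G b z = (\<Sum>k\<in>insert n (F \<union> G). (a k - b k) * cpower (of_real (l k)) z)"
    unfolding lincomb_def using z by (simp only: sum_subtractf [symmetric] left_diff_distrib pw_sector)
  thus "norm (\<Sum>k\<in>insert n (F \<union> G). (a k - b k) * cpower (of_real (l k)) z) \<le> M"
    using bd[OF z] by simp
qed (use F G in auto)

text \<open>The power has n-th coefficient 1, a combination of the others has 0. If they were closer
  than the reciprocal of the constant at n, the coefficient estimate with \<eta> = 1 would force
  this difference below 1.\<close>

lemma minimal: "minimal_set \<alpha> (range pw)"
  unfolding minimal_set_def
proof (intro ballI notI)
  fix e assume e: "e \<in> range pw" "e \<in> closed_span \<alpha> (range pw - {e})"
  then obtain n where n: "e = pw n" by auto
  have "range pw - {e} = pw ` (- {n})" using inj_pw by (auto simp: n inj_eq)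
  with e have cl: "pw n \<in> closed_span \<alpha> (pw ` (- {n}))" by (simp add: n)
  obtain C where C: "C \<ge> 0" "coefficient_bound_const \<alpha> l 1 C"
    using estimate[of 1] by auto
  define \<epsilon> where "\<epsilon> = 1 / (2 * (C * exp (1 * l n) + 1))"
  have pos: "C * exp (1 * l n) + 1 > 0" using C(1) by (auto intro: add_nonneg_pos)
  have \<epsilon>: "\<epsilon> > 0" "C * exp (1 * l n) * \<epsilon> < 1"
  proof -
    show "\<epsilon> > 0" using pos by (simp add: \<epsilon>_def)
    hence "C * exp (1 * l n) * \<epsilon> \<le> (C * exp (1 * l n) + 1) * \<epsilon>" by (intro mult_right_mono) auto
    also have "\<dots> = 1 / 2" using pos by (simp add: \<epsilon>_def)
    finally show "C * exp (1 * l n) * \<epsilon> < 1" by simp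
  qed
  obtain F a where Fa: "finite F" "F \<subseteq> - {n}" "\<And>k. k \<notin> F \<Longrightarrow> a k = 0"
    "\<And>z. z \<in> sector \<alpha> \<Longrightarrow> norm (pw n z - lincomb F a z) \<le> \<epsilon>"
    using in_closure_approx[OF cl \<epsilon>(1)] by blast
  have "norm ((if n = n then 1 else 0) - a n) \<le> C * exp (1 * l n) * \<epsilon>"
  proof (rule coefficient_difference[OF C(2), where F = "{n}" and a = "\<lambda>k. if k = n then 1 else 0" and G = F and b = a])
    show "norm (lincomb {n} (\<lambda>k. if k = n then 1 else 0) z - lincomb F a z) \<le> \<epsilon>" if "z \<in> sector \<alpha>" for z
      using Fa(4)[OF that] by (simp add: lincomb_def)
  qed (use Fa in auto)
  moreover have "a n = 0" using Fa by blast
  ultimately show False using \<epsilon> by simp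
qed

lemma summable_exp:
  assumes "\<tau> > 0" shows "summable (\<lambda>k. exp (- \<tau> * l k))"
proof (rule summable_comparison_test')
  have "exp (- \<tau> * \<delta>) < 1" using assms \<delta> by simp
  thus "summable (\<lambda>k. exp (- \<tau> * \<delta>) ^ k)" by (intro summable_geometric) auto
  fix k :: nat
  have "\<tau> * (real k * \<delta>) \<le> \<tau> * l k" using assms growth by (intro mult_left_mono) auto
  thus "norm (exp (- \<tau> * l k)) \<le> exp (- \<tau> * \<delta>) ^ k" if "k \<ge> 0"
    by (simp add: exp_of_nat_mult [symmetric] mult_ac)
qed

text \<open>For each index the coefficients of the approximating sums are Cauchy, by the estimate
  applied to differences of these sums. The rate of its exponential factor can be made arbitrarily
  small, so for |z| < 1 it is beaten by the decay of the powers, and the limit may be taken under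
  the sum.\<close>

lemma series_expansion:
  assumes f: "f \<in> closed_span \<alpha> (range pw)"
  obtains a where "\<And>\<tau>. \<tau> > 0 \<Longrightarrow> summable (\<lambda>k. norm (a k) * exp (- \<tau> * l k))"
    "\<And>z. z \<in> sector \<alpha> \<Longrightarrow> norm z < 1 \<Longrightarrow> (\<lambda>k. a k * cpower (of_real (l k)) z) sums f z"
proof -
  define \<epsilon> where "\<epsilon> j = 1 / real (Suc j)" for j
  have \<epsilon>: "\<epsilon> j > 0" for j by (simp add: \<epsilon>_def)
  have \<epsilon>lim: "\<epsilon> \<longlonglongrightarrow> 0" unfolding \<epsilon>_def by (rule LIMSEQ_Suc[OF lim_1_over_n])
  have "\<forall>j. \<exists>Fa. finite (fst Fa) \<and> (\<forall>k. k \<notin> fst Fa \<longrightarrow> snd Fa k = 0) \<and>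
      (\<forall>z\<in>sector \<alpha>. norm (f z - lincomb (fst Fa) (snd Fa) z) \<le> \<epsilon> j)"
  proof
    fix j
    obtain F a where "finite F" "F \<subseteq> UNIV" "\<And>k. k \<notin> F \<Longrightarrow> a k = 0"
      "\<And>z. z \<in> sector \<alpha> \<Longrightarrow> norm (f z - lincomb F a z) \<le> \<epsilon> j"
      using in_closure_approx[OF f \<epsilon>[of j]] by blast
    thus "\<exists>Fa. finite (fst Fa) \<and> (\<forall>k. k \<notin> fst Fa \<longrightarrow> snd Fa k = 0) \<and>
      (\<forall>z\<in>sector \<alpha>. norm (f z - lincomb (fst Fa) (snd Fa) z) \<le> \<epsilon> j)"
      by (intro exI[of _ "(F, a)"]) auto
  qed
  then obtain Fa where Fa: "\<And>j. finite (fst (Fa j))" "\<And>j k. k \<notin> fst (Fa j) \<Longrightarrow> snd (Fa j) k = 0"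
      "\<And>j z. z \<in> sector \<alpha> \<Longrightarrow> norm (f z - lincomb (fst (Fa j)) (snd (Fa j)) z) \<le> \<epsilon> j" by metis
  define A where "A j = snd (Fa j)" for j
  define S where "S j = fst (Fa j)" for j
  have S: "finite (S j)" and A0: "k \<notin> S j \<Longrightarrow> A j k = 0"
    and fA: "z \<in> sector \<alpha> \<Longrightarrow> norm (f z - lincomb (S j) (A j) z) \<le> \<epsilon> j" for j k z
    using Fa by (auto simp: A_def S_def)
  \<comment> \<open>The constant is fixed as a function of the rate alone, so that it does not vary
    with i, j and n.\<close>
  have "\<exists>C. \<forall>\<eta>>0. C \<eta> \<ge> 0 \<and> (\<forall>i j n. norm (A i n - A j n) \<le> C \<eta> * exp (\<eta> * l n) * (\<epsilon> i + \<epsilon> j))"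
  proof (rule choice, rule allI)
    fix \<eta> :: real
    show "\<exists>C. \<eta> > 0 \<longrightarrow> C \<ge> 0 \<and> (\<forall>i j n. norm (A i n - A j n) \<le> C * exp (\<eta> * l n) * (\<epsilon> i + \<epsilon> j))"
    proof (cases "\<eta> > 0")
      case True
      obtain C where C: "C \<ge> 0" "coefficient_bound_const \<alpha> l \<eta> C"
        using estimate[OF True] by auto
      have "norm (A i n - A j n) \<le> C * exp (\<eta> * l n) * (\<epsilon> i + \<epsilon> j)" for i j n
      proof (rule coefficient_difference[OF C(2) S A0 S A0])
        fix z assume z: "z \<in> sector \<alpha>"
        have "norm ((f z - lincomb (S j) (A j) z) - (f z - lincomb (S i) (A i) z)) \<le> \<epsilon> j + \<epsilon> i"
          by (intro order_trans[OF norm_triangle_ineq4] add_mono fA z)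
        thus "norm (lincomb (S i) (A i) z - lincomb (S j) (A j) z) \<le> \<epsilon> i + \<epsilon> j" by (simp add: add.commute)
      qed
      with C(1) show ?thesis by blast
    qed auto
  qed
  then obtain C where C: "\<And>\<eta>. \<eta> > 0 \<Longrightarrow> C \<eta> \<ge> 0"
    "\<And>\<eta> i j n. \<eta> > 0 \<Longrightarrow> norm (A i n - A j n) \<le> C \<eta> * exp (\<eta> * l n) * (\<epsilon> i + \<epsilon> j)" by blast
  have "convergent (\<lambda>j. A j n)" for n
  proof (rule Cauchy_convergent, rule metric_CauchyI)
    fix e :: real assume e: "e > 0"
    define B where "B = C 1 * exp (1 * l n) + 1"
    have B: "B > 0" using C(1)[of 1] by (auto simp: B_def intro!: add_nonneg_pos)
    obtain N where N: "\<And>j. j \<ge> N \<Longrightarrow> \<epsilon> j < e / (2 * B)"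
      using order_tendstoD(2)[OF \<epsilon>lim, of "e / (2 * B)"] e B by (auto simp: eventually_sequentially)
    have "dist (A i n) (A j n) < e" if "i \<ge> N" "j \<ge> N" for i j
    proof -
      have "norm (A i n - A j n) \<le> C 1 * exp (1 * l n) * (\<epsilon> i + \<epsilon> j)" by (rule C(2)) simp
      also have "\<dots> \<le> B * (\<epsilon> i + \<epsilon> j)" using \<epsilon>[of i] \<epsilon>[of j] by (intro mult_right_mono) (auto simp: B_def)
      also have "\<dots> < B * (e / (2 * B) + e / (2 * B))" using N that B by (intro mult_strict_left_mono add_strict_mono) auto
      also have "\<dots> = e" using B by (simp add: field_simps)
      finally show ?thesis by (simp add: dist_norm)
    qed
    thus "\<exists>M. \<forall>m\<ge>M. \<forall>n'\<ge>M. dist (A m n) (A n' n) < e" by blast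
  qed
  then obtain a where a: "\<And>n. (\<lambda>j. A j n) \<longlonglongrightarrow> a n" unfolding convergent_def by metis
  have diff: "norm (a n - A j n) \<le> C \<eta> * exp (\<eta> * l n) * \<epsilon> j" if "\<eta> > 0" for \<eta> j n
  proof (rule tendsto_le[OF sequentially_bot])
    show "(\<lambda>i. norm (A i n - A j n)) \<longlonglongrightarrow> norm (a n - A j n)" by (intro tendsto_intros a)
    have "(\<lambda>i. C \<eta> * exp (\<eta> * l n) * (\<epsilon> i + \<epsilon> j)) \<longlonglongrightarrow> C \<eta> * exp (\<eta> * l n) * (0 + \<epsilon> j)"
      by (intro tendsto_intros \<epsilon>lim)
    thus "(\<lambda>i. C \<eta> * exp (\<eta> * l n) * (\<epsilon> i + \<epsilon> j)) \<longlonglongrightarrow> C \<eta> * exp (\<eta> * l n) * \<epsilon> j" by simp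
  qed (use C(2)[OF that] in auto)
  \<comment> \<open>The estimate is used at rate \<tau>/2: half of the weight cancels its growth,
    the other half leaves a summable majorant.\<close>
  have weighted: "norm (a k - A j k) * exp (- \<tau> * l k) \<le> C (\<tau> / 2) * \<epsilon> j * exp (- (\<tau> / 2) * l k)" if "\<tau> > 0" for \<tau> j k
  proof -
    have "norm (a k - A j k) * exp (- \<tau> * l k) \<le> C (\<tau> / 2) * exp (\<tau> / 2 * l k) * \<epsilon> j * exp (- \<tau> * l k)"
      using that by (intro mult_right_mono diff) auto
    also have "\<dots> = C (\<tau> / 2) * \<epsilon> j * (exp (\<tau> / 2 * l k) * exp (- \<tau> * l k))" by (simp only: mult_ac)
    also have "exp (\<tau> / 2 * l k) * exp (- \<tau> * l k) = exp (- (\<tau> / 2) * l k)" by (simp flip: exp_add)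
    finally show ?thesis .
  qed
  have summ_diff: "summable (\<lambda>k. norm (a k - A j k) * exp (- \<tau> * l k))" if "\<tau> > 0" for \<tau> j
  proof (rule summable_comparison_test')
    show "summable (\<lambda>k. C (\<tau> / 2) * \<epsilon> j * exp (- (\<tau> / 2) * l k))" using that by (intro summable_mult summable_exp) auto
    show "norm (norm (a k - A j k) * exp (- \<tau> * l k)) \<le> C (\<tau> / 2) * \<epsilon> j * exp (- (\<tau> / 2) * l k)" if "k \<ge> 0" for k
      using weighted[OF \<open>\<tau> > 0\<close>, of k j] by simp
  qed
  have summ: "summable (\<lambda>k. norm (a k) * exp (- \<tau> * l k))" if "\<tau> > 0" for \<tau>
  proof (rule summable_comparison_test')
    show "summable (\<lambda>k. norm (a k - A 0 k) * exp (- \<tau> * l k) + norm (A 0 k) * exp (- \<tau> * l k))"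
      by (intro summable_add summ_diff that summable_finite[OF S[of 0]]) (auto simp: A0)
    show "norm (norm (a k) * exp (- \<tau> * l k)) \<le> norm (a k - A 0 k) * exp (- \<tau> * l k) + norm (A 0 k) * exp (- \<tau> * l k)" for k
    proof -
      have "norm (a k) \<le> norm (a k - A 0 k) + norm (A 0 k)" by (metis diff_add_cancel norm_triangle_ineq)
      hence "norm (a k) * exp (- \<tau> * l k) \<le> (norm (a k - A 0 k) + norm (A 0 k)) * exp (- \<tau> * l k)"
        by (rule mult_right_mono) simp
      thus ?thesis by (simp add: algebra_simps)
    qed
  qed
  have sums: "(\<lambda>k. a k * cpower (of_real (l k)) z) sums f z" if z: "z \<in> sector \<alpha>" "norm z < 1" for z
  proof -
    obtain \<tau> where \<tau>: "\<tau> > 0" "norm z \<le> exp (- \<tau>)"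
    proof (cases "z = 0")
      case True
      thus ?thesis by (intro that[of 1]) auto
    next
      case False
      thus ?thesis using z(2) by (intro that[of "- ln (norm z)"]) auto
    qed
    define c where "c k = cpower (of_real (l k)) z" for k
    have c: "norm (c k) \<le> exp (- \<tau> * l k)" for k
      unfolding c_def by (rule norm_cpower_le[OF l_nonneg \<tau>(2)])
    have sa: "summable (\<lambda>k. a k * c k)"
    proof (rule summable_comparison_test'[OF summ[OF \<tau>(1)]])
      show "norm (a k * c k) \<le> norm (a k) * exp (- \<tau> * l k)" for k
        unfolding norm_mult by (intro mult_left_mono c) auto
    qed
    define B where "B = (\<Sum>k. exp (- (\<tau> / 2) * l k))"
    have le: "norm (f z - (\<Sum>k. a k * c k)) \<le> (1 + C (\<tau> / 2) * B) * \<epsilon> j" for j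
    proof -
      have lin: "(\<lambda>k. A j k * c k) sums lincomb (S j) (A j) z"
      proof -
        have "lincomb (S j) (A j) z = (\<Sum>k\<in>S j. A j k * c k)" by (simp add: lincomb_def c_def pw_sector z)
        thus ?thesis using sums_finite[OF S[of j], of "\<lambda>k. A j k * c k"] A0 by simp
      qed
      have "(\<lambda>k. (a k - A j k) * c k) sums ((\<Sum>k. a k * c k) - lincomb (S j) (A j) z)"
        using sums_diff[OF summable_sums[OF sa] lin] by (simp add: left_diff_distrib)
      hence eq: "(\<Sum>k. a k * c k) - lincomb (S j) (A j) z = (\<Sum>k. (a k - A j k) * c k)" by (simp add: sums_iff)
      have b: "norm ((a k - A j k) * c k) \<le> C (\<tau> / 2) * \<epsilon> j * exp (- (\<tau> / 2) * l k)" for k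
      proof -
        have "norm ((a k - A j k) * c k) \<le> norm (a k - A j k) * exp (- \<tau> * l k)"
          unfolding norm_mult by (intro mult_left_mono c) auto
        also have "\<dots> \<le> C (\<tau> / 2) * \<epsilon> j * exp (- (\<tau> / 2) * l k)" by (rule weighted[OF \<tau>(1)])
        finally show ?thesis .
      qed
      have se: "summable (\<lambda>k. exp (- (\<tau> / 2) * l k))" using \<tau> by (intro summable_exp) auto
      have "norm (\<Sum>k. (a k - A j k) * c k) \<le> (\<Sum>k. C (\<tau> / 2) * \<epsilon> j * exp (- (\<tau> / 2) * l k))"
        using b se by (intro norm_suminf_le summable_mult) auto
      also have "\<dots> = C (\<tau> / 2) * \<epsilon> j * B" unfolding B_def by (rule suminf_mult[OF se])
      finally have "norm ((\<Sum>k. a k * c k) - lincomb (S j) (A j) z) \<le> C (\<tau> / 2) * \<epsilon> j * B" unfolding eq .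
      moreover have "norm (f z - lincomb (S j) (A j) z) \<le> \<epsilon> j" by (rule fA[OF z(1)])
      ultimately have "norm ((f z - lincomb (S j) (A j) z) - ((\<Sum>k. a k * c k) - lincomb (S j) (A j) z)) \<le> \<epsilon> j + C (\<tau> / 2) * \<epsilon> j * B"
        using norm_triangle_ineq4[of "f z - lincomb (S j) (A j) z" "(\<Sum>k. a k * c k) - lincomb (S j) (A j) z"] by linarith
      thus ?thesis by (simp add: algebra_simps)
    qed
    have "(\<lambda>j. (1 + C (\<tau> / 2) * B) * \<epsilon> j) \<longlonglongrightarrow> (1 + C (\<tau> / 2) * B) * 0" by (intro tendsto_intros \<epsilon>lim)
    hence "norm (f z - (\<Sum>k. a k * c k)) \<le> (1 + C (\<tau> / 2) * B) * 0"
      by (rule tendsto_lowerbound) (use le in auto)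
    hence "f z = (\<Sum>k. a k * c k)" by simp
    thus ?thesis using summable_sums[OF sa] by (simp add: c_def)
  qed
  show ?thesis by (rule that[OF summ sums])
qed

text \<open>The exponents are real, so the modulus of a power depends only on that of z. Weighted
  summability of the coefficients therefore gives uniform convergence on small closed discs anywhere
  in the slit disc.\<close>

lemma series_holomorphic:
  assumes summ: "\<And>\<tau>. \<tau> > 0 \<Longrightarrow> summable (\<lambda>k. norm (a k) * exp (- \<tau> * l k))"
  shows "(\<lambda>z. \<Sum>k. a k * cpower (of_real (l k)) z) holomorphic_on slit_disc"
proof (rule holomorphic_uniform_sequence[OF open_slit_disc])
  show "(\<lambda>z. \<Sum>k<n. a k * cpower (of_real (l k)) z) holomorphic_on slit_disc" for n
    by (intro holomorphic_intros cpower_holomorphic_slit_disc)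
  fix z assume z: "z \<in> slit_disc"
  obtain d0 where d0: "d0 > 0" "cball z d0 \<subseteq> slit_disc" using open_slit_disc z by (meson open_contains_cball)
  define d where "d = min d0 ((1 - norm z) / 2)"
  have nz: "norm z < 1" using z by (simp add: in_slit_disc_iff)
  have d: "d > 0" "cball z d \<subseteq> slit_disc" using d0 nz by (auto simp: d_def)
  define \<tau> where "\<tau> = - ln ((1 + norm z) / 2)"
  have half: "0 < (1 + norm z) / 2" by (intro divide_pos_pos add_pos_nonneg) auto
  have \<tau>: "\<tau> > 0" using nz half by (simp add: \<tau>_def)
  have nb: "norm w \<le> exp (- \<tau>)" if "w \<in> cball z d" for w
  proof -
    have "norm w \<le> norm z + dist z w" by (metis dist_norm norm_minus_commute norm_triangle_sub add.commute)
    also have "dist z w \<le> (1 - norm z) / 2" using that by (simp add: d_def)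
    finally show ?thesis using half by (simp add: \<tau>_def field_simps)
  qed
  have "uniform_limit (cball z d) (\<lambda>n w. \<Sum>k<n. a k * cpower (of_real (l k)) w) (\<lambda>w. \<Sum>k. a k * cpower (of_real (l k)) w) sequentially"
  proof (rule Weierstrass_m_test[OF _ summ[OF \<tau>]])
    fix k w assume "w \<in> cball z d"
    thus "norm (a k * cpower (of_real (l k)) w) \<le> norm (a k) * exp (- \<tau> * l k)"
      unfolding norm_mult by (intro mult_left_mono norm_cpower_le l_nonneg nb) auto
  qed
  thus "\<exists>d>0. cball z d \<subseteq> slit_disc \<and> uniform_limit (cball z d) (\<lambda>n z. \<Sum>k<n. a k * cpower (of_real (l k)) z) (\<lambda>z. \<Sum>k. a k * cpower (of_real (l k)) z) sequentially"
    using d by blast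
qed

end

text \<open>Shifting t by s leaves the limit unchanged but multiplies it by exp(- s \<nu>), so this
  factor is 1 for every real s. Then s = 1 gives Re \<nu> = 0, and for Im \<nu> \<noteq> 0 the
  choice s = \<pi> / Im \<nu> would give -1.\<close>

lemma exp_limit_at_top_nonzero:
  fixes \<nu> a :: complex
  assumes lim: "((\<lambda>t::real. exp (- of_real t * \<nu>)) \<longlongrightarrow> a) at_top" and a: "a \<noteq> 0"
  shows "\<nu> = 0"
proof -
  have period: "exp (- of_real s * \<nu>) = 1" for s :: real
  proof -
    have "((\<lambda>t::real. exp (- of_real (t + s) * \<nu>)) \<longlongrightarrow> a) at_top"
      by (rule filterlim_compose[OF lim]) real_asymp
    moreover have "(\<lambda>t::real. exp (- of_real (t + s) * \<nu>)) = (\<lambda>t. exp (- of_real t * \<nu>) * exp (- of_real s * \<nu>))"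
      by (simp add: fun_eq_iff exp_add [symmetric] algebra_simps)
    moreover have "((\<lambda>t::real. exp (- of_real t * \<nu>) * exp (- of_real s * \<nu>)) \<longlongrightarrow> a * exp (- of_real s * \<nu>)) at_top"
      by (intro tendsto_intros lim)
    ultimately have "a = a * exp (- of_real s * \<nu>)"
      using tendsto_unique[OF trivial_limit_at_top_linorder] by metis
    thus ?thesis using a by simp
  qed
  have "exp (- Re \<nu>) = norm (exp (- of_real 1 * \<nu>))" by simp
  hence re: "Re \<nu> = 0" unfolding period by simp
  have "Im \<nu> = 0"
  proof (rule ccontr)
    assume im: "Im \<nu> \<noteq> 0"
    have "- of_real (pi / Im \<nu>) * \<nu> = - (\<i> * of_real pi)"
      using re im by (simp add: complex_eq_iff)
    hence "exp (- (\<i> * of_real pi)) = (1 :: complex)" using period[of "pi / Im \<nu>"] by simp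
    thus False by (simp add: exp_minus)
  qed
  with re show ?thesis by (simp add: complex_eq_iff)
qed

context coefficient_system
begin

text \<open>Put x = exp(- t) and divide the series by its first term with a nonzero coefficient,
  apart from that coefficient. As t grows the later terms vanish because of the gaps, so exp(- t
  \<nu>) tends to a nonzero number, where \<nu> is the difference of the two exponents; this forces
  \<nu> = 0.\<close>

lemma power_in_closure:
  assumes \<mu>: "Re \<mu> > 0" and cl: "H_power \<alpha> \<mu> \<in> closed_span \<alpha> (range pw)"
  shows "\<exists>n\<ge>1. \<mu> = of_real (l n)"
proof -
  obtain a where summ: "\<And>\<tau>. \<tau> > 0 \<Longrightarrow> summable (\<lambda>k. norm (a k) * exp (- \<tau> * l k))"
    and sums: "\<And>z. z \<in> sector \<alpha> \<Longrightarrow> norm z < 1 \<Longrightarrow> (\<lambda>k. a k * cpower (of_real (l k)) z) sums H_power \<alpha> \<mu> z"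
    using series_expansion[OF cl] by blast
  have \<mu>0: "\<mu> \<noteq> 0" using \<mu> by auto
  have S: "(\<lambda>k. a k * exp (- of_real t * of_real (l k))) sums exp (- of_real t * \<mu>)" if t: "t > 0" for t :: real
  proof -
    define z where "z = (of_real (exp (- t)) :: complex)"
    have z: "z \<in> sector \<alpha>" "norm z < 1" using t \<alpha> of_real_in_sector[of \<alpha> "exp (- t)"] by (auto simp: z_def)
    have Lnz: "Ln z = - of_real t" by (simp add: z_def Ln_of_real)
    have z0: "z \<noteq> 0" by (simp add: z_def)
    have cp: "cpower \<nu> z = exp (- of_real t * \<nu>)" for \<nu>
      using z0 by (simp add: cpower_def powr_def Lnz mult.commute)
    show ?thesis using sums[OF z] z by (simp add: H_power_def cp)
  qed
  have "\<exists>k. a k \<noteq> 0"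
  proof (rule ccontr)
    assume "\<nexists>k. a k \<noteq> 0"
    hence "(\<lambda>k. 0) sums exp (- of_real 1 * \<mu>)" using S[of 1] by simp
    thus False by (simp add: sums_iff)
  qed
  define k0 where "k0 = (LEAST k. a k \<noteq> 0)"
  have k0: "a k0 \<noteq> 0" using \<open>\<exists>k. a k \<noteq> 0\<close> unfolding k0_def by (rule LeastI_ex)
  have below: "a k = 0" if "k < k0" for k using not_less_Least[of k "\<lambda>k. a k \<noteq> 0"] that by (auto simp: k0_def)
  define \<nu> where "\<nu> = \<mu> - of_real (l k0)"
  define B where "B = (\<Sum>k. norm (a k) * exp (- 1 * l k))"
  \<comment> \<open>From exp(- t * l k) one factor exp(- l k) is kept to sum the series; the
    remaining t - 1 acts on the gap l k - l k0 \<ge> \<delta> for k > k0.\<close>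
  have bound: "norm (exp (- of_real t * \<nu>) - a k0) \<le> exp (l k0) * exp (- (t - 1) * \<delta>) * B" if t: "t \<ge> 1" for t :: real
  proof -
    define c where "c k = a k * exp (- of_real t * of_real (l k)) * exp (of_real t * of_real (l k0))" for k
    have "c sums (exp (- of_real t * \<mu>) * exp (of_real t * of_real (l k0)))"
      unfolding c_def using t by (intro sums_mult2 S) auto
    moreover have "exp (- of_real t * \<mu>) * exp (of_real t * of_real (l k0)) = exp (- of_real t * \<nu>)"
      by (simp add: \<nu>_def exp_add [symmetric] algebra_simps)
    ultimately have "c sums exp (- of_real t * \<nu>)" by simp
    hence d: "(\<lambda>k. c k - (if k = k0 then a k0 else 0)) sums (exp (- of_real t * \<nu>) - a k0)"
      by (intro sums_diff sums_single)
    have ck0: "c k0 = a k0" by (simp add: c_def mult.assoc exp_add [symmetric])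
    have each: "norm (c k - (if k = k0 then a k0 else 0)) \<le> exp (l k0) * exp (- (t - 1) * \<delta>) * (norm (a k) * exp (- 1 * l k))" for k
    proof (cases "k > k0")
      case True
      have "(t - 1) * \<delta> \<le> (t - 1) * (l k - l k0)" using t gap[OF True] by (intro mult_left_mono) auto
      hence ex: "- t * l k + t * l k0 \<le> l k0 + - (t - 1) * \<delta> + - 1 * l k" by (simp add: algebra_simps)
      have "norm (c k) = norm (a k) * exp (- t * l k + t * l k0)"
        by (simp add: c_def norm_mult mult.assoc exp_add [symmetric])
      also have "\<dots> \<le> norm (a k) * exp (l k0 + - (t - 1) * \<delta> + - 1 * l k)" using ex by (intro mult_left_mono) auto
      also have "\<dots> = exp (l k0) * exp (- (t - 1) * \<delta>) * (norm (a k) * exp (- 1 * l k))" by (simp only: exp_add mult_ac)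
      finally show ?thesis using True by simp
    next
      case False
      show ?thesis
      proof (cases "k = k0")
        case True
        thus ?thesis by (simp add: ck0)
      next
        case False
        with \<open>\<not> k > k0\<close> have "a k = 0" by (intro below) auto
        thus ?thesis using False by (simp add: c_def)
      qed
    qed
    have "summable (\<lambda>k. norm (a k) * exp (- 1 * l k))" by (rule summ) simp
    hence "norm (\<Sum>k. c k - (if k = k0 then a k0 else 0)) \<le> (\<Sum>k. exp (l k0) * exp (- (t - 1) * \<delta>) * (norm (a k) * exp (- 1 * l k)))"
      by (intro norm_suminf_le each summable_mult)
    also have "\<dots> = exp (l k0) * exp (- (t - 1) * \<delta>) * B" unfolding B_def by (intro suminf_mult summ) simp
    also have "(\<Sum>k. c k - (if k = k0 then a k0 else 0)) = exp (- of_real t * \<nu>) - a k0" using d by (simp add: sums_iff)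
    finally show ?thesis .
  qed
  have "((\<lambda>t::real. exp (- of_real t * \<nu>) - a k0) \<longlongrightarrow> 0) at_top"
  proof (rule Lim_null_comparison)
    show "eventually (\<lambda>t. norm (exp (- of_real t * \<nu>) - a k0) \<le> exp (l k0) * exp (- (t - 1) * \<delta>) * B) at_top"
      using eventually_ge_at_top[of 1] by eventually_elim (rule bound)
    have "((\<lambda>t. exp (- (t - 1) * \<delta>)) \<longlongrightarrow> 0) at_top" using \<delta> by real_asymp
    hence "((\<lambda>t. exp (l k0) * exp (- (t - 1) * \<delta>) * B) \<longlongrightarrow> exp (l k0) * 0 * B) at_top" by (intro tendsto_intros)
    thus "((\<lambda>t. exp (l k0) * exp (- (t - 1) * \<delta>) * B) \<longlongrightarrow> 0) at_top" by simp
  qed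
  hence "((\<lambda>t::real. exp (- of_real t * \<nu>)) \<longlongrightarrow> a k0) at_top" by (simp add: LIM_zero_iff)
  hence "\<nu> = 0" using k0 by (rule exp_limit_at_top_nonzero)
  hence eq: "\<mu> = of_real (l k0)" by (simp add: \<nu>_def)
  \<comment> \<open>Index 0 carries the exponent 0, whose real part is not positive.\<close>
  have "k0 \<noteq> 0" using eq \<mu>0 l0 by (intro notI) simp
  with eq show ?thesis by (intro exI[of _ k0]) auto
qed

end

theorem theorem1:
  fixes \<alpha> :: real and l :: "nat \<Rightarrow> real"
  assumes "0 \<le> \<alpha>" and "\<alpha> < pi"
    and "l 0 = 0"
    and "\<And>n. n \<ge> 1 \<Longrightarrow> 0 < l n"
    and "mono l"
    and "min_gap l > 0"
    and "\<exists>\<epsilon> :: real \<Rightarrow> real. antimono_on {0..} \<epsilon> \<and> (\<epsilon> \<longlongrightarrow> 0) at_top \<and>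
           (\<forall>x y. 1 \<le> x \<and> x < y \<longrightarrow>
              char_log l y - char_log l x \<le> \<alpha> / pi * ln y - \<alpha> / pi * ln x + \<epsilon> x)"
  shows "minimal_set \<alpha> (power_system \<alpha> l) \<and>
    (\<forall>\<mu>::complex. Re \<mu> > 0 \<and> \<mu> \<notin> (\<lambda>n. of_real (l n)) ` {1..} \<longrightarrow>
       H_power \<alpha> \<mu> \<notin> closed_span \<alpha> (power_system \<alpha> l)) \<and>
    (\<forall>f \<in> closed_span \<alpha> (power_system \<alpha> l).
       (\<exists>g. g analytic_on slit_disc \<and> (\<forall>z \<in> sector \<alpha> \<inter> slit_disc. g z = f z)) \<and>
       (\<exists>a :: nat \<Rightarrow> complex. \<forall>x::real. 0 \<le> x \<and> x < 1 \<longrightarrow>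
          (\<lambda>k. a k * cpower (of_real (l k)) (of_real x)) sums f (of_real x)))"
proof -
  obtain \<epsilon> :: "real \<Rightarrow> real" where \<epsilon>: "(\<epsilon> \<longlongrightarrow> 0) at_top"
    "\<And>x y. 1 \<le> x \<Longrightarrow> x < y \<Longrightarrow> char_log l y - char_log l x \<le> \<alpha> / pi * ln y - \<alpha> / pi * ln x + \<epsilon> x"
    using assms(7) by blast
  interpret coefficient_system \<alpha> l "min_gap l"
  proof
    show "l n - l m \<ge> min_gap l" if "m < n" for m n by (rule min_gap_le(1)[OF assms(5,6) that])
    show "l n \<ge> real n * min_gap l" for n using min_gap_le(2)[OF assms(5,6), of n] assms(3) by simp
    show "\<exists>C\<ge>0. coefficient_bound_const \<alpha> l \<eta> C" if "\<eta> > 0" for \<eta>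
      by (rule power_coefficient_estimate[OF assms(1-6) \<epsilon> that])
  qed (use assms in auto)
  have ps: "power_system \<alpha> l = range pw" by (simp add: power_system_def pw_def [abs_def])
  show ?thesis
    unfolding ps
  proof (intro conjI allI impI ballI)
    show "minimal_set \<alpha> (range pw)" by (rule minimal)
    show "H_power \<alpha> \<mu> \<notin> closed_span \<alpha> (range pw)" if "Re \<mu> > 0 \<and> \<mu> \<notin> (\<lambda>n. of_real (l n)) ` {1..}" for \<mu>
      using power_in_closure[of \<mu>] that by auto
    fix f assume "f \<in> closed_span \<alpha> (range pw)"
    then obtain a where summ: "\<And>\<tau>. \<tau> > 0 \<Longrightarrow> summable (\<lambda>k. norm (a k) * exp (- \<tau> * l k))"
      and sums: "\<And>z. z \<in> sector \<alpha> \<Longrightarrow> norm z < 1 \<Longrightarrow> (\<lambda>k. a k * cpower (of_real (l k)) z) sums f z"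
      using series_expansion by blast
    show "\<exists>g. g analytic_on slit_disc \<and> (\<forall>z \<in> sector \<alpha> \<inter> slit_disc. g z = f z)"
    proof (intro exI conjI ballI)
      show "(\<lambda>z. \<Sum>k. a k * cpower (of_real (l k)) z) analytic_on slit_disc"
        using series_holomorphic[OF summ] by (simp add: analytic_on_open open_slit_disc)
      show "(\<Sum>k. a k * cpower (of_real (l k)) z) = f z" if "z \<in> sector \<alpha> \<inter> slit_disc" for z
        using sums[of z] that by (auto simp: in_slit_disc_iff sums_iff)
    qed
    show "\<exists>a :: nat \<Rightarrow> complex. \<forall>x::real. 0 \<le> x \<and> x < 1 \<longrightarrow>
          (\<lambda>k. a k * cpower (of_real (l k)) (of_real x)) sums f (of_real x)"
      \<comment> \<open>The point x = 0 is included: there \<open>cpower\<close> is 1 for the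
        exponent 0 and 0 for all others.\<close>
      using sums of_real_in_sector[OF assms(1)] by (intro exI[of _ a]) auto
  qed
qed

end
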